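(* Let $X$ be a uniformly convex real Banach space whose norm is $C^1$ on $X\setminus\{0\}$, let $1<\alpha<\eta<\beta$, and let $N,A,B\in C^1(X)$ be even functionals that are $\eta$-homogeneous, $\alpha$-homogeneous and $\beta$-homogeneous, respectively. For $\lambda\in\mathbb{R}$ put $$\Phi_\lambda(u)=\frac1\eta N(u)-\frac\lambda\alpha A(u)-\frac1\beta B(u),\quad u\in X.$$ Assume that there exist $C,C'>0$ such that $C'\|u\|^\eta\ge N(u)\ge C^{-1}\|u\|^\eta$, $|A(u)|\le C\|u\|^\alpha$ and $|B(u)|\le C\|u\|^\beta$ for all $u\in X$. Assume also that whenever $(\lambda_n)\subset\mathbb{R}$ and $(u_n)\subset X$ are bounded sequences such that $(\Phi_{\lambda_n}(u_n))$ is bounded and $\Phi_{\lambda_n}'(u_n)\to0$, then $(u_n)$ has a convergent subsequence. Let $\mathcal{C}_{-A}=\{u\in X:A(u)<0\}$ and $\mathcal{C}_B=\{u\in X:B(u)>0\}$. Then there exist $\overline{c}^*<0<\overline{c}^{**}$ such that: i) For any $1\le k\le\gamma(\mathcal{C}_{-A})$ and $c\in(\overline{c}^*,0)$ there exist $\lambda_{c,k}^-<0$ and $v_{c,k}\in\mathcal{C}_{-A}$ such that $\Phi_{\lambda_{c,k}^-}(v_{c,k})=c$ and $\Phi_{\lambda_{c,k}^-}'(v_{c,k})=0$. ii) For each $1\le k\le\gamma(\mathcal{C}_{-A})$ the map $c\mapsto\lambda_{c,k}^-$ is continuous and increasing in $(\overline{c}^*,0)$, and satisfies $\lim_{c\to0^-}\lambda_{c,k}^-=0$.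 iii) If $\gamma(\mathcal{C}_{-A})=\infty$ then, for any $c\in(\overline{c}^*,0)$, $\lambda_{c,k}^-\ge\lambda_{c,k+1}^-$ for all $k$ and $\lambda_{c,k}^-\to-\infty$ as $k\to\infty$. iv) If $\gamma(\mathcal{C}_{-A})=\infty$ then for any $\lambda<0$ there exist sequences $(v_n)\subset\mathcal{C}_{-A}$, $(c_n)\subset(\overline{c}^*,0)$ and $(k_n)\subset\mathbb{N}$ such that $c_n\to0$, $k_n\to\infty$, and $\lambda=\lambda_{c_n,k_n}^-$, $\Phi_{\lambda}(v_n)=c_n$, $\Phi_{\lambda}'(v_n)=0$ for every $n$. Moreover $v_n\to0$ in $X$, so $(\lambda,0)$ is a bifurcation point for any $\lambda<0$. v) For any $1\le k\le\gamma(\mathcal{C}_{-A}\cap\mathcal{C}_B)$ and $c\in(\overline{c}^*,\overline{c}^{**})$ there exist $\lambda_{c,k}^+<0$ and $u_{c,k}\in\mathcal{C}_{-A}\cap\mathcal{C}_B$ such that $\Phi_{\lambda_{c,k}^+}(u_{c,k})=c$ and $\Phi_{\lambda_{c,k}^+}'(u_{c,k})=0$. Moreover $\lambda_{c,k}^+<\lambda_{c,k}^-$ for all $c\in(\overline{c}^*,0)$. vi) For any $1\le k\le\gamma(\mathcal{C}_{-A}\cap\mathcal{C}_B)$ the map $c\mapsto\lambda_{c,k}^+$ is continuous and increasing in $(\overline{c}^*,\overline{c}^{**})$. vii) If $\gamma(\mathcal{C}_{-A}\cap\mathcal{C}_B)=\infty$ then, for any $c\in(\overline{c}^*,\overline{c}^{**})$,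 $\lambda_{c,k}^+\ge\lambda_{c,k+1}^+$ for all $k$ and $\lambda_{c,k}^+\to-\infty$ as $k\to\infty$. (The families $(\lambda^{\pm}_{c,k})$ in ii)--iv) and vi)--vii) are the ones whose existence is asserted in i) and v).)
   Context: $F$ is $q$-homogeneous if $F(tu)=t^qF(u)$ for all $t>0$, $u\in X$. "Increasing" means strictly increasing. For a symmetric open cone $\mathcal{C}\subset X\setminus\{0\}$, $\gamma(\mathcal{C})=\sup\{k\in\mathbb{N}:\text{there is a compact symmetric } M\subset\mathcal{C}\text{ with }\gamma(M)\ge k\}\in\{0,1,2,\dots\}\cup\{\infty\}$, where $\gamma(M)$ is the Krasnoselskii genus: the least $m$ such that there is an odd continuous map $M\to\mathbb{R}^m\setminus\{0\}$ ($\infty$ if none exists). When $\gamma(\mathcal{C})=\infty$, "$1\le k\le\gamma(\mathcal{C})$" means $k\in\mathbb{N}$. $(\lambda,0)$ is a bifurcation point if there are $(\lambda_n,u_n)\in\mathbb{R}\times(X\setminus\{0\})$ with $\Phi_{\lambda_n}'(u_n)=0$, $\lambda_n\to\lambda$ and $u_n\to0$ in $X$. *)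

theory Defs
  imports "HOL-Analysis.Analysis"
begin

definition uniformly_convex :: "'a::real_normed_vector itself \<Rightarrow> bool" where
  "uniformly_convex _ \<longleftrightarrow>
     (\<forall>\<epsilon>>0. \<exists>\<delta>>0. \<forall>x y :: 'a. norm x = 1 \<and> norm y = 1 \<and> norm (x - y) \<ge> \<epsilon>
        \<longrightarrow> norm ((x + y) /\<^sub>R 2) \<le> 1 - \<delta>)"

(* The Frechet derivative as an element of the dual space, so that limits of derivatives are
   taken in the dual norm. Meaningful only where f is differentiable. *)
definition fderiv :: "('a::real_normed_vector \<Rightarrow> real) \<Rightarrow> 'a \<Rightarrow> 'a \<Rightarrow>\<^sub>L real" where
  "fderiv f u = Blinfun (frechet_derivative f (at u))"

(* Intended for open S. *)
definition C1_on :: "'a::real_normed_vector set \<Rightarrow> ('a \<Rightarrow> real) \<Rightarrow> bool" where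
  "C1_on S f \<longleftrightarrow> (\<forall>u\<in>S. f differentiable (at u)) \<and> continuous_on S (fderiv f)"

definition even_functional :: "('a::real_vector \<Rightarrow> real) \<Rightarrow> bool" where
  "even_functional F \<longleftrightarrow> (\<forall>u. F (- u) = F u)"

definition homogeneous :: "real \<Rightarrow> ('a::real_vector \<Rightarrow> real) \<Rightarrow> bool" where
  "homogeneous q F \<longleftrightarrow> (\<forall>t>0. \<forall>u. F (t *\<^sub>R u) = t powr q * F u)"

(* Krasnoselskii genus. Euclidean_space m is R^m realised as the real sequences vanishing from
   index m on; the infimum of the empty set is infinity. *)
definition genus :: "'a::real_normed_vector set \<Rightarrow> enat" where
  "genus M = Inf {enat m |m. \<exists>f. continuous_map (top_of_set M) (Euclidean_space m) f \<and>
                   (\<forall>u\<in>M. f (- u) = (\<lambda>i. - f u i)) \<and> (\<forall>u\<in>M. f u \<noteq> (\<lambda>i. 0))}"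

definition cone_genus :: "'a::real_normed_vector set \<Rightarrow> enat" where
  "cone_genus K = Sup {enat k |k. \<exists>M. compact M \<and> (\<forall>u\<in>M. - u \<in> M) \<and> M \<subseteq> K \<and> enat k \<le> genus M}"

definition Phi :: "real \<Rightarrow> real \<Rightarrow> real \<Rightarrow> ('a \<Rightarrow> real) \<Rightarrow> ('a \<Rightarrow> real) \<Rightarrow> ('a \<Rightarrow> real) \<Rightarrow> real \<Rightarrow> 'a \<Rightarrow> real"
  where "Phi \<eta> \<alpha> \<beta> N A B lam u = 1 / \<eta> * N u - lam / \<alpha> * A u - 1 / \<beta> * B u"

definition bifurcation_point :: "(real \<Rightarrow> 'a::real_normed_vector \<Rightarrow> real) \<Rightarrow> real \<Rightarrow> bool" where
  "bifurcation_point \<Phi> lam \<longleftrightarrow>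
     (\<exists>(l :: nat \<Rightarrow> real) (u :: nat \<Rightarrow> 'a).
        (\<forall>n. u n \<noteq> 0 \<and> fderiv (\<Phi> (l n)) (u n) = 0) \<and> l \<longlonglongrightarrow> lam \<and> u \<longlonglongrightarrow> 0)"

end

theory Submission
  imports Defs
begin

text \<open>
  For fixed energy \<open>c\<close> and \<open>A u \<noteq> 0\<close> the equation \<open>\<Phi> \<lambda> u = c\<close> has the unique solution \<open>\<lambda> = lam c u\<close>, and the
  critical points of \<open>lam c\<close> are exactly the critical points of \<open>\<Phi> \<lambda>\<close> of energy \<open>c\<close>. Along a ray in
  \<open>A < 0\<close> the function \<open>lam c\<close> has a local maximum inside a fixed ball if \<open>c < 0\<close> is small, and if also
  \<open>B > 0\<close> a local minimum further out. Its values there are even \<open>0\<close>-homogeneous \<open>C\<^sup>1\<close> functions of the ray,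
  and \<open>\<lambda>\<^sup>\<plusminus>\<close> are their max-min levels over compact symmetric sets of genus at least \<open>k\<close>.

  No deformation flow is used. Given a nearly optimal compact set \<open>M\<close>, Ekeland's principle is applied
  on the complete space of bounded odd perturbations of the identity, with the minimum over the image of
  \<open>M\<close> as objective; if no point near the minimal level were almost critical, one step along an odd
  pseudo-gradient would improve the objective. That the levels tend to \<open>-\<infinity>\<close> follows by the same
  argument on the part of \<open>M\<close> where finitely many odd functions vanish which have no common zero on the
  critical set of the limiting level.
\<close>

section \<open>The genus\<close>

text \<open>The reduced functionals live on open cones, so an optimising sequence might leave
  through the boundary. This is why the minimum over a set is maximised: a lower bound on \<lambda>
  at a fibre critical point keeps \<open>- A\<close>, and in the second family also
  \<open>B\<close>, away from zero relative to the norm, so superlevel sets are closed in the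
  annulus 1/2 \<le> |u| \<le> 3/2. By 0-homogeneity this annulus replaces the unit sphere, and
  perturbations smaller than 1/2 need no retraction.

  The critical parameter on a ray is only shown to be continuous. The reduced functional is
  differentiable nevertheless, by an envelope argument based on extremality.

  All constants come from one radius \<tau>, below which the \<eta>-homogeneous term dominates the
  \<beta>-homogeneous one. For energies above \<open>cs\<close> the function \<open>G c\<close> is
  positive for \<tau>/2 \<le> |v| \<le> \<tau>. This separates the two zeros on a ray and makes the
  two families comparable when c < 0.\<close>

definition symset :: "'a::real_vector set \<Rightarrow> bool" where
  "symset M \<longleftrightarrow> (\<forall>u\<in>M. - u \<in> M)"

lemma symsetD: "symset M \<Longrightarrow> u \<in> M \<Longrightarrow> - u \<in> M"
  by (simp add: symset_def)

lemma genus_le: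
  assumes "continuous_map (top_of_set M) (Euclidean_space m) f"
    and "\<And>u. u \<in> M \<Longrightarrow> f (- u) = (\<lambda>i. - f u i)" and "\<And>u. u \<in> M \<Longrightarrow> f u \<noteq> (\<lambda>i. 0)"
  shows "genus M \<le> enat m"
  unfolding genus_def using assms by (intro Inf_lower) blast

lemma genus_lessE:
  assumes "genus M < enat k"
  obtains m f where "m < k" "continuous_map (top_of_set M) (Euclidean_space m) f"
    "\<And>u. u \<in> M \<Longrightarrow> f (- u) = (\<lambda>i. - f u i)" "\<And>u. u \<in> M \<Longrightarrow> f u \<noteq> (\<lambda>i. 0)"
  using assms unfolding genus_def Inf_less_iff by fastforce

lemma genus_empty: "genus {} = 0"
proof -
  have "genus {} \<le> enat 0"
    by (rule genus_le[where f = "\<lambda>u i. 0"]) auto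
  then show ?thesis by (simp flip: zero_enat_def)
qed

text \<open>An odd map without zeros on the image pulls back along \<open>h\<close>; hence the genus
  cannot drop under an odd continuous deformation.\<close>

lemma genus_image:
  assumes h: "continuous_on M h" and odd: "\<And>u. u \<in> M \<Longrightarrow> h (- u) = - h u"
  shows "genus M \<le> genus (h ` M)"
proof (rule ccontr)
  assume "\<not> ?thesis"
  then have less: "genus (h ` M) < genus M" by simp
  then obtain k where "genus (h ` M) = enat k"
    by (cases "genus (h ` M)") auto
  with less have "genus (h ` M) < enat (Suc k)" by simp
  then obtain m f where m: "m < Suc k" and f: "continuous_map (top_of_set (h ` M)) (Euclidean_space m) f"
    and o: "\<And>u. u \<in> h ` M \<Longrightarrow> f (- u) = (\<lambda>i. - f u i)"
    and n: "\<And>u. u \<in> h ` M \<Longrightarrow> f u \<noteq> (\<lambda>i. 0)"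
    by (rule genus_lessE) (rule that)
  have "continuous_map (top_of_set M) (top_of_set (h ` M)) h"
    using h by (auto simp: continuous_map_in_subtopology)
  then have "continuous_map (top_of_set M) (Euclidean_space m) (f \<circ> h)"
    using f by (rule continuous_map_compose)
  then have "genus M \<le> enat m"
    by (rule genus_le) (auto simp: odd o n)
  also have "\<dots> \<le> genus (h ` M)"
    using m \<open>genus (h ` M) = enat k\<close> by simp
  finally show False using less by simp
qed

lemma continuous_map_Euclidean_space_component:
  assumes "continuous_map X (Euclidean_space m) f"
  shows "continuous_map X euclideanreal (\<lambda>x. f x i)" and "x \<in> topspace X \<Longrightarrow> i \<ge> m \<Longrightarrow> f x i = 0"
proof -
  have *: "continuous_map X (powertop_real UNIV) f" "f \<in> topspace X \<rightarrow> {x. \<forall>i\<ge>m. x i = 0}"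
    using assms unfolding Euclidean_space_def continuous_map_in_subtopology by auto
  then show "continuous_map X euclideanreal (\<lambda>x. f x i)"
    by (auto simp: continuous_map_componentwise_UNIV)
  show "x \<in> topspace X \<Longrightarrow> i \<ge> m \<Longrightarrow> f x i = 0" using *(2) by (auto simp: Pi_iff)
qed

text \<open>The Tietze extension \<open>e\<close> need not be odd, but its odd part is, and on the
  symmetric set \<open>S\<close> it still equals \<open>g\<close>.\<close>

lemma odd_extension:
  fixes g :: "'a::real_normed_vector \<Rightarrow> real"
  assumes "closed S" "symset S" "continuous_on S g" "\<And>u. u \<in> S \<Longrightarrow> g (- u) = - g u"
  shows "\<exists>h. continuous_on UNIV h \<and> (\<forall>u. h (- u) = - h u) \<and> (\<forall>u\<in>S. h u = g u)"
proof -
  have "normal_space (euclidean :: 'a topology)"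
    by (simp add: metrizable_imp_normal_space metrizable_space_euclidean)
  then obtain e where e: "continuous_map (euclidean :: 'a topology) euclideanreal e" "\<And>u. u \<in> S \<Longrightarrow> e u = g u"
    using assms(1,3) unfolding normal_space_iff_Tietze
    by (metis closed_closedin continuous_map_iff_continuous)
  then have ce: "continuous_on UNIV e" by simp
  show ?thesis
  proof (intro exI[of _ "\<lambda>u. (e u - e (- u)) / 2"] conjI allI ballI)
    show "continuous_on UNIV (\<lambda>u. (e u - e (- u)) / 2)"
      by (intro continuous_intros continuous_on_compose2[OF ce]) auto
    show "(e (- u) - e (- (- u))) / 2 = - ((e u - e (- u)) / 2)" for u by (simp add: field_simps)
    show "(e u - e (- u)) / 2 = g u" if "u \<in> S" for u
      using that assms(4)[OF that] symsetD[OF assms(2) that] by (simp add: e(2))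
  qed
qed

text \<open>A dimension count: each odd equation costs at most one unit of genus. An odd map without
  zeros from the zero set into j coordinates extends componentwise to the whole space. Zeros of the
  extension on \<open>M\<close> lie off the zero set, where some \<open>f i\<close> is nonzero, so
  adjoining the m functions gives an odd map on \<open>M\<close> without zeros into j + m
  coordinates.\<close>

lemma genus_zero_set:
  fixes M :: "'a::real_normed_vector set" and f :: "nat \<Rightarrow> 'a \<Rightarrow> real"
  assumes M: "closed M" "symset M" and f: "\<And>i. i < m \<Longrightarrow> continuous_on UNIV (f i)"
    and fo: "\<And>i u. i < m \<Longrightarrow> f i (- u) = - f i u"
    and gen: "enat (k + m) \<le> genus M"
  shows "enat k \<le> genus {u\<in>M. \<forall>i<m. f i u = 0}"
proof (rule ccontr)
  let ?Z = "{u\<in>M. \<forall>i<m. f i u = 0}"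
  assume "\<not> ?thesis"
  then have "genus ?Z < enat k" by simp
  then obtain j g where j: "j < k" and g: "continuous_map (top_of_set ?Z) (Euclidean_space j) g"
    and go: "\<And>u. u \<in> ?Z \<Longrightarrow> g (- u) = (\<lambda>i. - g u i)"
    and gn: "\<And>u. u \<in> ?Z \<Longrightarrow> g u \<noteq> (\<lambda>i. 0)"
    by (rule genus_lessE) (rule that)
  have Z_eq: "?Z = M \<inter> (\<Inter>i\<in>{..<m}. {u. f i u = 0})" by auto
  have "closed {u. f i u = 0}" if "i < m" for i
    using f[OF that] by (intro closed_Collect_eq) (auto simp: continuous_on_const)
  then have cZ: "closed ?Z"
    unfolding Z_eq by (intro closed_Int closed_INT M(1)) auto
  have sZ: "symset ?Z" using M(2) fo by (auto simp: symset_def)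
  have "\<forall>i. \<exists>h. continuous_on UNIV h \<and> (\<forall>u. h (- u) = - h u) \<and> (\<forall>u\<in>?Z. h u = g u i)"
  proof
    fix i
    have "continuous_on ?Z (\<lambda>u. g u i)"
      using continuous_map_Euclidean_space_component(1)[OF g, of i] by simp
    then show "\<exists>h. continuous_on UNIV h \<and> (\<forall>u. h (- u) = - h u) \<and> (\<forall>u\<in>?Z. h u = g u i)"
      using go by (intro odd_extension[OF cZ sZ]) simp_all
  qed
  from choice[OF this] obtain h where h: "\<And>i. continuous_on UNIV (h i)" "\<And>i u. h i (- u) = - h i u"
    "\<And>i u. u \<in> ?Z \<Longrightarrow> h i u = g u i" by blast
  define F where "F = (\<lambda>u i. if i < j + m then (if i < j then h i u else f (i - j) u) else 0)"
  have "genus M \<le> enat (j + m)"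
  proof (rule genus_le[where f = F])
    show "continuous_map (top_of_set M) (Euclidean_space (j + m)) F"
      unfolding F_def continuous_map_componentwise_Euclidean_space
      using continuous_on_subset[OF h(1) subset_UNIV] continuous_on_subset[OF f subset_UNIV] by auto
    show "F (- u) = (\<lambda>i. - F u i)" for u
      by (auto simp: F_def h(2) fo fun_eq_iff)
    show "F u \<noteq> (\<lambda>i. 0)" if u: "u \<in> M" for u
    proof
      assume 0: "F u = (\<lambda>i. 0)"
      have "f i u = 0" if "i < m" for i
        using fun_cong[OF 0, of "i + j"] that by (auto simp: F_def)
      with u have uZ: "u \<in> ?Z" by auto
      have "g u i = 0" for i
      proof (cases "i < j")
        case True
        then show ?thesis using fun_cong[OF 0, of i] h(3)[OF uZ] by (auto simp: F_def)
      next
        case False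
        then show ?thesis using continuous_map_Euclidean_space_component(2)[OF g, of u i] uZ by auto
      qed
      with gn[OF uZ] show False by auto
    qed
  qed
  with gen have "enat (k + m) \<le> enat (j + m)" by (rule order_trans)
  with j show False by simp
qed

text \<open>A set of naturals whose supremum exceeds k - 1 has a member above k - 1, that is, at
  least k.\<close>

lemma cone_genusE:
  assumes "enat k \<le> cone_genus K" "1 \<le> k"
  obtains M where "compact M" "symset M" "M \<subseteq> K" "enat k \<le> genus M"
proof -
  let ?S = "{enat k |k. \<exists>M. compact M \<and> (\<forall>u\<in>M. - u \<in> M) \<and> M \<subseteq> K \<and> enat k \<le> genus M}"
  have "enat (k - 1) < enat k" using assms(2) by simp
  also have "\<dots> \<le> Sup ?S" using assms(1) by (simp add: cone_genus_def)
  finally obtain e where "e \<in> ?S" "enat (k - 1) < e"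
    by (auto simp: less_Sup_iff)
  then obtain j M where "k - 1 < j" and M: "compact M" "\<forall>u\<in>M. - u \<in> M" "M \<subseteq> K" "enat j \<le> genus M"
    by auto
  then have "enat k \<le> genus M"
    using order_trans[of "enat k" "enat j" "genus M"] by simp
  with M show thesis by (intro that) (auto simp: symset_def)
qed

text \<open>The function |u + x| - |u - x| is odd and continuous in u and equals 2|x| at u = x, so
  for x \<noteq> 0 it is nonzero near x; finitely many such neighbourhoods cover
  \<open>K\<close>.\<close>

lemma compact_odd_separation:
  fixes K :: "'a::real_normed_vector set"
  assumes "compact K" "0 \<notin> K"
  shows "\<exists>m (f :: nat \<Rightarrow> 'a \<Rightarrow> real). (\<forall>i. continuous_on UNIV (f i)) \<and> (\<forall>i u. f i (- u) = - f i u) \<and>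
    (\<forall>u\<in>K. \<exists>i<m. f i u \<noteq> 0)"
proof -
  define q where "q = (\<lambda>x u :: 'a. norm (u + x) - norm (u - x))"
  have q: "continuous_on UNIV (q x)" "q x (- u) = - q x u" for x u
  proof -
    show "continuous_on UNIV (q x)" unfolding q_def by (intro continuous_intros)
    have "norm (- u + x) = norm (u - x)" "norm (- u - x) = norm (u + x)"
      using norm_minus_cancel[of "u - x"] norm_minus_cancel[of "u + x"] by (auto simp: algebra_simps)
    then show "q x (- u) = - q x u" by (simp add: q_def)
  qed
  have "K \<subseteq> \<Union> ((\<lambda>x. {u. q x u \<noteq> 0}) ` K)"
  proof
    fix u assume "u \<in> K"
    with assms(2) have "u \<noteq> 0" by auto
    then have "q u u \<noteq> 0" by (simp add: q_def scaleR_2[symmetric])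
    with \<open>u \<in> K\<close> show "u \<in> \<Union> ((\<lambda>x. {u. q x u \<noteq> 0}) ` K)" by auto
  qed
  moreover have "open {u. q x u \<noteq> 0}" for x
    using q(1)[of x] by (intro open_Collect_neq) (auto simp: continuous_on_const)
  ultimately obtain Y where Y: "Y \<subseteq> K" "finite Y" "K \<subseteq> (\<Union>x\<in>Y. {u. q x u \<noteq> 0})"
    using compactE_image[OF assms(1), of K "\<lambda>x. {u. q x u \<noteq> 0}"] by auto
  obtain xs where xs: "set xs = Y" using finite_list[OF Y(2)] by auto
  show ?thesis
  proof (rule exI[of _ "length xs"], rule exI[of _ "\<lambda>i. q (xs ! i)"], intro conjI allI ballI)
    show "continuous_on UNIV (q (xs ! i))" for i by (rule q)
    show "q (xs ! i) (- u) = - q (xs ! i) u" for i u by (rule q)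
    show "\<exists>i<length xs. q (xs ! i) u \<noteq> 0" if "u \<in> K" for u
      using that Y(3) xs by (fastforce simp: in_set_conv_nth)
  qed
qed

section \<open>A minimax principle\<close>

text \<open>Ekeland's principle for maximisation. The order \<open>R\<close> says that a move gains
  at least e times its length; a greedy chain in it is Cauchy because the total gain is bounded, and
  its limit is maximal for \<open>R\<close>.\<close>

lemma ekeland:
  fixes f :: "'b::complete_space \<Rightarrow> real"
  assumes usc: "\<And>r. closed {x\<in>S. r \<le> f x}" and bdd: "\<And>x. x \<in> S \<Longrightarrow> f x \<le> K"
    and x0: "x0 \<in> S" and e: "e > 0"
  obtains x where "x \<in> S" "f x0 + e * dist x0 x \<le> f x"
    "\<And>y. y \<in> S \<Longrightarrow> y \<noteq> x \<Longrightarrow> f y < f x + e * dist x y"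
proof -
  define R where "R = (\<lambda>x y. y \<in> S \<and> f x + e * dist x y \<le> f y)"
  have R_trans: "R x z" if "R x y" "R y z" for x y z
  proof -
    have "e * dist x z \<le> e * dist x y + e * dist y z"
      using dist_triangle[of x z y] e by (simp flip: distrib_left)
    with that show ?thesis by (auto simp: R_def)
  qed
  \<comment> \<open>Each step realises at least half of the attainable gain, so what remains
    attainable is at most the gain just made.\<close>
  have step: "\<exists>y. y \<in> S \<and> R x y \<and> (\<forall>z. R x z \<longrightarrow> f z - f y \<le> f y - f x)" if "x \<in> S" for x
  proof -
    let ?A = "f ` {z. R x z}"
    have bA: "bdd_above ?A" using bdd by (intro bdd_aboveI[of _ K]) (auto simp: R_def)
    have xx: "R x x" using that by (simp add: R_def)
    show ?thesis
    proof (cases "Sup ?A \<le> f x")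
      case True
      have "f z \<le> f x" if "R x z" for z
        using cSup_upper[OF _ bA, of "f z"] that True by fastforce
      with xx that show ?thesis by (intro exI[of _ x]) simp
    next
      case False
      then have "(f x + Sup ?A) / 2 < Sup ?A" by simp
      then obtain y where y: "R x y" "(f x + Sup ?A) / 2 < f y"
        using less_cSup_iff[of ?A] xx bA by blast
      have "f z - f y \<le> f y - f x" if "R x z" for z
      proof -
        have "f z \<le> Sup ?A" using that bA by (intro cSup_upper) auto
        then show ?thesis using y(2) by simp
      qed
      with y show ?thesis by (intro exI[of _ y]) (auto simp: R_def)
    qed
  qed
  then obtain g where g: "\<And>x. x \<in> S \<Longrightarrow> g x \<in> S \<and> R x (g x) \<and> (\<forall>z. R x z \<longrightarrow> f z - f (g x) \<le> f (g x) - f x)"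
    by metis
  define X where "X n = (g ^^ n) x0" for n
  have XS: "X n \<in> S" for n
    by (induction n) (auto simp: X_def x0 g)
  have XSuc: "X (Suc n) = g (X n)" for n by (simp add: X_def)
  have Rmono: "R (X n) (X m)" if "n \<le> m" for n m
    using that
  proof (induction m rule: dec_induct)
    case base
    show ?case using XS by (simp add: R_def)
  next
    case (step m)
    then show ?case using R_trans g[OF XS[of m]] XSuc by metis
  qed
  have fmono: "f (X n) \<le> f (X m)" and dX: "e * dist (X n) (X m) \<le> f (X m) - f (X n)" if "n \<le> m" for n m
  proof -
    have "0 \<le> e * dist (X n) (X m)" using e by simp
    with Rmono[OF that] show "f (X n) \<le> f (X m)" "e * dist (X n) (X m) \<le> f (X m) - f (X n)"
      by (auto simp: R_def)
  qed
  obtain a where a: "(\<lambda>n. f (X n)) \<longlonglongrightarrow> a" "\<And>n. f (X n) \<le> a"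
    using incseq_convergent[of "\<lambda>n. f (X n)" K] fmono bdd XS by (auto simp: incseq_def)
  have "Cauchy X"
    unfolding Cauchy_altdef
  proof (intro allI impI)
    fix d :: real assume "d > 0"
    then have "0 < e * d" using e by simp
    with a(1) obtain n where n: "\<And>m. m \<ge> n \<Longrightarrow> dist (f (X m)) a < e * d"
      by (meson LIMSEQ_def)
    show "\<exists>M. \<forall>m\<ge>M. \<forall>k>m. dist (X m) (X k) < d"
    proof (intro exI allI impI)
      fix m k assume "n \<le> m" "m < k"
      then have "e * dist (X m) (X k) < e * d"
        using dX[of m k] n[of m] a(2)[of k] by (auto simp: dist_real_def)
      then show "dist (X m) (X k) < d" using e by simp
    qed
  qed
  then obtain x where x: "X \<longlonglongrightarrow> x"
    using Cauchy_convergent convergent_def by blast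
  have "x \<in> {x\<in>S. f (X n) \<le> f x}" for n
  proof (rule Lim_in_closed_set[OF usc _ _ x])
    show "\<forall>\<^sub>F m in sequentially. X m \<in> {x\<in>S. f (X n) \<le> f x}"
      using eventually_ge_at_top[of n] by eventually_elim (use fmono XS in auto)
  qed auto
  then have xS: "x \<in> S" and fx: "f (X n) \<le> f x" for n by auto
  have RX: "R (X n) x" for n
  proof -
    have "e * dist (X n) x \<le> f x - f (X n)"
    proof (rule tendsto_upperbound)
      show "(\<lambda>m. e * dist (X n) (X m)) \<longlonglongrightarrow> e * dist (X n) x"
        using x by (intro tendsto_intros)
      show "\<forall>\<^sub>F m in sequentially. e * dist (X n) (X m) \<le> f x - f (X n)"
        using eventually_ge_at_top[of n]
      proof eventually_elim
        case (elim m)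
        then show ?case using dX[OF elim] fx[of m] by linarith
      qed
    qed auto
    with xS show ?thesis by (simp add: R_def)
  qed
  show thesis
  proof
    show "x \<in> S" by (rule xS)
    show "f x0 + e * dist x0 x \<le> f x" using RX[of 0] by (simp add: R_def X_def)
    show "f y < f x + e * dist x y" if "y \<in> S" "y \<noteq> x" for y
    proof (rule ccontr)
      assume "\<not> ?thesis"
      with that have "R x y" by (simp add: R_def)
      \<comment> \<open>A point beating \<open>x\<close> is above every iterate, so its excess over
        the iterates is bounded by increments tending to 0.\<close>
      then have "R (X n) y" for n using RX R_trans by blast
      then have *: "f y \<le> f (X (Suc n)) + (f (X (Suc n)) - f (X n))" for n
        using g[OF XS[of n]] XSuc[of n] by (smt (verit, best))
      have "(\<lambda>n. f (X (Suc n)) + (f (X (Suc n)) - f (X n))) \<longlonglongrightarrow> a + (a - a)"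
        by (intro tendsto_intros a(1) LIMSEQ_Suc)
      then have "f y \<le> a + (a - a)" by (rule tendsto_lowerbound) (use * in auto)
      also have "a \<le> f x"
        using a(1) by (rule tendsto_upperbound) (use fx in auto)
      finally have "e * dist x y \<le> 0" using \<open>R x y\<close> by (auto simp: R_def)
      with e that show False by (simp add: mult_le_0_iff)
    qed
  qed
qed

section \<open>Odd pseudo-gradients and almost critical points\<close>

lemma blinfun_norm_gtE:
  fixes f :: "'a::real_normed_vector \<Rightarrow>\<^sub>L real"
  assumes "c < norm f" "0 \<le> c"
  obtains v where "norm v \<le> 1" "c < f v"
proof (rule ccontr)
  assume "\<not> thesis"
  with that have le: "f v \<le> c" if "norm v \<le> 1" for v using that by force
  have "norm f \<le> c"
  proof (rule norm_blinfun_bound[OF assms(2)])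
    fix x :: 'a
    show "norm (f x) \<le> c * norm x"
    proof (cases "x = 0")
      case False
      have "f (x /\<^sub>R norm x) \<le> c" "f ((- x) /\<^sub>R norm x) \<le> c"
        using False by (auto intro!: le)
      then have "\<bar>f x\<bar> / norm x \<le> c"
        by (auto simp: blinfun.scaleR_right blinfun.minus_right abs_if divide_inverse mult.commute)
      with False show ?thesis by (simp add: field_simps)
    qed auto
  qed
  with assms show False by simp
qed

text \<open>Directions at finitely many centres are glued with the odd weights
  \<open>\<rho> y w - \<rho> y (- w)\<close>, which is consistent because \<open>D\<close> is odd.
  The last two claims freeze the direction at \<open>w\<close> and vary the point \<open>w'\<close>,
  as a straight step from \<open>w\<close> requires. Off \<open>K\<close> the field may be small,
  but a short step still never decreases the functional.\<close>

lemma odd_pseudo_gradient: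
  fixes D :: "'a::real_normed_vector \<Rightarrow> 'a \<Rightarrow>\<^sub>L real"
  assumes W: "open W" "symset W" and D: "continuous_on W D" and odd: "\<And>u. u \<in> W \<Longrightarrow> D (- u) = - D u"
    and K: "compact K" "K \<subseteq> W" and big: "\<And>w. w \<in> K \<Longrightarrow> c < norm (D w)" and c: "0 \<le> c"
  obtains V d where "continuous_on UNIV V" "\<And>w. V (- w) = - V w" "\<And>w. norm (V w) \<le> 1" "d > 0"
    "\<And>w w'. V w \<noteq> 0 \<Longrightarrow> dist w w' < d \<Longrightarrow> w' \<in> W \<and> 0 \<le> D w' (V w)"
    "\<And>w w'. w \<in> K \<Longrightarrow> dist w w' < d \<Longrightarrow> w' \<in> W \<and> c \<le> D w' (V w)"
proof -
  \<comment> \<open>Radius 2r: the bump function uses r, and the other r accommodates the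
    displacement from \<open>w\<close> to \<open>w'\<close>.\<close>
  have "\<exists>v r. norm v \<le> 1 \<and> r > 0 \<and> (\<forall>w'. dist w w' < 2 * r \<longrightarrow> w' \<in> W \<and> c < D w' v)" if w: "w \<in> K" for w
  proof -
    obtain v where v: "norm v \<le> 1" "c < D w v"
      using blinfun_norm_gtE[OF big[OF w] c] .
    have "continuous_on W (\<lambda>w. D w v)" by (intro continuous_intros D)
    then have "open (W \<inter> (\<lambda>w. D w v) -` {c<..})"
      using W(1) by (simp add: continuous_on_open_vimage Int_commute)
    moreover have "w \<in> W \<inter> (\<lambda>w. D w v) -` {c<..}" using v w K by auto
    ultimately obtain r where "r > 0" "ball w r \<subseteq> W \<inter> (\<lambda>w. D w v) -` {c<..}"
      using open_contains_ball by blast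
    then show ?thesis using v by (intro exI[of _ v] exI[of _ "r/2"]) (auto simp: subset_iff)
  qed
  then obtain v r where v: "\<And>w. w \<in> K \<Longrightarrow> norm (v w) \<le> 1" and r: "\<And>w. w \<in> K \<Longrightarrow> r w > 0"
    and vr: "\<And>w w'. w \<in> K \<Longrightarrow> dist w w' < 2 * r w \<Longrightarrow> w' \<in> W \<and> c < D w' (v w)"
    by metis
  have "K \<subseteq> (\<Union>w\<in>K. ball w (r w))" using r by auto
  then obtain Y where Y: "Y \<subseteq> K" "finite Y" "K \<subseteq> (\<Union>w\<in>Y. ball w (r w))"
    using compactE_image[OF K(1), of K "\<lambda>w. ball w (r w)"] by auto
  define \<rho> where "\<rho> y w = max 0 (r y - dist y w)" for y w
  define R where "R w = (\<Sum>y\<in>Y. \<rho> y w + \<rho> y (- w))" for w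
  have \<rho>0: "\<rho> y w \<ge> 0" for y w by (simp add: \<rho>_def)
  have R0: "R w \<ge> 0" for w unfolding R_def by (intro sum_nonneg add_nonneg_nonneg \<rho>0)
  have cont\<rho>: "continuous_on UNIV (\<rho> y)" for y unfolding \<rho>_def by (intro continuous_intros)
  have cont\<rho>': "continuous_on UNIV (\<lambda>w. \<rho> y (- w))" for y unfolding \<rho>_def by (intro continuous_intros)
  have contR: "continuous_on UNIV R" unfolding R_def by (intro continuous_intros cont\<rho> cont\<rho>')
  have Rpos: "R w > 0" if "w \<in> K" for w
  proof -
    obtain y where y: "y \<in> Y" "dist y w < r y" using Y(3) \<open>w \<in> K\<close> by auto
    then have "0 < \<rho> y w + \<rho> y (- w)" using \<rho>0[of y "- w"] by (simp add: \<rho>_def)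
    then show ?thesis unfolding R_def
      using y Y(2) by (intro sum_pos2[of _ y]) (auto simp: \<rho>0)
  qed
  \<comment> \<open>\<open>max \<theta> (R w)\<close> is a positive divisor everywhere and equals
    \<open>R w\<close> on \<open>K\<close>, where the full slope c is needed.\<close>
  obtain \<theta> where \<theta>: "\<theta> > 0" "\<And>w. w \<in> K \<Longrightarrow> \<theta> \<le> R w"
  proof (cases "K = {}")
    case False
    have "continuous_on K R" using contR by (rule continuous_on_subset) simp
    then obtain w where "w \<in> K" "\<forall>w'\<in>K. R w \<le> R w'"
      using continuous_attains_inf[OF K(1) False] by blast
    with Rpos that show thesis by blast
  qed (use that[of 1] in auto)
  define V where "V w = (\<Sum>y\<in>Y. (\<rho> y w - \<rho> y (- w)) *\<^sub>R v y) /\<^sub>R max \<theta> (R w)" for w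
  have mpos: "max \<theta> (R w) > 0" for w using \<theta> by simp
  define d where "d = Min (insert 1 (r ` Y))"
  have d: "d > 0" "\<And>y. y \<in> Y \<Longrightarrow> d \<le> r y"
    using Y r by (auto simp: d_def)
  have DV: "D w' (V w) \<ge> c * R w / max \<theta> (R w) \<and> (R w > 0 \<longrightarrow> w' \<in> W)" if ww: "dist w w' < d" for w w'
  proof -
    have pos: "w' \<in> W \<and> c < D w' (v y)" if y: "y \<in> Y" "\<rho> y w \<noteq> 0" for y
    proof -
      have "dist y w < r y" using y(2) by (auto simp: \<rho>_def max_def split: if_splits)
      then have "dist y w' < 2 * r y"
        using dist_triangle[of y w' w] ww d(2)[OF y(1)] by simp
      with vr[of y w'] y Y(1) show ?thesis by blast
    qed
    \<comment> \<open>Where the reflected bump acts, oddness of \<open>D\<close> turns the slope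
      bound at - w' into one at w' along \<open>- v y\<close>, matching the negative weight.\<close>
    have neg: "w' \<in> W \<and> D w' (v y) < - c" if y: "y \<in> Y" "\<rho> y (- w) \<noteq> 0" for y
    proof -
      have "dist y (- w) < r y" using y(2) by (auto simp: \<rho>_def max_def split: if_splits)
      then have "dist y (- w') < 2 * r y"
        using dist_triangle[of y "- w'" "- w"] ww d(2)[OF y(1)] by (simp add: dist_minus)
      with vr[of y "- w'"] y Y(1) have "- w' \<in> W" "c < D (- w') (v y)" by auto
      with W(2) odd[of w'] show ?thesis
        using symsetD[OF W(2) \<open>- w' \<in> W\<close>] by (auto simp: blinfun.minus_left)
    qed
    have "c * R w = (\<Sum>y\<in>Y. c * \<rho> y w + c * \<rho> y (- w))"
      by (simp add: R_def sum_distrib_left distrib_left)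
    also have "\<dots> \<le> (\<Sum>y\<in>Y. (\<rho> y w - \<rho> y (- w)) * D w' (v y))"
    proof (rule sum_mono)
      fix y assume y: "y \<in> Y"
      have "c * \<rho> y w \<le> \<rho> y w * D w' (v y)"
        using pos[OF y] \<rho>0[of y w] by (cases "\<rho> y w = 0") (auto simp: mult.commute)
      moreover have "c * \<rho> y (- w) \<le> \<rho> y (- w) * (- D w' (v y))"
        using neg[OF y] mult_left_mono[of c "- D w' (v y)" "\<rho> y (- w)"] \<rho>0[of y "- w"] by (cases "\<rho> y (- w) = 0") (auto simp: mult.commute)
      ultimately show "c * \<rho> y w + c * \<rho> y (- w) \<le> (\<rho> y w - \<rho> y (- w)) * D w' (v y)"
        by (simp add: left_diff_distrib)
    qed
    finally have "c * R w / max \<theta> (R w) \<le> (\<Sum>y\<in>Y. (\<rho> y w - \<rho> y (- w)) * D w' (v y)) / max \<theta> (R w)"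
      using mpos[of w] by (simp add: divide_right_mono)
    also have "\<dots> = D w' (V w)"
      by (simp add: V_def blinfun.scaleR_right blinfun.sum_right divide_inverse)
    finally have 1: "c * R w / max \<theta> (R w) \<le> D w' (V w)" .
    have "w' \<in> W" if "R w > 0"
    proof -
      have "\<exists>y\<in>Y. \<rho> y w + \<rho> y (- w) \<noteq> 0"
        using that sum.neutral[of Y "\<lambda>y. \<rho> y w + \<rho> y (- w)"] unfolding R_def by (metis less_irrefl)
      then obtain y where "y \<in> Y" "\<rho> y w + \<rho> y (- w) \<noteq> 0" by blast
      with pos neg show ?thesis by fastforce
    qed
    with 1 show ?thesis by blast
  qed
  show thesis
  proof
    show "continuous_on UNIV V" unfolding V_def
      using mpos by (intro continuous_intros contR cont\<rho> cont\<rho>') (auto simp: less_imp_neq[symmetric])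
    have "R (- w) = R w" for w by (simp add: R_def add.commute)
    moreover have "(\<Sum>y\<in>Y. (\<rho> y (- w) - \<rho> y (- (- w))) *\<^sub>R v y) = - (\<Sum>y\<in>Y. (\<rho> y w - \<rho> y (- w)) *\<^sub>R v y)" for w
      unfolding sum_negf[symmetric] by (intro sum.cong) (auto simp: scaleR_left_diff_distrib)
    ultimately show "V (- w) = - V w" for w
      by (simp add: V_def)
    show "norm (V w) \<le> 1" for w
    proof -
      have "norm (\<Sum>y\<in>Y. (\<rho> y w - \<rho> y (- w)) *\<^sub>R v y) \<le> R w"
        unfolding R_def
      proof (rule sum_norm_le)
        fix y assume y: "y \<in> Y"
        have "norm ((\<rho> y w - \<rho> y (- w)) *\<^sub>R v y) \<le> \<bar>\<rho> y w - \<rho> y (- w)\<bar> * 1"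
          unfolding norm_scaleR using v y Y(1) by (intro mult_left_mono) auto
        also have "\<dots> \<le> \<rho> y w + \<rho> y (- w)" using \<rho>0[of y w] \<rho>0[of y "- w"] by simp
        finally show "norm ((\<rho> y w - \<rho> y (- w)) *\<^sub>R v y) \<le> \<rho> y w + \<rho> y (- w)" .
      qed
      also have "\<dots> \<le> max \<theta> (R w)" by simp
      finally show ?thesis using mpos[of w] by (simp add: V_def field_simps)
    qed
    show "d > 0" by (rule d)
    show "w' \<in> W \<and> 0 \<le> D w' (V w)" if "V w \<noteq> 0" "dist w w' < d" for w w'
    proof -
      have "R w > 0"
      proof (rule ccontr)
        assume "\<not> R w > 0"
        then have "R w = 0" using R0[of w] by simp
        then have "\<rho> y w = 0 \<and> \<rho> y (- w) = 0" if "y \<in> Y" for y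
          using that Y(2) \<rho>0 unfolding R_def
          by (subst (asm) sum_nonneg_eq_0_iff) (auto simp: add_nonneg_eq_0_iff)
        then have "V w = 0" by (simp add: V_def)
        with that show False by simp
      qed
      with DV[OF that(2)] have "w' \<in> W" "c * R w / max \<theta> (R w) \<le> D w' (V w)" by auto
      moreover have "0 \<le> c * R w / max \<theta> (R w)" using c R0[of w] \<theta> by simp
      ultimately show ?thesis by simp
    qed
    show "w' \<in> W \<and> c \<le> D w' (V w)" if "w \<in> K" "dist w w' < d" for w w'
      using DV[OF that(2)] \<theta>(2)[OF that(1)] Rpos[OF that(1)] by (simp add: max_def split: if_splits)
  qed
qed

lemma directional_increase:
  fixes L :: "'a::real_normed_vector \<Rightarrow> real"
  assumes der: "\<And>w'. dist w w' < d \<Longrightarrow> (L has_derivative blinfun_apply (D w')) (at w')"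
    and lo: "\<And>w'. dist w w' < d \<Longrightarrow> c \<le> D w' v" and v: "norm v \<le> 1" and s: "0 \<le> s" "s < d"
  shows "L w + c * s \<le> L (w + s *\<^sub>R v)"
proof -
  have near: "dist w (w + t *\<^sub>R v) < d" if "0 \<le> t" "t \<le> s" for t
  proof -
    have "t * norm v \<le> s * 1" using that v s by (intro mult_mono) auto
    then show ?thesis using s that by (simp add: dist_norm)
  qed
  have "\<exists>t\<in>{0..s}. L (w + s *\<^sub>R v) - L (w + 0 *\<^sub>R v) = (\<lambda>h. D (w + t *\<^sub>R v) (h *\<^sub>R v)) (s - 0)"
  proof (rule mvt_very_simple[OF s(1)])
    fix t assume t: "0 \<le> t" "t \<le> s"
    have 1: "((\<lambda>t. w + t *\<^sub>R v) has_derivative (\<lambda>h. h *\<^sub>R v)) (at t within {0..s})"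
      by (auto intro!: derivative_eq_intros)
    show "((\<lambda>t. L (w + t *\<^sub>R v)) has_derivative (\<lambda>h. D (w + t *\<^sub>R v) (h *\<^sub>R v))) (at t within {0..s})"
      using has_derivative_compose[OF 1 der[OF near[OF t]]] .
  qed
  then obtain t where t: "0 \<le> t" "t \<le> s" "L (w + s *\<^sub>R v) - L w = s * D (w + t *\<^sub>R v) v"
    by (auto simp: blinfun.scaleR_right)
  have "c * s \<le> s * D (w + t *\<^sub>R v) v"
    using mult_left_mono[OF lo[OF near[OF t(1,2)]] s(1)] by (simp add: mult.commute)
  with t show ?thesis by simp
qed

text \<open>\<open>M\<close> is within e^2 of optimal by \<open>low\<close>, and \<open>up\<close>
  caps the minimum over every odd image. Ekeland's principle with slope e therefore moves by at most
  e < 1/2, which leaves room in the annulus. A slope above 2e at all near-minimal points would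
  permit a step of length s that gains 2es at a cost of only es.\<close>

lemma almost_critical_point:
  fixes L :: "'a::banach \<Rightarrow> real" and D :: "'a \<Rightarrow> 'a \<Rightarrow>\<^sub>L real"
  assumes W: "open W" "symset W"
    and der: "\<And>u. u \<in> W \<Longrightarrow> (L has_derivative blinfun_apply (D u)) (at u)"
    and D: "continuous_on W D" and odd: "\<And>u. u \<in> W \<Longrightarrow> D (- u) = - D u"
    and cl: "\<And>r. closed {u\<in>W. 1/2 \<le> norm u \<and> norm u \<le> 3/2 \<and> r \<le> L u}"
    and M: "compact M" "M \<noteq> {}" "M \<subseteq> W" "\<And>x. x \<in> M \<Longrightarrow> norm x = 1"
    and e: "0 < e" "e < 1/2"
    and low: "\<And>x. x \<in> M \<Longrightarrow> l - e\<^sup>2 \<le> L x"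
    and up: "\<And>h r. continuous_on UNIV h \<Longrightarrow> (\<And>u. h (- u) = - h u) \<Longrightarrow> h ` M \<subseteq> W \<Longrightarrow>
      (\<And>x. x \<in> M \<Longrightarrow> r \<le> L (h x)) \<Longrightarrow> r \<le> l"
  obtains x u where "x \<in> M" "u \<in> W" "norm (u - x) \<le> e" "\<bar>L u - l\<bar> \<le> e" "norm (D u) \<le> 2 * e"
proof -
  define T where "T r = {u\<in>W. 1/2 \<le> norm u \<and> norm u \<le> 3/2 \<and> r \<le> L u}" for r
  \<comment> \<open>Perturbations are added, not composed, so completeness of the sup norm applies.
    Each \<open>p\<close> is defined on the whole space, as the competitors in \<open>up\<close>
    are.\<close>
  define Y where "Y r = {p :: 'a \<Rightarrow>\<^sub>C 'a. (\<forall>x. p (- x) = - p x) \<and> (\<forall>x\<in>M. x + p x \<in> T r)}" for r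
  define f where "f p = (INF x\<in>M. L (x + apply_bcontfun p x))" for p
  define r0 where "r0 = l - e\<^sup>2"
  have contL: "continuous_on W L"
    using der by (intro continuous_at_imp_continuous_on ballI has_derivative_continuous)
  have eval: "continuous_on UNIV (\<lambda>p :: 'a \<Rightarrow>\<^sub>C 'a. apply_bcontfun p x)" for x
  proof (rule continuous_at_imp_continuous_on, rule ballI)
    fix p :: "'a \<Rightarrow>\<^sub>C 'a"
    have "((\<lambda>q. dist (apply_bcontfun q x) (apply_bcontfun p x)) \<longlongrightarrow> 0) (at p)"
    proof (rule tendsto_sandwich[where f = "\<lambda>_. 0"])
      show "((\<lambda>q. dist q p) \<longlongrightarrow> 0) (at p)" by (intro tendsto_dist_iff[THEN iffD1] tendsto_ident_at)
    qed (auto simp: dist_bounded)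
    then show "isCont (\<lambda>p. apply_bcontfun p x) p"
      by (simp add: isCont_def tendsto_dist_iff[symmetric])
  qed
  have closedY: "closed (Y r)" for r
  proof -
    have Y_eq: "Y r = (\<Inter>x. {p. apply_bcontfun p (- x) = - apply_bcontfun p x}) \<inter> (\<Inter>x\<in>M. (\<lambda>p. x + apply_bcontfun p x) -` T r)"
      by (auto simp: Y_def)
    have "closed {p :: 'a \<Rightarrow>\<^sub>C 'a. apply_bcontfun p (- x) = - apply_bcontfun p x}" for x
      by (intro closed_Collect_eq continuous_intros eval)
    moreover have "closed ((\<lambda>p :: 'a \<Rightarrow>\<^sub>C 'a. x + apply_bcontfun p x) -` T r)" for x
      unfolding T_def by (intro closed_vimage cl continuous_intros eval)
    ultimately show ?thesis unfolding Y_eq by (intro closed_Int closed_INT ballI) auto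
  qed
  have bddY: "bdd_below ((\<lambda>x. L (x + apply_bcontfun p x)) ` M)" if "p \<in> Y r0" for p
    using that by (intro bdd_belowI[of _ r0]) (auto simp: Y_def T_def)
  have f_iff: "r \<le> f p \<longleftrightarrow> (\<forall>x\<in>M. r \<le> L (x + apply_bcontfun p x))" if "p \<in> Y r0" for p r
    unfolding f_def by (rule le_cINF_iff[OF M(2) bddY[OF that]])
  have usc: "closed {p\<in>Y r0. r \<le> f p}" for r
  proof -
    have "{p\<in>Y r0. r \<le> f p} = Y (max r r0)"
      using f_iff by (auto simp: Y_def T_def)
    then show ?thesis using closedY by simp
  qed
  have odd_map: "continuous_on UNIV (\<lambda>x. x + apply_bcontfun p x)"
    "- u + apply_bcontfun p (- u) = - (u + apply_bcontfun p u)"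
    if "p \<in> Y r0" for p u
    using that by (auto simp: Y_def intro!: continuous_intros)
  have fl: "f p \<le> l" if "p \<in> Y r0" for p
    using that f_iff[OF that, of "f p"]
    by (intro up[of "\<lambda>x. x + apply_bcontfun p x"] odd_map[OF that]) (auto simp: Y_def T_def)
  have 0: "0 \<in> Y r0" using low M by (auto simp: Y_def T_def r0_def)
  obtain p where p: "p \<in> Y r0" "f 0 + e * dist 0 p \<le> f p"
    "\<And>q. q \<in> Y r0 \<Longrightarrow> q \<noteq> p \<Longrightarrow> f q < f p + e * dist p q"
    using ekeland[OF usc fl 0 e(1)] by blast
  have "r0 \<le> f 0" using f_iff[OF 0] low by (simp add: r0_def)
  \<comment> \<open>The objective starts at l - e^2 or higher and never exceeds l, which bounds the
    total gain.\<close>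
  with p(2) fl[OF p(1)] have "e * norm p \<le> e * e"
    by (simp add: r0_def power2_eq_square)
  then have np: "norm p \<le> e" using e by simp
  have px: "norm (apply_bcontfun p x) \<le> e" for x
    using norm_bounded[of p x] np by simp
  define h where "h = (\<lambda>x. x + apply_bcontfun p x)"
  have h: "continuous_on UNIV h" "\<And>u. h (- u) = - h u" "\<And>x. x \<in> M \<Longrightarrow> h x \<in> T r0"
    using odd_map[OF p(1)] p(1) by (auto simp: h_def Y_def)
  have hW: "h ` M \<subseteq> W" using h(3) by (auto simp: T_def)
  \<comment> \<open>Only points within e of the current minimum have to be raised; elsewhere the
    reserve e covers the gain 2es, since s \<le> 1/2.\<close>
  define Z where "Z = {x\<in>M. L (h x) \<le> f p + e}"
  have contLh: "continuous_on M (\<lambda>x. L (h x))"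
    using hW by (intro continuous_on_compose2[OF contL]) (auto intro: continuous_on_subset[OF h(1)])
  then have clZ: "closed Z" unfolding Z_def
    by (rule continuous_on_closed_Collect_le) (intro continuous_on_const compact_imp_closed M)+
  have "M \<inter> Z = Z" by (auto simp: Z_def)
  with compact_Int_closed[OF M(1) clZ] have "compact Z" by simp
  then have K: "compact (h ` Z)" using h(1) by (intro compact_continuous_image) (auto intro: continuous_on_subset)
  have KW: "h ` Z \<subseteq> W" using hW by (auto simp: Z_def)
  show thesis
  proof (cases "\<exists>x\<in>Z. norm (D (h x)) \<le> 2 * e")
    case True
    then obtain x where x: "x \<in> M" "L (h x) \<le> f p + e" "norm (D (h x)) \<le> 2 * e" by (auto simp: Z_def)
    have "r0 \<le> L (h x)" using h(3)[OF x(1)] by (simp add: T_def)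
    moreover have "e\<^sup>2 \<le> e" using e mult_left_mono[of e 1 e] by (simp add: power2_eq_square)
    ultimately have "\<bar>L (h x) - l\<bar> \<le> e"
      using x(2) fl[OF p(1)] by (simp add: r0_def)
    with x hW px[of x] show thesis by (intro that[of x "h x"]) (auto simp: h_def)
  next
    case False
    then have big: "2 * e < norm (D w)" if "w \<in> h ` Z" for w using that by force
    obtain V d where V: "continuous_on UNIV V" "\<And>w. V (- w) = - V w" "\<And>w. norm (V w) \<le> 1" "d > 0"
      "\<And>w w'. V w \<noteq> 0 \<Longrightarrow> dist w w' < d \<Longrightarrow> w' \<in> W \<and> 0 \<le> D w' (V w)"
      "\<And>w w'. w \<in> h ` Z \<Longrightarrow> dist w w' < d \<Longrightarrow> w' \<in> W \<and> 2 * e \<le> D w' (V w)"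
      using odd_pseudo_gradient[OF W D odd K KW big] e by auto
    define s where "s = min (d / 2) (1/2 - e)"
    have s: "0 < s" "s < d" "s \<le> 1/2 - e" using V(4) e by (auto simp: s_def)
    then have s_half: "s \<le> 1/2" using e by linarith
    define q where "q = Bcontfun (\<lambda>x. s *\<^sub>R V (h x))"
    have "(\<lambda>x. s *\<^sub>R V (h x)) \<in> bcontfun"
    proof (rule bcontfun_normI)
      show "continuous_on UNIV (\<lambda>x. s *\<^sub>R V (h x))"
        by (intro continuous_intros continuous_on_compose2[OF V(1) h(1)]) auto
      show "norm (s *\<^sub>R V (h x)) \<le> s" for x using V(3)[of "h x"] s mult_left_mono[of "norm (V (h x))" 1 s] by simp
    qed
    then have q: "apply_bcontfun q x = s *\<^sub>R V (h x)" for x by (simp add: q_def Bcontfun_inverse)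
    have nsV: "norm (s *\<^sub>R V (h x)) \<le> s" for x
      using V(3)[of "h x"] s mult_left_mono[of "norm (V (h x))" 1 s] by simp
    have nq: "norm q \<le> s" using nsV by (intro norm_bound) (simp add: q)
    have inc0: "h x + s *\<^sub>R V (h x) \<in> W \<and> L (h x) \<le> L (h x + s *\<^sub>R V (h x))" if x: "x \<in> M" for x
    proof (cases "V (h x) = 0")
      case True
      then show ?thesis using hW x by auto
    next
      case False
      have "dist (h x) (h x + s *\<^sub>R V (h x)) < d"
        using le_less_trans[OF nsV[of x] s(2)] dist_norm[of "h x" "h x + s *\<^sub>R V (h x)"] by (simp del: norm_scaleR)
      moreover have "L (h x) + 0 * s \<le> L (h x + s *\<^sub>R V (h x))"
        using V(5)[OF False] s by (intro directional_increase[where D = D and d = d] der V(3)) auto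
      ultimately show ?thesis using V(5)[OF False] by auto
    qed
    have inc: "L (h x) + 2 * e * s \<le> L (h x + s *\<^sub>R V (h x))" if x: "x \<in> Z" for x
      using V(6)[of "h x"] s x by (intro directional_increase[where D = D and d = d] der V(3)) auto
    have qY: "p + q \<in> Y r0"
      unfolding Y_def mem_Collect_eq
    proof (intro conjI allI ballI)
      show "apply_bcontfun (p + q) (- x) = - apply_bcontfun (p + q) x" for x
        using p(1) h(2) V(2) by (simp add: q Y_def)
      fix x assume x: "x \<in> M"
      have eq: "x + apply_bcontfun (p + q) x = h x + s *\<^sub>R V (h x)" by (simp add: q h_def)
      have "norm (apply_bcontfun (p + q) x) \<le> 1/2"
        using norm_triangle_ineq[of "apply_bcontfun p x" "s *\<^sub>R V (h x)"] px[of x] nsV[of x] s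
        unfolding plus_bcontfun.rep_eq q by linarith
      then have "1/2 \<le> norm (x + apply_bcontfun (p + q) x)" "norm (x + apply_bcontfun (p + q) x) \<le> 3/2"
        using M(4)[OF x] norm_triangle_ineq[of x "apply_bcontfun (p + q) x"]
          norm_diff_ineq[of x "apply_bcontfun (p + q) x"] by linarith+
      moreover have "r0 \<le> L (h x)" using h(3)[OF x] by (simp add: T_def)
      ultimately show "x + apply_bcontfun (p + q) x \<in> T r0"
        using inc0[OF x] unfolding eq by (auto simp: T_def)
    qed
    have "f p + 2 * e * s \<le> f (p + q)"
      unfolding f_iff[OF qY]
    proof
      fix x assume x: "x \<in> M"
      have eq: "x + apply_bcontfun (p + q) x = h x + s *\<^sub>R V (h x)" by (simp add: q h_def)
      show "f p + 2 * e * s \<le> L (x + apply_bcontfun (p + q) x)"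
      proof (cases "x \<in> Z")
        case True
        have "f p \<le> L (h x)" using f_iff[OF p(1), of "f p"] x by (auto simp: h_def)
        then show ?thesis using inc[OF True] unfolding eq by linarith
      next
        case False
        have "2 * e * s \<le> 2 * e * (1/2)" using e s_half by (intro mult_left_mono) auto
        then have "2 * e * s \<le> e" by simp
        with False x inc0[OF x] show ?thesis unfolding eq Z_def by auto
      qed
    qed
    moreover have "e * s > 0" using e s by simp
    moreover from calculation have "p + q \<noteq> p" by (auto simp: mult.assoc)
    moreover have "e * dist p (p + q) \<le> e * s" using e nq by (simp add: dist_norm)
    ultimately show thesis using p(3)[OF qY] by (simp add: mult.assoc)
  qed
qed

section \<open>Max-min levels of a 0-homogeneous functional on a symmetric open cone\<close>

definition adm :: "'a::real_normed_vector set \<Rightarrow> nat \<Rightarrow> 'a set \<Rightarrow> bool" where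
  "adm W k M \<longleftrightarrow> compact M \<and> symset M \<and> M \<subseteq> W \<and> M \<noteq> {} \<and> enat k \<le> genus M"

text \<open>The supremum over \<open>M\<close> of the minimum of \<open>L\<close> on
  \<open>M\<close>, written with lower bounds r to avoid an inner infimum. Nonemptiness in
  \<open>adm\<close> matters for k = 0, where the empty set would admit every r.\<close>

definition ls_level :: "'a::real_normed_vector set \<Rightarrow> ('a \<Rightarrow> real) \<Rightarrow> nat \<Rightarrow> real" where
  "ls_level W L k = Sup {r. \<exists>M. adm W k M \<and> (\<forall>u\<in>M. r \<le> L u)}"

lemma adm_exists:
  assumes "enat k \<le> cone_genus W" "1 \<le> k"
  obtains M where "adm W k M"
proof -
  obtain M where M: "compact M" "symset M" "M \<subseteq> W" "enat k \<le> genus M"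
    using cone_genusE[OF assms] .
  have "M \<noteq> {}" using M(4) assms(2) by (auto simp: genus_empty zero_enat_def)
  with M show thesis by (intro that) (auto simp: adm_def)
qed

lemma adm_image:
  assumes "adm W k M" "continuous_on M h" "\<And>u. u \<in> M \<Longrightarrow> h (- u) = - h u" "h ` M \<subseteq> W"
  shows "adm W k (h ` M)"
  unfolding adm_def
proof (intro conjI)
  have M: "compact M" "symset M" "M \<noteq> {}" "enat k \<le> genus M" using assms(1) by (auto simp: adm_def)
  show "compact (h ` M)" by (rule compact_continuous_image[OF assms(2) M(1)])
  show "symset (h ` M)"
    unfolding symset_def
  proof (intro ballI)
    fix v assume "v \<in> h ` M"
    then obtain u where "u \<in> M" "v = h u" by auto
    then show "- v \<in> h ` M" using symsetD[OF M(2)] assms(3) by (intro image_eqI[of _ _ "- u"]) auto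
  qed
  show "enat k \<le> genus (h ` M)" using genus_image[OF assms(2,3)] M(4) by (rule order_trans[rotated])
qed (use assms in \<open>auto simp: adm_def\<close>)

lemma adm_mono: "adm W k M \<Longrightarrow> j \<le> k \<Longrightarrow> W \<subseteq> W' \<Longrightarrow> adm W' j M"
  unfolding adm_def using order_trans[of "enat j" "enat k" "genus M"] by auto

text \<open>The interface of the max-min argument. \<open>L_neg\<close> bounds the levels above,
  \<open>sup_closed\<close> stops sequences with values bounded below from leaving \<open>W\<close>,
  and \<open>L_hom\<close> is why the annulus about the unit sphere suffices in
  \<open>PS\<close>.\<close>

locale ls_functional =
  fixes W :: "'a::banach set" and L :: "'a \<Rightarrow> real" and D :: "'a \<Rightarrow> 'a \<Rightarrow>\<^sub>L real"
  assumes open_W: "open W" and sym_W: "symset W"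
    and cone_W: "\<And>u t. u \<in> W \<Longrightarrow> 0 < t \<Longrightarrow> t *\<^sub>R u \<in> W" and zero_W: "0 \<notin> W"
    and L_neg: "\<And>u. u \<in> W \<Longrightarrow> L u < 0"
    and L_hom: "\<And>u t. u \<in> W \<Longrightarrow> 0 < t \<Longrightarrow> L (t *\<^sub>R u) = L u"
    and L_der: "\<And>u. u \<in> W \<Longrightarrow> (L has_derivative blinfun_apply (D u)) (at u)"
    and D_cont: "continuous_on W D" and D_odd: "\<And>u. u \<in> W \<Longrightarrow> D (- u) = - D u"
    and sup_closed: "\<And>r. closed {u\<in>W. 1/2 \<le> norm u \<and> norm u \<le> 3/2 \<and> r \<le> L u}"
    and PS: "\<And>u l. (\<And>n :: nat. u n \<in> W) \<Longrightarrow> (\<And>n. 1/2 \<le> norm (u n)) \<Longrightarrow> (\<And>n. norm (u n) \<le> 3/2) \<Longrightarrow>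
      (\<lambda>n. L (u n)) \<longlonglongrightarrow> l \<Longrightarrow> (\<lambda>n. D (u n)) \<longlonglongrightarrow> 0 \<Longrightarrow> \<exists>x r. strict_mono r \<and> (u \<circ> r) \<longlonglongrightarrow> x"
begin

abbreviation level where "level \<equiv> ls_level W L"

lemma L_cont: "continuous_on W L"
  using L_der by (intro continuous_at_imp_continuous_on ballI has_derivative_continuous)

lemma bdd_above_levels: "bdd_above {r. \<exists>M. adm W k M \<and> (\<forall>u\<in>M. r \<le> L u)}"
  using L_neg by (intro bdd_aboveI[of _ 0]) (force simp: adm_def)

lemma levelI: "adm W k M \<Longrightarrow> (\<And>u. u \<in> M \<Longrightarrow> r \<le> L u) \<Longrightarrow> r \<le> level k"
  unfolding ls_level_def by (intro cSup_upper bdd_above_levels) auto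

lemma levels_nonempty:
  assumes "enat k \<le> cone_genus W" "1 \<le> k"
  shows "{r. \<exists>M. adm W k M \<and> (\<forall>u\<in>M. r \<le> L u)} \<noteq> {}"
proof -
  obtain M where M: "adm W k M" using adm_exists[OF assms] .
  then obtain u where "u \<in> M" "\<forall>v\<in>M. L u \<le> L v"
    using continuous_attains_inf[of M L] continuous_on_subset[OF L_cont, of M] by (auto simp: adm_def)
  with M show ?thesis by auto
qed

text \<open>Radial projection to the unit sphere is odd and continuous on \<open>M\<close> and
  leaves \<open>L\<close> unchanged, so a near-optimal set can be normalised without loss of
  genus.\<close>

lemma level_approx:
  assumes k: "enat k \<le> cone_genus W" "1 \<le> k" and d: "d > 0"
  shows "\<exists>M. adm W k M \<and> (\<forall>u\<in>M. norm u = 1 \<and> level k - d \<le> L u)"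
proof -
  have "level k - d < level k" using d by simp
  then obtain r M where rM: "level k - d < r" "adm W k M" "\<And>u. u \<in> M \<Longrightarrow> r \<le> L u"
    unfolding ls_level_def using less_cSup_iff[OF levels_nonempty[OF k] bdd_above_levels] by auto
  define h where "h u = u /\<^sub>R norm u" for u :: 'a
  have MW: "u \<in> W" "u \<noteq> 0" if "u \<in> M" for u using that rM(2) zero_W by (auto simp: adm_def)
  have hW: "h u \<in> W" "L (h u) = L u" "norm (h u) = 1" if "u \<in> M" for u
    using MW[OF that] cone_W[of u "inverse (norm u)"] L_hom[of u "inverse (norm u)"] by (auto simp: h_def)
  have "adm W k (h ` M)"
  proof (rule adm_image[OF rM(2)])
    show "continuous_on M h" unfolding h_def using MW by (intro continuous_intros) auto
  qed (use hW in \<open>auto simp: h_def\<close>)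
  moreover have "norm u = 1 \<and> level k - d \<le> L u" if "u \<in> h ` M" for u
    using that hW rM(1,3) by fastforce
  ultimately show ?thesis by blast
qed

lemma level_antimono:
  assumes "enat k \<le> cone_genus W" "1 \<le> k" "j \<le> k"
  shows "level k \<le> level j"
  unfolding ls_level_def
  by (rule cSup_subset_mono[OF levels_nonempty[OF assms(1,2)] bdd_above_levels])
    (use adm_mono[OF _ assms(3)] in blast)

text \<open>The danger is a limit on the boundary of \<open>W\<close>. Convergence of the values
  gives a lower bound -B, and the closed superlevel set for -B keeps the limit inside
  \<open>W\<close>, where \<open>L\<close> and \<open>D\<close> are continuous.\<close>

lemma PS_limit:
  assumes u: "\<And>n :: nat. u n \<in> W" "\<And>n. 1/2 \<le> norm (u n)" "\<And>n. norm (u n) \<le> 3/2"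
    and l: "(\<lambda>n. L (u n)) \<longlonglongrightarrow> l" and D: "(\<lambda>n. D (u n)) \<longlonglongrightarrow> 0"
  obtains x r where "strict_mono r" "(u \<circ> r) \<longlonglongrightarrow> x" "x \<in> W" "1/2 \<le> norm x" "norm x \<le> 3/2" "L x = l" "D x = 0"
proof -
  obtain x r where r: "strict_mono r" "(u \<circ> r) \<longlonglongrightarrow> x" using PS[OF u l D] by blast
  obtain B where B: "\<And>n. norm (L (u n)) \<le> B"
    using convergent_imp_Bseq[OF convergentI[OF l]] by (auto simp: Bseq_def)
  have "x \<in> {u\<in>W. 1/2 \<le> norm u \<and> norm u \<le> 3/2 \<and> - B \<le> L u}"
  proof (rule Lim_in_closed_set[OF sup_closed _ _ r(2)])
    have "- B \<le> L (u n)" for n using B[of n] by (simp add: abs_le_iff)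
    then show "\<forall>\<^sub>F n in sequentially. (u \<circ> r) n \<in> {u\<in>W. 1/2 \<le> norm u \<and> norm u \<le> 3/2 \<and> - B \<le> L u}"
      using u by simp
  qed auto
  then have x: "x \<in> W" "1/2 \<le> norm x" "norm x \<le> 3/2" by auto
  have "(\<lambda>n. L ((u \<circ> r) n)) \<longlonglongrightarrow> L x"
    using u(1) x(1) by (intro continuous_on_tendsto_compose[OF L_cont r(2)]) auto
  moreover have "(\<lambda>n. L ((u \<circ> r) n)) \<longlonglongrightarrow> l" using LIMSEQ_subseq_LIMSEQ[OF l r(1)] by (simp add: o_def)
  ultimately have "L x = l" by (rule LIMSEQ_unique)
  have "(\<lambda>n. D ((u \<circ> r) n)) \<longlonglongrightarrow> D x"
    using u(1) x(1) by (intro continuous_on_tendsto_compose[OF D_cont r(2)]) auto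
  moreover have "(\<lambda>n. D ((u \<circ> r) n)) \<longlonglongrightarrow> 0" using LIMSEQ_subseq_LIMSEQ[OF D r(1)] by (simp add: o_def)
  ultimately have "D x = 0" by (rule LIMSEQ_unique)
  with r x \<open>L x = l\<close> show thesis by (rule that)
qed

text \<open>The perturbations need not preserve \<open>Z\<close>, yet \<open>Z\<close> localises the
  critical point: almost critical points stay within e of \<open>M\<close>, so their limit lies in
  the closed set \<open>Z\<close>. The index k may change with e; only the levels have to approach
  l.\<close>

lemma critical_point_in:
  assumes Z: "closed Z"
    and M: "\<And>e :: real. 0 < e \<Longrightarrow> e < 1/2 \<Longrightarrow> \<exists>M k. adm W k M \<and> M \<subseteq> Z \<and> (\<forall>x\<in>M. norm x = 1 \<and> level k - e\<^sup>2 \<le> L x) \<and> \<bar>level k - l\<bar> \<le> e"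
  obtains u where "u \<in> W" "u \<in> Z" "1/2 \<le> norm u" "norm u \<le> 3/2" "L u = l" "D u = 0"
proof -
  define e where "e n = inverse (real (n + 3))" for n :: nat
  have e: "0 < e n" "e n < 1/2" for n by (auto simp: e_def field_simps)
  have e0: "e \<longlonglongrightarrow> 0"
    unfolding e_def using LIMSEQ_ignore_initial_segment[OF LIMSEQ_inverse_real_of_nat, of 2]
    by (simp add: eval_nat_numeral)
  have "\<exists>x u. x \<in> Z \<and> u \<in> W \<and> norm x = 1 \<and> norm (u - x) \<le> e n \<and> \<bar>L u - l\<bar> \<le> 2 * e n \<and> norm (D u) \<le> 2 * e n" for n
  proof -
    obtain M k where M: "adm W k M" "M \<subseteq> Z" "\<And>x. x \<in> M \<Longrightarrow> norm x = 1"
      "\<And>x. x \<in> M \<Longrightarrow> level k - (e n)\<^sup>2 \<le> L x" "\<bar>level k - l\<bar> \<le> e n"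
      using M[OF e] by blast
    have M': "compact M" "M \<noteq> {}" "M \<subseteq> W" using M(1) by (auto simp: adm_def)
    have up: "r \<le> level k" if h: "continuous_on UNIV h" "\<And>u. h (- u) = - h u" "h ` M \<subseteq> W" "\<And>x. x \<in> M \<Longrightarrow> r \<le> L (h x)" for h r
    proof -
      have "adm W k (h ` M)" using h by (intro adm_image[OF M(1)]) (auto intro: continuous_on_subset)
      then show ?thesis by (rule levelI) (use h(4) in auto)
    qed
    obtain x u where "x \<in> M" "u \<in> W" "norm (u - x) \<le> e n" "\<bar>L u - level k\<bar> \<le> e n" "norm (D u) \<le> 2 * e n"
      by (rule almost_critical_point[OF open_W sym_W L_der D_cont D_odd sup_closed M' M(3) e M(4) up])
    with M show ?thesis by (intro exI[of _ x] exI[of _ u]) auto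
  qed
  then obtain x u where x: "\<And>n. x n \<in> Z" "\<And>n. norm (x n) = 1" and u: "\<And>n. u n \<in> W"
    and ux: "\<And>n. norm (u n - x n) \<le> e n" and L: "\<And>n. \<bar>L (u n) - l\<bar> \<le> 2 * e n" and D: "\<And>n. norm (D (u n)) \<le> 2 * e n"
    by metis
  have e2: "(\<lambda>n. 2 * e n) \<longlonglongrightarrow> 0" using tendsto_mult_right[OF e0, of 2] by simp
  have nu: "1/2 \<le> norm (u n)" "norm (u n) \<le> 3/2" for n
    using norm_triangle_ineq2[of "x n" "u n"] norm_triangle_ineq2[of "u n" "x n"] ux[of n] x(2)[of n] e(2)[of n]
    by (auto simp: norm_minus_commute)
  have "(\<lambda>n. L (u n) - l) \<longlonglongrightarrow> 0" by (rule Lim_null_comparison[OF _ e2]) (use L in auto)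
  then have "(\<lambda>n. L (u n)) \<longlonglongrightarrow> l" by (rule LIM_zero_cancel)
  moreover have "(\<lambda>n. D (u n)) \<longlonglongrightarrow> 0" by (rule Lim_null_comparison[OF _ e2]) (use D in auto)
  ultimately obtain y r where y: "strict_mono r" "(u \<circ> r) \<longlonglongrightarrow> y" "y \<in> W" "1/2 \<le> norm y" "norm y \<le> 3/2" "L y = l" "D y = 0"
    by (rule PS_limit[of u, OF u nu])
  have "(\<lambda>n. u n - x n) \<longlonglongrightarrow> 0" by (rule Lim_null_comparison[OF _ e0]) (use ux in auto)
  then have "(\<lambda>n. u (r n) - x (r n)) \<longlonglongrightarrow> 0" using LIMSEQ_subseq_LIMSEQ[OF _ y(1)] by (fastforce simp: o_def)
  from tendsto_diff[OF y(2)[unfolded o_def] this] have "(\<lambda>n. x (r n)) \<longlonglongrightarrow> y" by simp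
  then have "y \<in> Z" by (rule closed_sequentially[OF Z, rotated]) (use x in auto)
  with y show thesis by (intro that)
qed

theorem level_critical:
  assumes "enat k \<le> cone_genus W" "1 \<le> k"
  obtains u where "u \<in> W" "L u = level k" "D u = 0"
proof -
  have "\<exists>M j. adm W j M \<and> M \<subseteq> UNIV \<and> (\<forall>x\<in>M. norm x = 1 \<and> level j - e\<^sup>2 \<le> L x) \<and> \<bar>level j - level k\<bar> \<le> e"
    if "0 < e" for e :: real
  proof -
    have "e\<^sup>2 > 0" using that by simp
    then obtain M where "adm W k M" "\<And>u. u \<in> M \<Longrightarrow> norm u = 1" "\<And>u. u \<in> M \<Longrightarrow> level k - e\<^sup>2 \<le> L u"
      using level_approx[OF assms] by blast
    with that show ?thesis by (intro exI[of _ M] exI[of _ k]) auto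
  qed
  then obtain u where "u \<in> W" "L u = level k" "D u = 0"
    by (rule critical_point_in[OF closed_UNIV, of "level k"])
  then show thesis by (rule that)
qed

text \<open>If the levels stayed bounded below they would converge to some l, and the levels of
  index n + 1 and n + 1 + m would be equally close to l for large n. Giving up m units of genus then
  costs nothing in the limit, while it confines the sets to a closed set without critical points at
  level l.\<close>

theorem level_at_bot:
  assumes inf: "cone_genus W = \<infinity>"
  shows "filterlim level at_bot sequentially"
proof (rule ccontr)
  assume not: "\<not> ?thesis"
  have anti: "level k \<le> level j" if "1 \<le> j" "j \<le> k" for j k
    using level_antimono[of k j] that inf by simp
  have "\<exists>B. \<forall>k\<ge>1. B < level k"
  proof (rule ccontr)
    assume *: "\<not> ?thesis"
    have "filterlim level at_bot sequentially"
      unfolding filterlim_at_bot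
    proof
      fix B
      obtain k where "k \<ge> 1" "level k \<le> B" using * by (meson not_le)
      then show "\<forall>\<^sub>F n in sequentially. level n \<le> B"
        using anti by (intro eventually_sequentiallyI[of k]) fastforce
    qed
    with not show False by simp
  qed
  then obtain B where B: "\<And>k. k \<ge> 1 \<Longrightarrow> B < level k" by blast
  have "decseq (\<lambda>n. level (Suc n))" using anti by (auto simp: decseq_def)
  then obtain l where l: "(\<lambda>n. level (Suc n)) \<longlonglongrightarrow> l" "\<And>n. l \<le> level (Suc n)"
    using decseq_convergent[of "\<lambda>n. level (Suc n)" B] B by (auto simp: less_imp_le)
  define K where "K = {u\<in>W. 1/2 \<le> norm u \<and> norm u \<le> 3/2 \<and> L u = l \<and> D u = 0}"
  have "compact K"
    unfolding compact_eq_seq_compact_metric seq_compact_def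
  proof (intro allI impI)
    fix u :: "nat \<Rightarrow> 'a" assume "\<forall>n. u n \<in> K"
    then have u: "u n \<in> W" "1/2 \<le> norm (u n)" "norm (u n) \<le> 3/2" "L (u n) = l" "D (u n) = 0" for n
      by (auto simp: K_def)
    have "(\<lambda>n. L (u n)) \<longlonglongrightarrow> l" "(\<lambda>n. D (u n)) \<longlonglongrightarrow> 0" by (simp_all add: u)
    then obtain x r where "strict_mono r" "(u \<circ> r) \<longlonglongrightarrow> x" "x \<in> K"
      unfolding K_def mem_Collect_eq by (rule PS_limit[of u, OF u(1-3)]) blast
    then show "\<exists>x\<in>K. \<exists>r. strict_mono r \<and> (u \<circ> r) \<longlonglongrightarrow> x" by blast
  qed
  moreover have "0 \<notin> K" using zero_W by (simp add: K_def)
  ultimately obtain m and f :: "nat \<Rightarrow> 'a \<Rightarrow> real" where f': "\<forall>i. continuous_on UNIV (f i)" "\<forall>i u. f i (- u) = - f i u"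
    and fK: "\<forall>u\<in>K. \<exists>i<m. f i u \<noteq> 0"
    using compact_odd_separation[of K] by blast
  have f: "continuous_on UNIV (f i)" "f i (- u) = - f i u" for i u using f' by simp_all
  define Z where "Z = (\<Inter>i\<in>{..<m}. {u. f i u = 0})"
  have "closed Z" unfolding Z_def
    by (intro closed_INT ballI closed_Collect_eq f continuous_on_const)
  moreover have "\<exists>M k. adm W k M \<and> M \<subseteq> Z \<and> (\<forall>x\<in>M. norm x = 1 \<and> level k - e\<^sup>2 \<le> L x) \<and> \<bar>level k - l\<bar> \<le> e"
    if e: "0 < e" "e < 1/2" for e :: real
  proof -
    have e2: "e\<^sup>2 / 2 > 0" using e by simp
    then have "\<forall>\<^sub>F n in sequentially. level (Suc n) < l + e\<^sup>2 / 2" using order_tendstoD(2)[OF l(1)] by simp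
    then obtain n where n: "level (Suc n) < l + e\<^sup>2 / 2" by (auto simp: eventually_sequentially)
    \<comment> \<open>The extra m units pay for the equations \<open>f i u = 0\<close>. The
      tolerance e^2/2 here and the distance e^2/2 from l add up to the e^2 required below.\<close>
    obtain M where M: "adm W (Suc n + m) M" "\<And>u. u \<in> M \<Longrightarrow> norm u = 1" "\<And>u. u \<in> M \<Longrightarrow> level (Suc n + m) - e\<^sup>2 / 2 \<le> L u"
      using level_approx[of "Suc n + m", OF _ _ e2] inf by auto
    let ?M = "{u\<in>M. \<forall>i<m. f i u = 0}"
    have MZ: "?M = M \<inter> Z" by (auto simp: Z_def)
    have gen: "enat (Suc n) \<le> genus ?M"
      using M(1) by (intro genus_zero_set f) (auto simp: adm_def compact_imp_closed)
    have "adm W (Suc n) ?M"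
      unfolding adm_def
    proof (intro conjI gen)
      show "compact ?M" unfolding MZ using M(1) \<open>closed Z\<close> by (auto simp: adm_def)
      show "symset ?M" using M(1) f(2) by (auto simp: adm_def symset_def)
      show "?M \<noteq> {}" using gen by (metis genus_empty zero_enat_def enat_ord_simps(1) not_less_eq_eq le0)
    qed (use M(1) in \<open>auto simp: adm_def\<close>)
    moreover have "level (Suc n) - e\<^sup>2 \<le> L x" if "x \<in> ?M" for x
      using M(3)[of x] that n l(2)[of "n + m"] by auto
    moreover have "e\<^sup>2 / 2 \<le> e" using e mult_left_mono[of e 2 e] by (simp add: power2_eq_square)
    then have "\<bar>level (Suc n) - l\<bar> \<le> e" using n l(2)[of n] by auto
    ultimately show ?thesis using M(2) MZ by (intro exI[of _ ?M] exI[of _ "Suc n"]) auto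
  qed
  ultimately obtain u where u: "u \<in> W" "u \<in> Z" "1/2 \<le> norm u" "norm u \<le> 3/2" "L u = l" "D u = 0"
    by (rule critical_point_in)
  then have "u \<in> K" by (simp add: K_def)
  from bspec[OF fK this] u(2) show False by (auto simp: Z_def)
qed

end

section \<open>Dual-valued derivatives of even functionals\<close>

lemma C1_on_has_derivative:
  assumes "C1_on UNIV f"
  shows "(f has_derivative blinfun_apply (fderiv f u)) (at u)"
proof -
  have "(f has_derivative frechet_derivative f (at u)) (at u)"
    using assms by (simp add: C1_on_def frechet_derivative_works[symmetric])
  then show ?thesis
    by (simp add: fderiv_def bounded_linear_Blinfun_apply has_derivative_bounded_linear)
qed

lemma fderiv_eqI: "(f has_derivative blinfun_apply F) (at u) \<Longrightarrow> fderiv f u = F"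
  by (simp add: fderiv_def frechet_derivative_at[symmetric] blinfun_apply_inverse)

lemma C1_on_continuous: "C1_on UNIV f \<Longrightarrow> continuous_on S f"
  by (blast intro: continuous_at_imp_continuous_on has_derivative_continuous C1_on_has_derivative)

lemma fderiv_even:
  assumes "C1_on UNIV f" "even_functional f"
  shows "fderiv f (- u) = - fderiv f u"
proof (rule fderiv_eqI)
  have "(f has_derivative blinfun_apply (fderiv f u)) (at (- (- u)))"
    using C1_on_has_derivative[OF assms(1), of u] by simp
  then have "((\<lambda>x. f (- x)) has_derivative (\<lambda>h. fderiv f u (- h))) (at (- u))"
    by (intro has_derivative_compose[where f = uminus and g = f] derivative_intros)
  then show "(f has_derivative blinfun_apply (- fderiv f u)) (at (- u))"
    using assms(2) by (simp add: even_functional_def blinfun.minus_right blinfun.minus_left[abs_def])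
qed

section \<open>The functional in terms of the parameter\<close>

locale setting =
  fixes N A B :: "'a::banach \<Rightarrow> real" and \<alpha> \<eta> \<beta> C C' :: real
  assumes exponents: "1 < \<alpha>" "\<alpha> < \<eta>" "\<eta> < \<beta>"
    and C1: "C1_on UNIV N" "C1_on UNIV A" "C1_on UNIV B"
    and even: "even_functional N" "even_functional A" "even_functional B"
    and homog: "homogeneous \<eta> N" "homogeneous \<alpha> A" "homogeneous \<beta> B"
    and C_pos: "C > 0" "C' > 0"
    and N_le: "\<And>u. N u \<le> C' * norm u powr \<eta>"
    and N_ge: "\<And>u. N u \<ge> inverse C * norm u powr \<eta>"
    and A_le: "\<And>u. \<bar>A u\<bar> \<le> C * norm u powr \<alpha>"
    and B_le: "\<And>u. \<bar>B u\<bar> \<le> C * norm u powr \<beta>"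
    and Phi_PS: "\<And>(l :: nat \<Rightarrow> real) (u :: nat \<Rightarrow> 'a).
           bounded (range l) \<Longrightarrow> bounded (range u) \<Longrightarrow>
           bounded (range (\<lambda>n. Phi \<eta> \<alpha> \<beta> N A B (l n) (u n))) \<Longrightarrow>
           (\<lambda>n. fderiv (Phi \<eta> \<alpha> \<beta> N A B (l n)) (u n)) \<longlonglongrightarrow> 0 \<Longrightarrow>
           \<exists>r. strict_mono r \<and> convergent (u \<circ> r)"
begin

text \<open>For \<open>A v \<noteq> 0\<close>, \<open>lam c v\<close> is the unique parameter with \<open>\<Phi> (lam c v) v = c\<close>, and \<open>G c (t v)\<close>
  is a positive multiple of \<open>A v\<close> times the derivative of \<open>t \<mapsto> lam c (t v)\<close>.\<close>

definition lam :: "real \<Rightarrow> 'a \<Rightarrow> real" where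
  "lam c v = \<alpha> * (N v / \<eta> - B v / \<beta> - c) / A v"

definition G :: "real \<Rightarrow> 'a \<Rightarrow> real" where
  "G c v = (\<eta> - \<alpha>) / \<eta> * N v - (\<beta> - \<alpha>) / \<beta> * B v + \<alpha> * c"

abbreviation DPhi :: "real \<Rightarrow> 'a \<Rightarrow> 'a \<Rightarrow>\<^sub>L real" where
  "DPhi l \<equiv> fderiv (Phi \<eta> \<alpha> \<beta> N A B l)"

text \<open>Implicit differentiation of \<Phi> (lam c v) v = c, the derivative of \<Phi> in its
  parameter being - A v / \<alpha>; so \<open>Dlam\<close> and \<open>DPhi\<close> vanish together
  where A v \<noteq> 0.\<close>

definition Dlam :: "real \<Rightarrow> 'a \<Rightarrow> 'a \<Rightarrow>\<^sub>L real" where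
  "Dlam c v = (\<alpha> / A v) *\<^sub>R DPhi (lam c v) v"

lemma pos: "0 < \<alpha>" "0 < \<eta>" "0 < \<beta>" "0 < \<eta> - \<alpha>" "0 < \<beta> - \<eta>" "0 < \<beta> - \<alpha>"
  using exponents by auto

lemma scale:
  assumes "t > 0"
  shows "N (t *\<^sub>R u) = t powr \<eta> * N u" "A (t *\<^sub>R u) = t powr \<alpha> * A u" "B (t *\<^sub>R u) = t powr \<beta> * B u"
  using homog assms by (auto simp: homogeneous_def)

lemma minus [simp]: "N (- u) = N u" "A (- u) = A u" "B (- u) = B u"
  using even by (auto simp: even_functional_def)

lemma G_minus [simp]: "G c (- v) = G c v" and lam_minus [simp]: "lam c (- v) = lam c v"
  by (simp_all add: G_def lam_def)

lemma DPhi_eq: "DPhi l v = (1 / \<eta>) *\<^sub>R fderiv N v - (l / \<alpha>) *\<^sub>R fderiv A v - (1 / \<beta>) *\<^sub>R fderiv B v"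
proof (rule fderiv_eqI)
  have "((\<lambda>u. 1 / \<eta> * N u - l / \<alpha> * A u - 1 / \<beta> * B u) has_derivative
    (\<lambda>h. 1 / \<eta> * fderiv N v h - l / \<alpha> * fderiv A v h - 1 / \<beta> * fderiv B v h)) (at v)"
    by (intro has_derivative_diff has_derivative_mult_right C1_on_has_derivative C1)
  then show "(Phi \<eta> \<alpha> \<beta> N A B l has_derivative
      blinfun_apply ((1 / \<eta>) *\<^sub>R fderiv N v - (l / \<alpha>) *\<^sub>R fderiv A v - (1 / \<beta>) *\<^sub>R fderiv B v)) (at v)"
    by (simp add: Phi_def[abs_def] blinfun.diff_left[abs_def] blinfun.scaleR_left[abs_def])
qed

lemma DPhi_minus: "DPhi l (- v) = - DPhi l v"
  by (simp add: DPhi_eq fderiv_even C1 even algebra_simps)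

lemma Dlam_minus: "Dlam c (- v) = - Dlam c v"
  by (simp add: Dlam_def DPhi_minus)

lemma Phi_lam: "A v \<noteq> 0 \<Longrightarrow> Phi \<eta> \<alpha> \<beta> N A B (lam c v) v = c"
  using pos by (simp add: Phi_def lam_def field_simps)

lemma lam_diff: "A v < 0 \<Longrightarrow> lam c' v = lam c v + \<alpha> * (c' - c) / (- A v)"
  by (simp add: lam_def field_simps)

text \<open>Eliminating \<open>B v\<close> through \<open>G c v = 0\<close> leaves a numerator in
  \<open>N v\<close> and c alone. Its sign decides the sign of \<lambda> at fibre critical points,
  and its size converts bounds on \<lambda> into bounds on \<open>A v\<close>.\<close>

lemma lam_crit:
  assumes "G c v = 0"
  shows "lam c v = \<alpha> * (((\<beta> - \<eta>) / \<eta> * N v - \<beta> * c) / (\<beta> - \<alpha>)) / A v"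
proof -
  have "B v / \<beta> = ((\<eta> - \<alpha>) / \<eta> * N v + \<alpha> * c) / (\<beta> - \<alpha>)"
    using assms pos by (simp add: G_def field_simps)
  moreover have "N v / \<eta> - ((\<eta> - \<alpha>) / \<eta> * N v + \<alpha> * c) / (\<beta> - \<alpha>) - c = ((\<beta> - \<eta>) / \<eta> * N v - \<beta> * c) / (\<beta> - \<alpha>)"
    using pos by (simp add: divide_simps) (simp add: algebra_simps)
  ultimately show ?thesis by (simp add: lam_def)
qed

lemma lam_has_derivative:
  assumes "A v \<noteq> 0"
  shows "(lam c has_derivative blinfun_apply (Dlam c v)) (at v)"
proof -
  have 1: "(\<lambda>v. \<alpha> * (1 / \<eta> * N v - 1 / \<beta> * B v - c) / A v) = lam c" by (simp add: lam_def fun_eq_iff)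
  have "((\<lambda>v. \<alpha> * (1 / \<eta> * N v - 1 / \<beta> * B v - c)) has_derivative
      (\<lambda>h. \<alpha> * (1 / \<eta> * fderiv N v h - 1 / \<beta> * fderiv B v h - 0))) (at v)"
    by (intro has_derivative_diff has_derivative_mult_right has_derivative_const C1_on_has_derivative C1)
  from has_derivative_divide'[OF this C1_on_has_derivative[OF C1(2)] assms]
  have "(lam c has_derivative (\<lambda>h. (\<alpha> * (1 / \<eta> * fderiv N v h - 1 / \<beta> * fderiv B v h - 0) * A v -
      \<alpha> * (1 / \<eta> * N v - 1 / \<beta> * B v - c) * fderiv A v h) / (A v * A v))) (at v)"
    unfolding 1 .
  moreover have "(\<lambda>h. (\<alpha> * (1 / \<eta> * fderiv N v h - 1 / \<beta> * fderiv B v h - 0) * A v -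
      \<alpha> * (1 / \<eta> * N v - 1 / \<beta> * B v - c) * fderiv A v h) / (A v * A v)) = blinfun_apply (Dlam c v)"
    using assms pos
    by (simp add: fun_eq_iff Dlam_def DPhi_eq lam_def blinfun.diff_left blinfun.scaleR_left) (simp add: field_simps)
  ultimately show ?thesis by simp
qed

lemma lam_continuous: "continuous_on {v. A v \<noteq> 0} (lam c)"
  unfolding lam_def by (intro continuous_intros C1_on_continuous C1) (use pos in auto)

lemma Dlam_continuous: "continuous_on {v. A v \<noteq> 0} (Dlam c)"
proof -
  have "continuous_on S (fderiv N)" "continuous_on S (fderiv A)" "continuous_on S (fderiv B)" for S
    using C1 by (auto simp: C1_on_def intro: continuous_on_subset)
  then show ?thesis unfolding Dlam_def DPhi_eq
    using pos by (intro continuous_intros C1_on_continuous C1 lam_continuous) simp_all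
qed

lemma G_continuous: "continuous_on S (G c)"
  unfolding G_def by (intro continuous_intros C1_on_continuous C1) (use pos in auto)

lemma fibre_derivative:
  assumes "x > 0" "A u \<noteq> 0"
  shows "((\<lambda>x. lam c (x *\<^sub>R u)) has_real_derivative \<alpha> / A u * (x powr (- \<alpha> - 1) * G c (x *\<^sub>R u))) (at x)"
proof -
  let ?f = "\<lambda>x. \<alpha> / A u * (N u / \<eta> * x powr (\<eta> - \<alpha>) - B u / \<beta> * x powr (\<beta> - \<alpha>) - c * x powr (- \<alpha>))"
  have p: "x powr (\<eta> - \<alpha> - 1) = x powr \<eta> * x powr (- \<alpha> - 1)"
    "x powr (\<beta> - \<alpha> - 1) = x powr \<beta> * x powr (- \<alpha> - 1)"
    by (simp_all flip: powr_add add: algebra_simps)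
  have "(?f has_real_derivative \<alpha> / A u * (N u / \<eta> * ((\<eta> - \<alpha>) * x powr (\<eta> - \<alpha> - 1)) - B u / \<beta> * ((\<beta> - \<alpha>) * x powr (\<beta> - \<alpha> - 1))
     - c * (- \<alpha> * x powr (- \<alpha> - 1)))) (at x)"
    by (intro DERIV_cmult DERIV_diff has_real_derivative_powr assms(1))
  also have "\<alpha> / A u * (N u / \<eta> * ((\<eta> - \<alpha>) * x powr (\<eta> - \<alpha> - 1)) - B u / \<beta> * ((\<beta> - \<alpha>) * x powr (\<beta> - \<alpha> - 1))
     - c * (- \<alpha> * x powr (- \<alpha> - 1))) = \<alpha> / A u * (x powr (- \<alpha> - 1) * G c (x *\<^sub>R u))"
    unfolding p G_def scale[OF assms(1)] using assms pos by (simp add: field_simps)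
  finally show ?thesis
  proof (rule has_field_derivative_transform_within_open[of _ _ _ "{0<..}"])
    show "?f y = lam c (y *\<^sub>R u)" if "y \<in> {0<..}" for y
      using that assms pos
      by (simp add: lam_def scale powr_diff powr_minus divide_simps)
  qed (use assms in simp_all)
qed

end

section \<open>Fibre maps\<close>

text \<open>On each ray through a point of \<open>W\<close> the function \<open>lam c\<close> has exactly one critical point in \<open>F\<close>:
  a maximum if \<open>\<sigma> = 1\<close>, a minimum if \<open>\<sigma> = -1\<close>.\<close>

locale fibres = setting +
  fixes F W :: "'a set" and \<sigma> :: real and I :: "real set"
  assumes F_open: "open F" and F_sym: "\<And>v. v \<in> F \<Longrightarrow> - v \<in> F"
    and F_mid: "\<And>u s t x. s *\<^sub>R u \<in> F \<Longrightarrow> t *\<^sub>R u \<in> F \<Longrightarrow> 0 < s \<Longrightarrow> s \<le> x \<Longrightarrow> x \<le> t \<Longrightarrow> x *\<^sub>R u \<in> F"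
    and W_open: "open W" and W_sym: "symset W" and W_cone: "\<And>u t. u \<in> W \<Longrightarrow> 0 < t \<Longrightarrow> t *\<^sub>R u \<in> W"
    and W_neg: "\<And>u. u \<in> W \<Longrightarrow> A u < 0"
    and \<sigma>: "\<sigma> = 1 \<or> \<sigma> = - 1"
    and I_open: "open I" and I_interval: "is_interval I"
    and zero_ex: "\<And>c u. c \<in> I \<Longrightarrow> u \<in> W \<Longrightarrow> \<exists>t>0. t *\<^sub>R u \<in> F \<and> G c (t *\<^sub>R u) = 0"
    and zero_below: "\<And>c v s. c \<in> I \<Longrightarrow> v \<in> W \<Longrightarrow> v \<in> F \<Longrightarrow> G c v = 0 \<Longrightarrow> 0 < s \<Longrightarrow> s < 1 \<Longrightarrow> s *\<^sub>R v \<in> F \<Longrightarrow> \<sigma> * G c (s *\<^sub>R v) < 0"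
    and zero_above: "\<And>c v s. c \<in> I \<Longrightarrow> v \<in> W \<Longrightarrow> v \<in> F \<Longrightarrow> G c v = 0 \<Longrightarrow> 1 < s \<Longrightarrow> s *\<^sub>R v \<in> F \<Longrightarrow> 0 < \<sigma> * G c (s *\<^sub>R v)"
    and neg: "\<And>c v. c \<in> I \<Longrightarrow> v \<in> W \<Longrightarrow> v \<in> F \<Longrightarrow> G c v = 0 \<Longrightarrow> \<beta> * c < (\<beta> - \<eta>) / \<eta> * N v"
    and ctrl: "\<And>c1 c2 r. c1 \<in> I \<Longrightarrow> c2 \<in> I \<Longrightarrow> \<exists>a>0. \<exists>b>0. \<exists>d>0. \<exists>Q. closed Q \<and>
      (\<forall>v\<in>Q. \<forall>s>0. s *\<^sub>R v \<in> Q) \<and> Q - {0} \<subseteq> W \<and>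
      (\<forall>c\<in>{c1..c2}. \<forall>v\<in>W \<inter> F. G c v = 0 \<longrightarrow> d \<le> norm v \<and>
        (r \<le> lam c v \<longrightarrow> norm v \<le> b \<and> a * norm v powr \<alpha> \<le> - A v \<and> v \<in> Q))"
begin

section \<open>The critical parameter on a ray and the reduced functional\<close>

definition tm :: "real \<Rightarrow> 'a \<Rightarrow> real" where
  "tm c u = (SOME t. 0 < t \<and> t *\<^sub>R u \<in> F \<and> G c (t *\<^sub>R u) = 0)"

definition vv :: "real \<Rightarrow> 'a \<Rightarrow> 'a" where "vv c u = tm c u *\<^sub>R u"

definition Lf :: "real \<Rightarrow> 'a \<Rightarrow> real" where "Lf c u = lam c (vv c u)"

text \<open>No derivative of \<open>tm\<close> enters, since \<open>G c (vv c u) = 0\<close> makes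
  \<open>Dlam c (vv c u)\<close> annihilate the direction of the ray.\<close>

definition Df :: "real \<Rightarrow> 'a \<Rightarrow> 'a \<Rightarrow>\<^sub>L real" where "Df c u = tm c u *\<^sub>R Dlam c (vv c u)"

lemma zero_W: "0 \<notin> W"
proof
  assume "0 \<in> W"
  then have "A 0 < 0" by (rule W_neg)
  moreover have "A 0 = 2 powr \<alpha> * A 0" using scale(2)[of 2 0] by simp
  ultimately show False using pos by simp
qed

lemma tm: 
  assumes "c \<in> I" "u \<in> W"
  shows "0 < tm c u" "vv c u \<in> F" "G c (vv c u) = 0" "vv c u \<in> W" "vv c u \<noteq> 0" "A (vv c u) < 0"
proof -
  have "0 < tm c u \<and> tm c u *\<^sub>R u \<in> F \<and> G c (tm c u *\<^sub>R u) = 0"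
    unfolding tm_def by (rule someI_ex) (use zero_ex[OF assms] in blast)
  then show *: "0 < tm c u" "vv c u \<in> F" "G c (vv c u) = 0" by (simp_all add: vv_def)
  show "vv c u \<in> W" unfolding vv_def by (rule W_cone[OF assms(2) *(1)])
  then show "vv c u \<noteq> 0" "A (vv c u) < 0" using zero_W W_neg by auto
qed

lemma sign_below:
  assumes "c \<in> I" "u \<in> W" "0 < t" "t < tm c u" "t *\<^sub>R u \<in> F"
  shows "\<sigma> * G c (t *\<^sub>R u) < 0"
proof -
  note T = tm[OF assms(1,2)]
  have eq: "t *\<^sub>R u = (t / tm c u) *\<^sub>R vv c u" using T(1) by (simp add: vv_def)
  show ?thesis unfolding eq
    by (rule zero_below[OF assms(1) T(4) T(2,3)]) (use assms T(1) eq in auto)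
qed

lemma sign_above:
  assumes "c \<in> I" "u \<in> W" "tm c u < t" "t *\<^sub>R u \<in> F"
  shows "0 < \<sigma> * G c (t *\<^sub>R u)"
proof -
  note T = tm[OF assms(1,2)]
  have eq: "t *\<^sub>R u = (t / tm c u) *\<^sub>R vv c u" using T(1) by (simp add: vv_def)
  show ?thesis unfolding eq
    by (rule zero_above[OF assms(1) T(4) T(2,3)]) (use assms T(1) eq in auto)
qed

lemma tm_unique:
  assumes "c \<in> I" "u \<in> W" "0 < t" "t *\<^sub>R u \<in> F" "G c (t *\<^sub>R u) = 0"
  shows "tm c u = t"
  using sign_below[OF assms(1-3) _ assms(4)] sign_above[OF assms(1,2) _ assms(4)] assms(5)
  by (cases "tm c u" t rule: linorder_cases) auto

lemma tm_scale:
  assumes "c \<in> I" "u \<in> W" "0 < s"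
  shows "tm c (s *\<^sub>R u) = tm c u / s" "vv c (s *\<^sub>R u) = vv c u"
proof -
  note T = tm[OF assms(1,2)]
  show 1: "tm c (s *\<^sub>R u) = tm c u / s"
    by (rule tm_unique[OF assms(1) W_cone[OF assms(2,3)]]) (use T assms(3) in \<open>auto simp: vv_def\<close>)
  show "vv c (s *\<^sub>R u) = vv c u" using assms(3) by (simp add: vv_def 1)
qed

lemma tm_minus:
  assumes "c \<in> I" "u \<in> W"
  shows "tm c (- u) = tm c u" "vv c (- u) = - vv c u"
proof -
  note T = tm[OF assms]
  show 1: "tm c (- u) = tm c u"
    by (rule tm_unique[OF assms(1) symsetD[OF W_sym assms(2)]]) (use T F_sym in \<open>auto simp: vv_def\<close>)
  show "vv c (- u) = - vv c u" by (simp add: vv_def 1)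
qed

text \<open>The zero on a ray is a strict sign change, so the signs of \<open>\<sigma> * G c\<close>
  at parameters s < tm c u < t persist on nearby rays and trap their zeros between s and t.\<close>

lemma tm_continuous:
  assumes "c \<in> I"
  shows "continuous_on W (tm c)"
proof (rule continuous_at_imp_continuous_on, rule ballI)
  fix u assume u: "u \<in> W"
  note T = tm[OF assms u]
  show "isCont (tm c) u"
    unfolding isCont_def
  proof (rule tendstoI)
    fix e :: real assume e: "0 < e"
    have "open ((\<lambda>t. t *\<^sub>R u) -` F)"
      by (intro open_vimage F_open continuous_intros)
    moreover have "tm c u \<in> (\<lambda>t. t *\<^sub>R u) -` F" using T(2) by (simp add: vv_def)
    ultimately obtain d where d: "d > 0" "ball (tm c u) d \<subseteq> (\<lambda>t. t *\<^sub>R u) -` F"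
      using open_contains_ball by blast
    define m where "m = Min {d, e, tm c u}"
    have m: "m > 0" "m \<le> d" "m \<le> e" "m \<le> tm c u" using d e T(1) by (auto simp: m_def)
    define s t where "s = tm c u - m / 2" and "t = tm c u + m / 2"
    have st: "0 < s" "s < tm c u" "tm c u < t" "tm c u - e < s" "t < tm c u + e" using m by (auto simp: s_def t_def)
    have F: "s *\<^sub>R u \<in> F" "t *\<^sub>R u \<in> F"
      using m by (intro subsetD[OF d(2), simplified]; simp add: s_def t_def dist_real_def)+
    have sg: "\<sigma> * G c (s *\<^sub>R u) < 0" "0 < \<sigma> * G c (t *\<^sub>R u)"
      using sign_below[OF assms u st(1,2) F(1)] sign_above[OF assms u st(3) F(2)] .
    have cG: "((\<lambda>w. \<sigma> * G c (x *\<^sub>R w)) \<longlongrightarrow> \<sigma> * G c (x *\<^sub>R u)) (at u)" for x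
    proof -
      have "continuous_on UNIV (\<lambda>w. \<sigma> * G c (x *\<^sub>R w))"
        by (intro continuous_intros continuous_on_compose2[OF G_continuous[of UNIV]]) auto
      then show ?thesis by (simp add: continuous_on_def)
    qed
    have cx: "((\<lambda>w. x *\<^sub>R w) \<longlongrightarrow> x *\<^sub>R u) (at u)" for x by (intro tendsto_intros)
    have "\<forall>\<^sub>F w in at u. w \<in> W" using topological_tendstoD[OF tendsto_ident_at W_open u] .
    moreover note topological_tendstoD[OF cx F_open F(1)] topological_tendstoD[OF cx F_open F(2)]
      order_tendstoD(2)[OF cG sg(1)] order_tendstoD(1)[OF cG sg(2)]
    ultimately show "\<forall>\<^sub>F w in at u. dist (tm c w) (tm c u) < e"
    proof eventually_elim
      case (elim w)
      note Tw = tm[OF assms elim(1)]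
      have "s < tm c w"
        using sign_above[OF assms elim(1) _ elim(2)] elim(4) Tw(3) by (cases "tm c w" s rule: linorder_cases) (auto simp: vv_def)
      moreover have "tm c w < t"
        using sign_below[OF assms elim(1) _ _ elim(3)] elim(5) Tw(3) st T(1) by (cases "tm c w" t rule: linorder_cases) (auto simp: vv_def)
      ultimately show ?case using st by (auto simp: dist_real_def)
    qed
  qed
qed

lemma vv_continuous: "c \<in> I \<Longrightarrow> continuous_on W (vv c)"
  unfolding vv_def by (intro continuous_intros tm_continuous)

text \<open>As \<open>A u < 0\<close>, the derivative of \<open>\<sigma> * lam c\<close> along the
  ray has the sign opposite to \<open>\<sigma> * G c\<close>: the function rises up to
  \<open>tm c u\<close> and falls afterwards. \<open>F_mid\<close> keeps the segment in between
  inside \<open>F\<close>, where the signs are known.\<close>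

lemma extremal:
  assumes c: "c \<in> I" and u: "u \<in> W" and t: "0 < t" "t *\<^sub>R u \<in> F"
  shows "\<sigma> * lam c (t *\<^sub>R u) \<le> \<sigma> * Lf c u"
proof -
  note T = tm[OF c u]
  have A: "A u < 0" by (rule W_neg[OF u])
  have der: "((\<lambda>x. \<sigma> * lam c (x *\<^sub>R u)) has_real_derivative \<alpha> * x powr (- \<alpha> - 1) / (- A u) * - (\<sigma> * G c (x *\<^sub>R u))) (at x)" if "x > 0" for x
    using DERIV_cmult[OF fibre_derivative[OF that, of u c], of \<sigma>] A by (simp add: field_simps)
  have fac: "0 \<le> \<alpha> * x powr (- \<alpha> - 1) / (- A u)" for x using A pos by (simp add: divide_nonneg_neg)
  show ?thesis
  proof (cases "t \<le> tm c u")
    case True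
    have "\<sigma> * lam c (t *\<^sub>R u) \<le> \<sigma> * lam c (tm c u *\<^sub>R u)"
    proof (rule DERIV_nonneg_imp_nondecreasing[OF True])
      fix x assume x: "t \<le> x" "x \<le> tm c u"
      have "x *\<^sub>R u \<in> F" using F_mid[OF t(2) _ t(1) x] T(2) by (simp add: vv_def)
      then have "\<sigma> * G c (x *\<^sub>R u) \<le> 0"
        using sign_below[OF c u, of x] x t T(3) by (cases "x = tm c u") (auto simp: vv_def)
      then have "0 \<le> \<alpha> * x powr (- \<alpha> - 1) / (- A u) * - (\<sigma> * G c (x *\<^sub>R u))" by (intro mult_nonneg_nonneg fac) simp
      with der[of x] x t show "\<exists>y. ((\<lambda>x. \<sigma> * lam c (x *\<^sub>R u)) has_real_derivative y) (at x) \<and> 0 \<le> y" by auto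
    qed
    then show ?thesis by (simp add: Lf_def vv_def)
  next
    case False
    then have le: "tm c u \<le> t" by simp
    have "\<sigma> * lam c (tm c u *\<^sub>R u) \<ge> \<sigma> * lam c (t *\<^sub>R u)"
    proof (rule DERIV_nonpos_imp_nonincreasing[OF le])
      fix x assume x: "tm c u \<le> x" "x \<le> t"
      have "x *\<^sub>R u \<in> F" using F_mid[OF _ t(2) T(1) x] T(2) by (simp add: vv_def)
      then have "0 \<le> \<sigma> * G c (x *\<^sub>R u)"
        using sign_above[OF c u, of x] x t T(3) by (cases "x = tm c u") (auto simp: vv_def)
      then have "\<alpha> * x powr (- \<alpha> - 1) / (- A u) * - (\<sigma> * G c (x *\<^sub>R u)) \<le> 0" by (intro mult_nonneg_nonpos fac) simp
      with der[of x] x T show "\<exists>y. ((\<lambda>x. \<sigma> * lam c (x *\<^sub>R u)) has_real_derivative y) (at x) \<and> y \<le> 0" by auto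
    qed
    then show ?thesis by (simp add: Lf_def vv_def)
  qed
qed

lemma Df_continuous:
  assumes "c \<in> I"
  shows "continuous_on W (Df c)"
  unfolding Df_def
  by (intro continuous_intros tm_continuous continuous_on_compose2[OF Dlam_continuous vv_continuous] assms)
    (use tm[OF assms] in force)

lemma Lf_has_derivative:
  assumes c: "c \<in> I" and u: "u \<in> W"
  shows "(Lf c has_derivative blinfun_apply (Df c u)) (at u)"
  unfolding has_derivative_at_alt
proof (intro conjI allI impI)
  show "bounded_linear (blinfun_apply (Df c u))" by (rule blinfun.bounded_linear_right)
  fix e :: real assume e: "0 < e"
  note T = tm[OF c u]
  let ?S = "{0::real<..} \<times> W"
  have "continuous_on ?S (\<lambda>p. fst p *\<^sub>R Dlam c (fst p *\<^sub>R snd p))"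
  proof (intro continuous_intros continuous_on_compose2[OF Dlam_continuous])
    show "(\<lambda>p. fst p *\<^sub>R snd p) ` ?S \<subseteq> {v. A v \<noteq> 0}"
      using W_cone W_neg by force
  qed
  moreover have S: "open ?S" by (intro open_Times W_open open_greaterThan)
  moreover have uS: "(tm c u, u) \<in> ?S" using T u by simp
  ultimately have "isCont (\<lambda>p. fst p *\<^sub>R Dlam c (fst p *\<^sub>R snd p)) (tm c u, u)"
    by (simp add: continuous_on_eq_continuous_at)
  then have "\<forall>\<^sub>F p in nhds (tm c u, u). dist (fst p *\<^sub>R Dlam c (fst p *\<^sub>R snd p)) (Df c u) < e"
    using e unfolding continuous_at_eps_delta Df_def vv_def
    by (auto simp: eventually_nhds_metric)
  moreover have "\<forall>\<^sub>F p in nhds (tm c u, u). p \<in> ?S" using S uS by (rule eventually_nhds_in_open)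
  moreover have "\<forall>\<^sub>F p in nhds (tm c u, u). fst p *\<^sub>R snd p \<in> F"
  proof -
    have "open ((\<lambda>p. fst p *\<^sub>R snd p) -` F)" by (intro open_vimage F_open continuous_intros)
    then show ?thesis using T(2) by (auto simp: vv_def dest: eventually_nhds_in_open[of _ "(tm c u, u)"])
  qed
  ultimately have "\<forall>\<^sub>F p in nhds (tm c u, u). p \<in> ?S \<and> fst p *\<^sub>R snd p \<in> F \<and> dist (fst p *\<^sub>R Dlam c (fst p *\<^sub>R snd p)) (Df c u) < e"
    by eventually_elim auto
  then obtain d where d: "d > 0" "\<And>t w. dist (t, w) (tm c u, u) < d \<Longrightarrow> 0 < t \<and> w \<in> W \<and> t *\<^sub>R w \<in> F \<and> dist (t *\<^sub>R Dlam c (t *\<^sub>R w)) (Df c u) < e"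
    unfolding eventually_nhds_metric by auto
  have near: "dist (t, w) (tm c u, u) < d" if "dist t (tm c u) < d / 2" "dist w u < d / 2" for t w
    using that real_sqrt_sum_squares_triangle_ineq[of "dist t (tm c u)" 0 0 "dist w u"] by (auto simp: dist_prod_def)
  have line: "\<bar>lam c (t *\<^sub>R w) - lam c (t *\<^sub>R u) - Df c u (w - u)\<bar> \<le> e * norm (w - u)"
    if t: "dist t (tm c u) < d / 2" and w: "dist w u < d / 2" for t w
  proof -
    have "norm ((lam c (t *\<^sub>R w) - Df c u w) - (lam c (t *\<^sub>R u) - Df c u u)) \<le> e * norm (w - u)"
    proof (rule differentiable_bound[of "ball u (d / 2)" _ "\<lambda>x. blinfun_apply (t *\<^sub>R Dlam c (t *\<^sub>R x) - Df c u)"])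
      fix x assume "x \<in> ball u (d / 2)"
      then have "dist (t, x) (tm c u, u) < d" using near[OF t] by (simp add: dist_commute)
      note x = d(2)[OF this]
      have "A (t *\<^sub>R x) \<noteq> 0" using W_neg[OF W_cone[of x t]] x by auto
      then have "((\<lambda>x. lam c (t *\<^sub>R x)) has_derivative (\<lambda>h. Dlam c (t *\<^sub>R x) (t *\<^sub>R h))) (at x)"
        by (intro has_derivative_compose[where f = "\<lambda>x. t *\<^sub>R x" and g = "lam c"] lam_has_derivative)
          (auto intro!: derivative_eq_intros)
      then have "((\<lambda>x. lam c (t *\<^sub>R x) - Df c u x) has_derivative (\<lambda>h. Dlam c (t *\<^sub>R x) (t *\<^sub>R h) - Df c u h)) (at x)"
        by (intro has_derivative_diff bounded_linear_imp_has_derivative blinfun.bounded_linear_right)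
      then show "((\<lambda>x. lam c (t *\<^sub>R x) - Df c u x) has_derivative blinfun_apply (t *\<^sub>R Dlam c (t *\<^sub>R x) - Df c u)) (at x within ball u (d / 2))"
        by (simp add: blinfun.diff_left[abs_def] blinfun.scaleR_left[abs_def] blinfun.scaleR_right has_derivative_at_withinI)
      show "onorm (blinfun_apply (t *\<^sub>R Dlam c (t *\<^sub>R x) - Df c u)) \<le> e"
        using x by (simp add: norm_blinfun.rep_eq[symmetric] dist_norm)
    qed (use d w in \<open>auto simp: dist_commute\<close>)
    then show ?thesis by (simp add: blinfun.diff_right algebra_simps)
  qed
  have "isCont (tm c) u" using tm_continuous[OF c] W_open u by (simp add: continuous_on_eq_continuous_at)
  then obtain d' where d': "d' > 0" "\<And>w. dist w u < d' \<Longrightarrow> dist (tm c w) (tm c u) < d / 2"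
    using d(1) unfolding continuous_at_eps_delta by (metis half_gt_zero)
  show "\<exists>d>0. \<forall>w. norm (w - u) < d \<longrightarrow> norm (Lf c w - Lf c u - Df c u (w - u)) \<le> e * norm (w - u)"
  proof (intro exI[of _ "min d' (d / 2)"] conjI allI impI)
    show "0 < min d' (d / 2)" using d d' by simp
    fix w assume "norm (w - u) < min d' (d / 2)"
    then have w: "dist w u < d'" "dist w u < d / 2" by (auto simp: dist_norm)
    have u0: "dist u u < d / 2" and t0: "dist (tm c u) (tm c u) < d / 2" using d by auto
    note tw = d'(2)[OF w(1)]
    have wW: "w \<in> W" using d(2)[OF near[OF t0 w(2)]] by simp
    have 1: "\<sigma> * lam c (tm c u *\<^sub>R w) \<le> \<sigma> * Lf c w"
      using extremal[OF c wW T(1)] d(2)[OF near[OF t0 w(2)]] by simp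
    have 2: "\<sigma> * lam c (tm c w *\<^sub>R u) \<le> \<sigma> * Lf c u"
      using extremal[OF c u tm(1)[OF c wW]] d(2)[OF near[OF tw u0]] by simp
    have eq: "Lf c w = lam c (tm c w *\<^sub>R w)" "Lf c u = lam c (tm c u *\<^sub>R u)" by (simp_all add: Lf_def vv_def)
    show "norm (Lf c w - Lf c u - Df c u (w - u)) \<le> e * norm (w - u)"
      using \<sigma> 1 2 line[OF tw w(2)] line[OF t0 w(2)] unfolding eq real_norm_def abs_le_iff by auto
  qed
qed

section \<open>The reduced functional meets the requirements of the minimax principle\<close>

lemma Lf_neg:
  assumes "c \<in> I" "u \<in> W"
  shows "Lf c u < 0"
proof -
  note T = tm[OF assms]
  have "0 < \<alpha> * (((\<beta> - \<eta>) / \<eta> * N (vv c u) - \<beta> * c) / (\<beta> - \<alpha>))"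
    using neg[OF assms(1) T(4,2,3)] pos by simp
  then show ?thesis unfolding Lf_def lam_crit[OF T(3)] using T(6) by (rule divide_pos_neg)
qed

text \<open>A lower bound on \<lambda> places the fibre points in the closed set \<open>Q\<close> of
  \<open>ctrl\<close>, and with them the points \<open>u n\<close>, since \<open>Q\<close> is a
  cone. A limit in \<open>Q\<close> of norm at least 1/2 is nonzero, hence still in
  \<open>W\<close>.\<close>

lemma sup_closed:
  assumes c: "c \<in> I"
  shows "closed {u\<in>W. 1/2 \<le> norm u \<and> norm u \<le> 3/2 \<and> r \<le> Lf c u}"
  unfolding closed_sequential_limits
proof (intro allI impI, elim conjE)
  fix u :: "nat \<Rightarrow> 'a" and l
  assume "\<forall>n. u n \<in> {u\<in>W. 1/2 \<le> norm u \<and> norm u \<le> 3/2 \<and> r \<le> Lf c u}" and l: "u \<longlonglongrightarrow> l"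
  then have u: "u n \<in> W" "1/2 \<le> norm (u n)" "norm (u n) \<le> 3/2" "r \<le> Lf c (u n)" for n by auto
  obtain a b d Q where Q: "closed Q" "\<And>v s. v \<in> Q \<Longrightarrow> 0 < s \<Longrightarrow> s *\<^sub>R v \<in> Q" "Q - {0} \<subseteq> W"
    and Q': "\<And>v. v \<in> W \<Longrightarrow> v \<in> F \<Longrightarrow> G c v = 0 \<Longrightarrow> r \<le> lam c v \<Longrightarrow> v \<in> Q"
    using ctrl[OF c c, of r] by auto
  have "u n \<in> Q" for n
  proof -
    note T = tm[OF c u(1)[of n]]
    have "vv c (u n) \<in> Q" using Q'[OF T(4,2,3)] u(4)[of n] by (simp add: Lf_def)
    from Q(2)[OF this, of "1 / tm c (u n)"] show ?thesis using T(1) by (simp add: vv_def)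
  qed
  then have "l \<in> Q" using closed_sequentially[OF Q(1) _ l] by blast
  moreover have nl: "1/2 \<le> norm l" "norm l \<le> 3/2"
    using Lim_norm_lbound[OF _ l, of "1/2"] Lim_norm_ubound[OF _ l, of "3/2"] u by auto
  ultimately have lW: "l \<in> W" using Q(3) by auto
  have "continuous_on W (Lf c)"
    using Lf_has_derivative[OF c] by (intro continuous_at_imp_continuous_on ballI has_derivative_continuous)
  then have "(\<lambda>n. Lf c (u n)) \<longlonglongrightarrow> Lf c l" by (rule continuous_on_tendsto_compose[OF _ l lW]) (use u in auto)
  then have "r \<le> Lf c l" by (rule tendsto_lowerbound) (use u in auto)
  with lW nl show "l \<in> {u\<in>W. 1/2 \<le> norm u \<and> norm u \<le> 3/2 \<and> r \<le> Lf c u}" by auto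
qed

text \<open>Compactness is assumed for \<Phi>, so it is applied to the fibre points.
  \<open>ctrl\<close> confines these to d \<le> |v| \<le> b, whence passing from \<open>Df\<close>
  to \<open>DPhi\<close> costs a bounded factor; a convergent subsequence of fibre points, nonzero
  in the limit, is then rescaled back.\<close>

lemma Lf_PS:
  assumes c: "c \<in> I" and u: "\<And>n :: nat. u n \<in> W" "\<And>n. 1/2 \<le> norm (u n)" "\<And>n. norm (u n) \<le> 3/2"
    and L: "(\<lambda>n. Lf c (u n)) \<longlonglongrightarrow> l" and D: "(\<lambda>n. Df c (u n)) \<longlonglongrightarrow> 0"
  shows "\<exists>x r. strict_mono r \<and> (u \<circ> r) \<longlonglongrightarrow> x"
proof -
  obtain K where K: "\<And>n. \<bar>Lf c (u n)\<bar> \<le> K"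
    using convergent_imp_Bseq[OF convergentI[OF L]] by (auto simp: Bseq_def)
  obtain b d where bd: "b > 0" "d > 0"
    and ub: "\<And>v. v \<in> W \<Longrightarrow> v \<in> F \<Longrightarrow> G c v = 0 \<Longrightarrow> d \<le> norm v \<and> (- K \<le> lam c v \<longrightarrow> norm v \<le> b)"
    using ctrl[OF c c, of "- K"] by auto
  define v where "v n = vv c (u n)" for n
  define t where "t n = tm c (u n)" for n
  have T: "0 < t n" "v n \<in> F" "G c (v n) = 0" "v n \<in> W" "v n \<noteq> 0" "A (v n) < 0" "v n = t n *\<^sub>R u n" for n
    using tm[OF c u(1)[of n]] by (auto simp: v_def t_def vv_def)
  have nv: "d \<le> norm (v n)" "norm (v n) \<le> b" for n
    using ub[OF T(4,2,3), of n] K[of n] by (auto simp: v_def Lf_def)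
  have t_ge: "2 * d / 3 \<le> t n" for n
  proof -
    have "d \<le> t n * norm (u n)" using nv(1)[of n] T(1)[of n] by (simp add: T(7))
    also have "\<dots> \<le> t n * (3/2)" using u(3) T(1)[of n] by (intro mult_left_mono) auto
    finally show ?thesis by simp
  qed
  have Phi: "Phi \<eta> \<alpha> \<beta> N A B (Lf c (u n)) (v n) = c" for n
    using Phi_lam[of "v n" c] T(6)[of n] by (simp add: Lf_def v_def)
  have DP: "DPhi (Lf c (u n)) (v n) = (A (v n) / (\<alpha> * t n)) *\<^sub>R Df c (u n)" for n
    using T(1,6)[of n] pos by (simp add: Df_def Dlam_def Lf_def v_def t_def)
  have bound: "\<bar>A (v n) / (\<alpha> * t n)\<bar> \<le> C * b powr \<alpha> / (\<alpha> * (2 * d / 3))" for n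
  proof -
    have "\<bar>A (v n)\<bar> \<le> C * norm (v n) powr \<alpha>" by (rule A_le)
    also have "\<dots> \<le> C * b powr \<alpha>" using nv(2)[of n] C_pos pos by (intro mult_left_mono powr_mono2) auto
    finally have "\<bar>A (v n)\<bar> / (\<alpha> * t n) \<le> C * b powr \<alpha> / (\<alpha> * (2 * d / 3))"
      using t_ge[of n] bd pos C_pos by (intro frac_le mult_left_mono) auto
    then show ?thesis using T(1)[of n] pos by (simp add: abs_mult)
  qed
  have "(\<lambda>n. DPhi (Lf c (u n)) (v n)) \<longlonglongrightarrow> 0"
  proof (rule Lim_null_comparison)
    show "\<forall>\<^sub>F n in sequentially. norm (DPhi (Lf c (u n)) (v n)) \<le> C * b powr \<alpha> / (\<alpha> * (2 * d / 3)) * norm (Df c (u n))"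
      unfolding DP norm_scaleR using bound by (intro always_eventually allI mult_right_mono) auto
    show "(\<lambda>n. C * b powr \<alpha> / (\<alpha> * (2 * d / 3)) * norm (Df c (u n))) \<longlonglongrightarrow> 0"
      by (rule tendsto_mult_right_zero[OF tendsto_norm_zero[OF D]])
  qed
  moreover have "bounded (range (\<lambda>n. Lf c (u n)))" using K by (auto simp: bounded_iff)
  moreover have "bounded (range v)" using nv by (auto simp: bounded_iff)
  moreover have "bounded (range (\<lambda>n. Phi \<eta> \<alpha> \<beta> N A B (Lf c (u n)) (v n)))" by (simp add: Phi)
  ultimately obtain r where r: "strict_mono r" "convergent (v \<circ> r)"
    using Phi_PS[of "\<lambda>n. Lf c (u n)" v] by blast
  then obtain y where y: "(v \<circ> r) \<longlonglongrightarrow> y" by (auto simp: convergent_def)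
  \<comment> \<open>Recovering \<open>u n\<close> from the direction of \<open>v n\<close> also
    needs convergence of the norms of \<open>u n\<close>, hence a second extraction.\<close>
  have "bounded (range (\<lambda>n. norm (u (r n))))" using u by (intro boundedI[of _ "3/2"]) auto
  then obtain \<rho> r' where r': "strict_mono r'" "((\<lambda>n. norm (u (r n))) \<circ> r') \<longlonglongrightarrow> \<rho>"
    using bounded_imp_convergent_subsequence by blast
  have y': "(\<lambda>n. v (r (r' n))) \<longlonglongrightarrow> y" using LIMSEQ_subseq_LIMSEQ[OF y r'(1)] by (simp add: o_def)
  have "d \<le> norm y" using Lim_norm_lbound[OF _ y', of d] nv by auto
  then have "norm y \<noteq> 0" using bd by auto
  then have "(\<lambda>n. (norm (u (r (r' n))) / norm (v (r (r' n)))) *\<^sub>R v (r (r' n))) \<longlonglongrightarrow> (\<rho> / norm y) *\<^sub>R y"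
    using r'(2) y' by (intro tendsto_intros) (auto simp: o_def)
  moreover have "(norm (u n) / norm (v n)) *\<^sub>R v n = u n" for n
    using T(1)[of n] T(5)[of n] by (simp add: T(7))
  ultimately have "(u \<circ> (r \<circ> r')) \<longlonglongrightarrow> (\<rho> / norm y) *\<^sub>R y" by (simp add: o_def)
  then show ?thesis using strict_mono_o[OF r(1) r'(1)] by blast
qed

lemma ls_functional_Lf: "c \<in> I \<Longrightarrow> ls_functional W (Lf c) (Df c)"
proof (unfold_locales; (rule W_open W_sym zero_W Df_continuous sup_closed; assumption)?)
  assume c: "c \<in> I"
  show "t *\<^sub>R u \<in> W" if "u \<in> W" "0 < t" for u t using that by (rule W_cone)
  show "Lf c u < 0" if "u \<in> W" for u using c that by (rule Lf_neg)
  show "Lf c (t *\<^sub>R u) = Lf c u" if "u \<in> W" "0 < t" for u t using tm_scale[OF c that] by (simp add: Lf_def)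
  show "(Lf c has_derivative blinfun_apply (Df c u)) (at u)" if "u \<in> W" for u using c that by (rule Lf_has_derivative)
  show "Df c (- u) = - Df c u" if "u \<in> W" for u by (simp add: Df_def tm_minus[OF c that] Dlam_minus)
  show "\<exists>x r. strict_mono r \<and> (u \<circ> r) \<longlonglongrightarrow> x"
    if "\<And>n :: nat. u n \<in> W" "\<And>n. 1/2 \<le> norm (u n)" "\<And>n. norm (u n) \<le> 3/2"
      "(\<lambda>n. Lf c (u n)) \<longlonglongrightarrow> l" "(\<lambda>n. Df c (u n)) \<longlonglongrightarrow> 0" for u l
    using c that by (rule Lf_PS)
qed

section \<open>Levels as functions of the energy\<close>

abbreviation lev :: "real \<Rightarrow> nat \<Rightarrow> real" where "lev c \<equiv> ls_level W (Lf c)"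

text \<open>At the fibre point of a critical ray, \<open>tm\<close> > 0 and \<open>A\<close>
  \<noteq> 0 make \<open>Df\<close>, \<open>Dlam\<close> and \<open>DPhi\<close> vanish together.
  Its location in \<open>F\<close> and \<open>G c v = 0\<close> are recorded for later norm
  bounds.\<close>

lemma lev_critical:
  assumes "c \<in> I" "enat k \<le> cone_genus W" "1 \<le> k"
  obtains v where "v \<in> W" "v \<in> F" "G c v = 0" "lev c k < 0" "Phi \<eta> \<alpha> \<beta> N A B (lev c k) v = c" "DPhi (lev c k) v = 0"
proof -
  obtain u where u: "u \<in> W" "Lf c u = lev c k" "Df c u = 0"
    using ls_functional.level_critical[OF ls_functional_Lf[OF assms(1)] assms(2,3)] .
  note T = tm[OF assms(1) u(1)]
  show thesis
  proof
    show "vv c u \<in> W" "vv c u \<in> F" "G c (vv c u) = 0" using T by auto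
    show "lev c k < 0" using Lf_neg[OF assms(1) u(1)] u(2) by simp
    show "Phi \<eta> \<alpha> \<beta> N A B (lev c k) (vv c u) = c"
      using Phi_lam[of "vv c u" c] T(6) u(2) by (simp add: Lf_def)
    show "DPhi (lev c k) (vv c u) = 0"
      using u(3) T(1,6) pos u(2) by (auto simp: Df_def Dlam_def Lf_def)
  qed
qed

text \<open>Since \<open>lam c' - lam c\<close> is explicit, both estimates only need the fibre maximum
  (or minimum) for one of the two energies to be compared with the value of the other one at the same point.\<close>

lemma Lf_energy:
  assumes c: "c1 \<in> I" "c2 \<in> I"
  shows "\<exists>\<delta>>0. \<forall>c c'. \<forall>u\<in>W. c1 \<le> c \<longrightarrow> c < c' \<longrightarrow> c' \<le> c2 \<longrightarrow> r \<le> Lf c u \<longrightarrow> Lf c u + \<delta> * (c' - c) \<le> Lf c' u"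
    (is "\<exists>\<delta>>0. ?low \<delta>")
    and "\<exists>K>0. \<forall>c c'. \<forall>u\<in>W. c1 \<le> c \<longrightarrow> c < c' \<longrightarrow> c' \<le> c2 \<longrightarrow> r \<le> Lf c' u \<longrightarrow> Lf c' u \<le> Lf c u + K * (c' - c)"
    (is "\<exists>K>0. ?up K")
proof -
  obtain a b d where abd: "a > 0" "b > 0" "d > 0"
    and ctl: "\<And>c v. c1 \<le> c \<Longrightarrow> c \<le> c2 \<Longrightarrow> v \<in> W \<Longrightarrow> v \<in> F \<Longrightarrow> G c v = 0 \<Longrightarrow>
      d \<le> norm v \<and> (r \<le> lam c v \<longrightarrow> norm v \<le> b \<and> a * norm v powr \<alpha> \<le> - A v)"
    using ctrl[OF c, of r] by auto
  have inI: "x \<in> I" if "c1 \<le> x" "x \<le> c2" for x using I_interval c that by (meson mem_is_interval_1_I)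
  \<comment> \<open>Both constants bound \<alpha> / (- A v): \<open>C * b powr \<alpha>\<close> is
    an upper and \<open>a * d powr \<alpha>\<close> a lower bound for - A v at the fibre points
    concerned.\<close>
  have "?low (\<alpha> / (C * b powr \<alpha>)) \<and> ?up (\<alpha> / (a * d powr \<alpha>))"
  proof (intro allI ballI impI conjI)
    fix c c' u assume u: "u \<in> W" and cc: "c1 \<le> c" "c < c'" "c' \<le> c2"
    have cI: "c \<in> I" "c' \<in> I" using cc inI by auto
    note T = tm[OF cI(1) u] and T' = tm[OF cI(2) u]
    have ext: "\<sigma> * lam c (vv c' u) \<le> \<sigma> * Lf c u" "\<sigma> * lam c' (vv c u) \<le> \<sigma> * Lf c' u"
      using extremal[OF cI(1) u T'(1)] T'(2) extremal[OF cI(2) u T(1)] T(2) by (simp_all add: vv_def)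
    have dif: "lam c' v = lam c v + \<alpha> * (c' - c) / (- A v)" if "A v < 0" for v using that by (rule lam_diff)
    have up: "\<alpha> / (C * b powr \<alpha>) * (c' - c) \<le> \<alpha> * (c' - c) / (- A v)" if "norm v \<le> b" "A v < 0" for v
    proof -
      have "- A v \<le> C * norm v powr \<alpha>" using A_le[of v] by simp
      also have "\<dots> \<le> C * b powr \<alpha>" using that C_pos pos by (intro mult_left_mono powr_mono2) auto
      finally have "\<alpha> * (c' - c) / (C * b powr \<alpha>) \<le> \<alpha> * (c' - c) / (- A v)"
        using that pos cc by (intro frac_le) auto
      then show ?thesis by simp
    qed
    have nonneg: "0 \<le> \<alpha> * (c' - c) / (- A v)" if "A v < 0" for v using that pos cc by (simp add: divide_nonneg_neg)
    show "Lf c u + \<alpha> / (C * b powr \<alpha>) * (c' - c) \<le> Lf c' u" if r: "r \<le> Lf c u"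
      using \<sigma>
    proof
      assume s: "\<sigma> = 1"
      have "norm (vv c u) \<le> b" using ctl[OF _ _ T(4,2,3)] cc r by (auto simp: Lf_def)
      from up[OF this T(6)] ext(2) dif[OF T(6)] show ?thesis by (simp add: s Lf_def)
    next
      assume s: "\<sigma> = - 1"
      have 1: "Lf c u + \<alpha> * (c' - c) / (- A (vv c' u)) \<le> Lf c' u" using ext(1) dif[OF T'(6)] by (simp add: s Lf_def)
      \<comment> \<open>For minima the comparison point is the fibre point at energy c', so the
        bound r has to be carried from c to c' before \<open>ctrl\<close> applies.\<close>
      then have "r \<le> Lf c' u" using nonneg[OF T'(6)] r by linarith
      then have "norm (vv c' u) \<le> b" using ctl[OF _ _ T'(4,2,3)] cc by (auto simp: Lf_def)
      from up[OF this T'(6)] 1 show ?thesis by simp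
    qed
    show "Lf c' u \<le> Lf c u + \<alpha> / (a * d powr \<alpha>) * (c' - c)" if r: "r \<le> Lf c' u"
    proof -
      have "a * norm (vv c' u) powr \<alpha> \<le> - A (vv c' u)" using ctl[OF _ _ T'(4,2,3)] cc r by (auto simp: Lf_def)
      \<comment> \<open>Both sides are \<alpha>-homogeneous, so the bound holds on the whole ray, in
        particular at \<open>vv c u\<close>, although r is assumed only at energy c'.\<close>
      then have "tm c' u powr \<alpha> * (a * norm u powr \<alpha>) \<le> tm c' u powr \<alpha> * - A u"
        using T'(1) by (simp add: vv_def scale powr_mult algebra_simps)
      then have u_ge: "a * norm u powr \<alpha> \<le> - A u" by (rule mult_left_le_imp_le) (use T'(1) in simp)
      have low: "\<alpha> * (c' - c) / (- A (t *\<^sub>R u)) \<le> \<alpha> / (a * d powr \<alpha>) * (c' - c)" if t: "0 < t" "d \<le> norm (t *\<^sub>R u)" for t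
      proof -
        have "a * d powr \<alpha> \<le> a * norm (t *\<^sub>R u) powr \<alpha>" using t abd pos by (intro mult_left_mono powr_mono2) auto
        also have "\<dots> = t powr \<alpha> * (a * norm u powr \<alpha>)" using t by (simp add: powr_mult)
        also have "\<dots> \<le> t powr \<alpha> * - A u" using u_ge by (intro mult_left_mono) auto
        also have "\<dots> = - A (t *\<^sub>R u)" using t by (simp add: scale)
        finally have "\<alpha> * (c' - c) / (- A (t *\<^sub>R u)) \<le> \<alpha> * (c' - c) / (a * d powr \<alpha>)"
          using pos cc abd by (intro frac_le) auto
        then show ?thesis by simp
      qed
      have dd: "d \<le> norm (vv c u)" "d \<le> norm (vv c' u)" using ctl[OF _ _ T(4,2,3)] ctl[OF _ _ T'(4,2,3)] cc by auto
      show ?thesis using \<sigma>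
      proof
        assume "\<sigma> = 1"
        then show ?thesis
          using ext(1) dif[OF T'(6)] low[OF T'(1)] dd(2) by (simp add: Lf_def vv_def)
      next
        assume "\<sigma> = - 1"
        then show ?thesis
          using ext(2) dif[OF T(6)] low[OF T(1)] dd(1) by (simp add: Lf_def vv_def)
      qed
    qed
  qed
  moreover have "0 < \<alpha> / (C * b powr \<alpha>)" "0 < \<alpha> / (a * d powr \<alpha>)" using abd pos C_pos by auto
  ultimately show "\<exists>\<delta>>0. ?low \<delta>" "\<exists>K>0. ?up K" by blast+
qed

text \<open>A near-optimal set for the smaller energy is tested at the larger one. The tolerance is
  at most half of the uniform gain, for strictness, and at most 1, so that all values stay above the
  cutoff for which \<delta> was obtained.\<close>

lemma lev_less:
  assumes c: "c1 \<in> I" "c2 \<in> I" "c1 < c2" and k: "enat k \<le> cone_genus W" "1 \<le> k"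
  shows "lev c1 k < lev c2 k"
proof -
  obtain \<delta> where \<delta>: "0 < \<delta>" and \<delta>': "\<forall>c c'. \<forall>u\<in>W. c1 \<le> c \<longrightarrow> c < c' \<longrightarrow> c' \<le> c2 \<longrightarrow> lev c1 k - 1 \<le> Lf c u \<longrightarrow> Lf c u + \<delta> * (c' - c) \<le> Lf c' u"
    using Lf_energy(1)[OF c(1,2), of "lev c1 k - 1"] by blast
  define e where "e = min 1 (\<delta> * (c2 - c1) / 2)"
  have e: "0 < e" "e \<le> 1" "e < \<delta> * (c2 - c1)" using \<delta> c(3) by (auto simp: e_def min_def)
  obtain M where M: "adm W k M" "\<And>u. u \<in> M \<Longrightarrow> lev c1 k - e \<le> Lf c1 u"
    using ls_functional.level_approx[OF ls_functional_Lf[OF c(1)] k e(1)] by blast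
  have "lev c1 k - e + \<delta> * (c2 - c1) \<le> lev c2 k"
  proof (rule ls_functional.levelI[OF ls_functional_Lf[OF c(2)] M(1)])
    fix u assume u: "u \<in> M"
    then have "u \<in> W" using M(1) by (auto simp: adm_def)
    from \<delta>'[rule_format, OF this order_refl c(3) order_refl] M(2)[OF u] e
    show "lev c1 k - e + \<delta> * (c2 - c1) \<le> Lf c2 u" by linarith
  qed
  with e show ?thesis by simp
qed

text \<open>Testing a near-optimal set of the larger energy at the smaller one gives one Lipschitz
  bound; monotonicity gives the other side. Monotonicity also lets the cutoff taken at the left end
  c1 serve every energy in the interval.\<close>

lemma lev_continuous:
  assumes k: "enat k \<le> cone_genus W" "1 \<le> k"
  shows "continuous_on I (\<lambda>c. lev c k)"
proof (rule continuous_at_imp_continuous_on, rule ballI)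
  fix c0 assume "c0 \<in> I"
  with I_open obtain \<epsilon> where \<epsilon>: "\<epsilon> > 0" "cball c0 \<epsilon> \<subseteq> I" using open_contains_cball by blast
  define c1 c2 where "c1 = c0 - \<epsilon>" and "c2 = c0 + \<epsilon>"
  have sub: "{c1..c2} \<subseteq> I" using \<epsilon>(2) by (simp add: c1_def c2_def cball_eq_atLeastAtMost)
  have c: "c1 \<in> I" "c2 \<in> I" using sub \<epsilon>(1) by (auto simp: c1_def c2_def subset_iff)
  obtain K where K: "\<forall>c c'. \<forall>u\<in>W. c1 \<le> c \<longrightarrow> c < c' \<longrightarrow> c' \<le> c2 \<longrightarrow> lev c1 k - 1 \<le> Lf c' u \<longrightarrow> Lf c' u \<le> Lf c u + K * (c' - c)"
    using Lf_energy(2)[OF c, of "lev c1 k - 1"] by blast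
  have lip: "lev c' k \<le> lev c k + K * (c' - c)" if cc: "c1 \<le> c" "c < c'" "c' \<le> c2" for c c'
  proof (rule field_le_epsilon)
    fix e0 :: real assume "0 < e0"
    define e where "e = min 1 e0"
    have e: "0 < e" "e \<le> 1" "e \<le> e0" using \<open>0 < e0\<close> by (auto simp: e_def)
    have cI: "c \<in> I" "c' \<in> I" using cc sub by auto
    obtain M where M: "adm W k M" "\<And>u. u \<in> M \<Longrightarrow> lev c' k - e \<le> Lf c' u"
      using ls_functional.level_approx[OF ls_functional_Lf[OF cI(2)] k e(1)] by blast
    have mono: "lev c1 k \<le> lev c' k" using lev_less[OF c(1) cI(2) _ k] cc by simp
    have "lev c' k - e - K * (c' - c) \<le> lev c k"
    proof (rule ls_functional.levelI[OF ls_functional_Lf[OF cI(1)] M(1)])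
      fix u assume u: "u \<in> M"
      then have "u \<in> W" using M(1) by (auto simp: adm_def)
      from K[rule_format, OF this cc] M(2)[OF u] e mono
      show "lev c' k - e - K * (c' - c) \<le> Lf c u" by linarith
    qed
    with e show "lev c' k \<le> lev c k + K * (c' - c) + e0" by simp
  qed
  have lip': "\<bar>lev c k - lev c0 k\<bar> \<le> K * \<bar>c - c0\<bar>" if "c1 \<le> c" "c \<le> c2" for c
  proof (cases c c0 rule: linorder_cases)
    case less
    have "lev c k < lev c0 k" using lev_less[OF _ \<open>c0 \<in> I\<close> less k] sub that by auto
    with lip[OF that(1) less] \<epsilon> less show ?thesis by (auto simp: c2_def)
  next
    case greater
    have "lev c0 k < lev c k" using lev_less[OF \<open>c0 \<in> I\<close> _ greater k] sub that by auto
    with lip[OF _ greater that(2)] \<epsilon> greater show ?thesis by (auto simp: c1_def)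
  qed simp
  show "isCont (\<lambda>c. lev c k) c0"
    unfolding isCont_def
  proof (rule LIM_zero_cancel, rule Lim_null_comparison)
    have "\<forall>\<^sub>F c in at c0. c \<in> {c1<..<c2}"
      using \<epsilon>(1) by (intro topological_tendstoD[OF tendsto_ident_at]) (auto simp: c1_def c2_def)
    then show "\<forall>\<^sub>F c in at c0. norm (lev c k - lev c0 k) \<le> K * \<bar>c - c0\<bar>"
      by eventually_elim (use lip' in auto)
    show "((\<lambda>c. K * \<bar>c - c0\<bar>) \<longlongrightarrow> 0) (at c0)"
      by (auto intro!: tendsto_eq_intros)
  qed
qed

end

section \<open>The two families of fibre critical points\<close>

text \<open>On (0, 1) the quotient (1 - s^p) / (1 - s^q) is at most p/q when q < p, by Young's
  inequality for s^q = (s^p)^(q/p). This turns a derivative condition at one point of a ray into a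
  sign along the ray.\<close>

lemma powr_ratio:
  fixes a b p q s :: real
  assumes s: "0 < s" "s < 1" and q: "0 < q" "q < p" and a: "0 < a" and ab: "b * p < a * q"
  shows "b * (1 - s powr p) < a * (1 - s powr q)"
proof -
  have lt: "0 < 1 - s powr p" "0 < 1 - s powr q" using powr_less_mono2[of p s 1] powr_less_mono2[of q s 1] s q by auto
  show ?thesis
  proof (cases "b \<le> 0")
    case True
    then have "b * (1 - s powr p) \<le> 0" using lt by (simp add: mult_nonpos_nonneg)
    also have "0 < a * (1 - s powr q)" using a lt by simp
    finally show ?thesis .
  next
    case False
    have "(s powr p) powr (q / p) * 1 powr (1 - q / p) \<le> q / p * s powr p + (1 - q / p) * 1"
      using s q by (intro Youngs_inequality_0) auto
    then have "s powr q \<le> q / p * s powr p + (1 - q / p)" using q by (simp add: powr_powr)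
    then have "p * s powr q \<le> p * (q / p * s powr p + (1 - q / p))" using q by (intro mult_left_mono) auto
    also have "\<dots> = q * s powr p + (p - q)" using q by (simp add: distrib_left right_diff_distrib)
    finally have "p * s powr q \<le> q * s powr p + (p - q)" .
    then have "q * (1 - s powr p) \<le> p * (1 - s powr q)" by (simp add: algebra_simps)
    then have "b * (q * (1 - s powr p)) \<le> b * (p * (1 - s powr q))" using False by (intro mult_left_mono) auto
    also have "\<dots> < a * q * (1 - s powr q)" using ab lt by (simp flip: mult.assoc)
    finally have "q * (b * (1 - s powr p)) < q * (a * (1 - s powr q))" by (simp add: mult_ac)
    then show ?thesis using q by simp
  qed
qed

section \<open>Constants and estimates inside and outside the critical radius\<close>

context setting
begin

definition aN :: "'a \<Rightarrow> real" where "aN v = (\<eta> - \<alpha>) / \<eta> * N v"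
definition bB :: "'a \<Rightarrow> real" where "bB v = (\<beta> - \<alpha>) / \<beta> * B v"
definition \<kappa> :: real where "\<kappa> = (\<eta> - \<alpha>) / (\<eta> * C)"
text \<open>Chosen so that \<beta> bB v is at most half of \<eta> \<kappa> |v|^\<eta> for |v| \<le>
  \<tau>; the factor 2 gives strict domination up to the boundary.\<close>

definition \<tau> :: real where "\<tau> = (\<kappa> * \<eta> / (2 * (\<beta> - \<alpha>) * C)) powr (1 / (\<beta> - \<eta>))"
definition \<rho> :: real where "\<rho> = \<tau> / 2"
definition g0 :: real where "g0 = (1 - \<eta> / \<beta>) * (\<kappa> * \<rho> powr \<eta>)"
text \<open>\<open>g0\<close> is a lower bound for \<open>aN - bB\<close> on the annulus \<rho>
  \<le> |v| \<le> \<tau>; energies above \<open>cs\<close> consume at most half of it.\<close>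

definition cs :: real where "cs = - (g0 / (2 * \<alpha>))"
text \<open>Half of the energy threshold below which
  \<open>aN v \<ge> \<kappa> * \<rho> powr \<eta>\<close> makes the numerator in
  \<open>lam_crit\<close> positive; the other half supplies a quantitative bound.\<close>

definition css :: real where "css = (\<beta> - \<eta>) / (2 * \<beta> * (\<eta> - \<alpha>)) * (\<kappa> * \<rho> powr \<eta>)"

lemma consts_pos: "0 < \<kappa>" "0 < \<tau>" "0 < \<rho>" "0 < g0" "cs < 0" "0 < css"
proof -
  show k: "0 < \<kappa>" using pos C_pos by (simp add: \<kappa>_def)
  show "0 < \<tau>" using k pos C_pos by (simp add: \<tau>_def)
  then show "0 < \<rho>" by (simp add: \<rho>_def)
  then have "0 < \<kappa> * \<rho> powr \<eta>" using k by simp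
  then show "0 < g0" "0 < css" unfolding g0_def css_def using pos exponents by (auto intro!: mult_pos_pos)
  then show "cs < 0" using pos by (simp add: cs_def)
qed

lemma G_eq: "G c v = aN v - bB v + \<alpha> * c"
  by (simp add: G_def aN_def bB_def)

lemma aN_scale: "t > 0 \<Longrightarrow> aN (t *\<^sub>R v) = t powr \<eta> * aN v" and bB_scale: "t > 0 \<Longrightarrow> bB (t *\<^sub>R v) = t powr \<beta> * bB v"
  by (simp_all add: aN_def bB_def scale)

lemma aN_ge: "\<kappa> * norm v powr \<eta> \<le> aN v"
proof -
  have "(\<eta> - \<alpha>) / \<eta> * (inverse C * norm v powr \<eta>) \<le> aN v"
    unfolding aN_def using N_ge[of v] pos by (intro mult_left_mono) auto
  then show ?thesis by (simp add: \<kappa>_def divide_inverse mult_ac)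
qed

lemma aN_pos: "v \<noteq> 0 \<Longrightarrow> 0 < aN v"
  using aN_ge[of v] consts_pos(1) by (smt (verit) mult_pos_pos powr_gt_zero norm_eq_zero)

text \<open>Equivalently, t^\<eta> aN v - t^\<beta> bB v has positive derivative at t = 1, the form
  in which \<open>powr_ratio\<close> uses it.\<close>

lemma small_ball:
  assumes "v \<noteq> 0" "norm v \<le> \<tau>"
  shows "bB v * \<beta> < aN v * \<eta>"
proof -
  have k: "0 < \<kappa> * \<eta>" using consts_pos pos by simp
  have nv: "0 < norm v powr \<eta>" using assms by simp
  have "norm v powr (\<beta> - \<eta>) \<le> \<tau> powr (\<beta> - \<eta>)" using assms pos by (intro powr_mono2) auto
  also have "\<dots> = \<kappa> * \<eta> / (2 * (\<beta> - \<alpha>) * C)" using pos C_pos k by (simp add: \<tau>_def powr_powr)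
  finally have *: "norm v powr (\<beta> - \<eta>) \<le> \<kappa> * \<eta> / (2 * (\<beta> - \<alpha>) * C)" .
  have "bB v * \<beta> = (\<beta> - \<alpha>) * B v" using pos by (simp add: bB_def)
  also have "\<dots> \<le> (\<beta> - \<alpha>) * (C * norm v powr \<beta>)" using B_le[of v] pos by (intro mult_left_mono) auto
  also have "\<dots> = (\<beta> - \<alpha>) * C * norm v powr (\<beta> - \<eta>) * norm v powr \<eta>" by (simp flip: powr_add)
  also have "\<dots> \<le> (\<beta> - \<alpha>) * C * (\<kappa> * \<eta> / (2 * (\<beta> - \<alpha>) * C)) * norm v powr \<eta>"
    using * pos C_pos by (intro mult_right_mono mult_left_mono) auto
  also have "(\<beta> - \<alpha>) * C * (\<kappa> * \<eta> / (2 * (\<beta> - \<alpha>) * C)) = \<kappa> * \<eta> / 2"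
  proof -
    have "x * (y / (2 * x)) = y / 2" if "x \<noteq> 0" for x y :: real using that by simp
    then show ?thesis unfolding mult.assoc[of 2] using pos C_pos by (metis less_irrefl mult_pos_pos)
  qed
  also have "\<kappa> * \<eta> / 2 * norm v powr \<eta> < \<kappa> * \<eta> * norm v powr \<eta>" using k nv by (intro mult_strict_right_mono) linarith+
  also have "\<dots> \<le> aN v * \<eta>" using aN_ge[of v] pos by (simp add: mult_ac mult_left_mono)
  finally show ?thesis .
qed

lemma aN_bB_ge:
  assumes "v \<noteq> 0" "norm v \<le> \<tau>"
  shows "(1 - \<eta> / \<beta>) * aN v \<le> aN v - bB v"
  using small_ball[OF assms] pos by (simp add: field_simps)

lemma aN_ge_rho:
  assumes "\<rho> \<le> norm v"
  shows "\<kappa> * \<rho> powr \<eta> \<le> aN v"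
proof -
  have "\<kappa> * \<rho> powr \<eta> \<le> \<kappa> * norm v powr \<eta>" using assms consts_pos pos by (intro mult_left_mono powr_mono2) auto
  also note aN_ge
  finally show ?thesis .
qed

text \<open>The barrier between the families: for c > \<open>cs\<close> no zero of
  \<open>G c\<close> has norm between \<rho> and \<tau>.\<close>

lemma G_ge:
  assumes "\<rho> \<le> norm v" "norm v \<le> \<tau>" "cs < c"
  shows "g0 / 2 \<le> G c v"
proof -
  have "g0 \<le> (1 - \<eta> / \<beta>) * aN v"
    unfolding g0_def using aN_ge_rho[OF assms(1)] exponents pos by (intro mult_left_mono) auto
  also have "\<dots> \<le> aN v - bB v" using assms consts_pos by (intro aN_bB_ge) auto
  finally have "g0 \<le> aN v - bB v" .
  moreover have "- (g0 / 2) \<le> \<alpha> * c" using assms(3) pos by (simp add: cs_def field_simps)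
  ultimately show ?thesis by (simp add: G_eq)
qed

lemma G_fibre_continuous: "continuous_on S (\<lambda>t. G c (t *\<^sub>R u))"
  by (intro continuous_on_compose2[OF G_continuous[of UNIV]] continuous_intros) auto

text \<open>After division of G c (t v) by t^\<beta>, this says that the derivative at t = 1 is
  negative, whatever the value of \<open>B v\<close>.\<close>

lemma large_ball:
  assumes "\<rho> \<le> norm v" "cs < c"
  shows "- (\<alpha> * c) * \<beta> < aN v * (\<beta> - \<eta>)"
proof -
  have "- (\<alpha> * c) * \<beta> < g0 * \<beta>"
  proof (rule mult_strict_right_mono)
    have "- (\<alpha> * c) < g0 / 2" using assms(2) pos by (simp add: cs_def field_simps)
    then show "- (\<alpha> * c) < g0" using consts_pos by simp
  qed (use pos in simp)
  also have "g0 * \<beta> = \<kappa> * \<rho> powr \<eta> * (\<beta> - \<eta>)" using pos by (simp add: g0_def field_simps)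
  also have "\<dots> \<le> aN v * (\<beta> - \<eta>)" using aN_ge_rho[OF assms(1)] pos by (intro mult_right_mono) auto
  finally show ?thesis .
qed

lemma N_aN: "(\<beta> - \<eta>) / \<eta> * N v = (\<beta> - \<eta>) / (\<eta> - \<alpha>) * aN v"
  using pos by (simp add: aN_def)

text \<open>By \<open>lam_crit\<close> the product of \<lambda> and \<open>A v\<close> is explicit
  at a zero of \<open>G c\<close>, so a lower bound on \<lambda> is one on - A v.
  \<open>max 1 (- r)\<close> keeps the divisor positive for every r.\<close>

lemma lam_lower:
  assumes "A v < 0" "G c v = 0" "r \<le> lam c v" "e \<le> (\<beta> - \<eta>) / \<eta> * N v - \<beta> * c" "0 < e"
  shows "\<alpha> * e / ((\<beta> - \<alpha>) * max 1 (- r)) \<le> - A v"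
proof -
  let ?E = "\<alpha> * (((\<beta> - \<eta>) / \<eta> * N v - \<beta> * c) / (\<beta> - \<alpha>))"
  have "\<alpha> * (e / (\<beta> - \<alpha>)) \<le> ?E" using assms(4) pos by (intro mult_left_mono divide_right_mono) auto
  also have "?E = lam c v * A v" using lam_crit[OF assms(2)] assms(1) by simp
  also have "\<dots> = - lam c v * - A v" by simp
  also have "\<dots> \<le> max 1 (- r) * - A v" using assms by (intro mult_right_mono) auto
  finally have "\<alpha> * (e / (\<beta> - \<alpha>)) / max 1 (- r) \<le> - A v" by (subst pos_divide_le_eq) (simp_all add: mult.commute)
  then show ?thesis by (simp only: times_divide_eq_right divide_divide_eq_left)
qed

lemma norm_powr_continuous: "0 < p \<Longrightarrow> continuous_on S (\<lambda>v :: 'a. norm v powr p)"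
  by (rule continuous_on_powr') (auto intro!: continuous_intros)

lemma uminus_A_ge: "closed {v. a * norm v powr \<alpha> \<le> - A v}"
  by (intro closed_Collect_le continuous_on_mult continuous_on_const continuous_on_minus norm_powr_continuous pos C1_on_continuous C1)

lemma bB_ge_closed: "closed {v. b * norm v powr \<beta> \<le> bB v}"
  unfolding bB_def
  by (intro closed_Collect_le continuous_on_mult continuous_on_const norm_powr_continuous pos C1_on_continuous C1)

lemma zero_values: "N 0 = 0" "A 0 = 0" "B 0 = 0"
  using N_le[of 0] N_ge[of 0] A_le[of 0] B_le[of 0] pos by auto

lemma nonzero: "A v < 0 \<Longrightarrow> v \<noteq> 0"
  using zero_values by auto

text \<open>With the bound \<open>aN_bB_le\<close>, a zero of \<open>G c\<close> in the ball
  satisfies - \<alpha> c \<le> P |v|^\<eta>, which keeps it away from the origin for c \<le> c2 <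
  0.\<close>

definition P :: real where "P = (\<eta> - \<alpha>) / \<eta> * C' + (\<beta> - \<alpha>) / \<beta> * C * \<tau> powr (\<beta> - \<eta>)"

lemma P_pos: "0 < P"
  unfolding P_def using pos C_pos consts_pos by (intro add_pos_pos mult_pos_pos) auto

lemma aN_bB_le:
  assumes "norm v \<le> \<tau>"
  shows "aN v - bB v \<le> P * norm v powr \<eta>"
proof -
  have "aN v \<le> (\<eta> - \<alpha>) / \<eta> * (C' * norm v powr \<eta>)" unfolding aN_def using N_le pos by (intro mult_left_mono) auto
  moreover have "- bB v \<le> (\<beta> - \<alpha>) / \<beta> * C * \<tau> powr (\<beta> - \<eta>) * norm v powr \<eta>"
  proof -
    have "- bB v = (\<beta> - \<alpha>) / \<beta> * - B v" by (simp add: bB_def)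
    also have "\<dots> \<le> (\<beta> - \<alpha>) / \<beta> * (C * norm v powr \<beta>)" using B_le[of v] pos by (intro mult_left_mono) auto
    also have "\<dots> = (\<beta> - \<alpha>) / \<beta> * C * norm v powr (\<beta> - \<eta>) * norm v powr \<eta>" by (simp flip: powr_add)
    also have "\<dots> \<le> (\<beta> - \<alpha>) / \<beta> * C * \<tau> powr (\<beta> - \<eta>) * norm v powr \<eta>"
      using assms pos C_pos by (intro mult_right_mono mult_left_mono powr_mono2) auto
    finally show ?thesis .
  qed
  ultimately show ?thesis by (simp add: P_def algebra_simps)
qed

text \<open>On a ray in A < 0, \<open>G c\<close> starts at \<alpha> c < 0 and is positive at radius
  \<tau>; inside the ball \<open>powr_ratio\<close> makes the crossing unique and upward.\<close>

lemma minus_fibres: "fibres N A B \<alpha> \<eta> \<beta> C C' {v. norm v < \<tau>} {v. A v < 0} 1 {cs<..<0}"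
proof unfold_locales
  have A_cont: "continuous_on S A" for S by (intro C1_on_continuous C1)
  show "open {v :: 'a. norm v < \<tau>}" by (intro open_Collect_less continuous_intros)
  show "open {v. A v < 0}" by (intro open_Collect_less continuous_intros A_cont)
  show "x *\<^sub>R u \<in> {v. norm v < \<tau>}"
    if "t *\<^sub>R u \<in> {v. norm v < \<tau>}" "0 < s" "s \<le> x" "x \<le> t" for u :: 'a and s t x
  proof -
    have "x * norm u \<le> t * norm u" using that by (intro mult_right_mono) auto
    then show ?thesis using that by auto
  qed
  show "symset {v. A v < 0}" by (simp add: symset_def)
  show "t *\<^sub>R u \<in> {v. A v < 0}" if "u \<in> {v. A v < 0}" "0 < t" for u t
    using that by (simp add: scale mult_pos_neg)
  show "\<exists>t>0. t *\<^sub>R u \<in> {v. norm v < \<tau>} \<and> G c (t *\<^sub>R u) = 0" if c: "c \<in> {cs<..<0}" and u: "u \<in> {v. A v < 0}" for c u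
  proof -
    have u0: "u \<noteq> 0" using u nonzero by simp
    have "\<exists>t\<ge>0. t \<le> \<tau> / norm u \<and> G c (t *\<^sub>R u) = 0"
    proof (rule IVT')
      show "G c (0 *\<^sub>R u) \<le> 0" using c pos by (simp add: G_def zero_values mult_nonneg_nonpos)
      show "0 \<le> G c ((\<tau> / norm u) *\<^sub>R u)"
        using G_ge[of "(\<tau> / norm u) *\<^sub>R u" c] c u0 consts_pos by (simp add: \<rho>_def)
      show "0 \<le> \<tau> / norm u" using consts_pos by simp
    qed (rule G_fibre_continuous)
    then obtain t where t: "0 \<le> t" "t \<le> \<tau> / norm u" "G c (t *\<^sub>R u) = 0" by blast
    have "t \<noteq> 0"
    proof
      assume "t = 0"
      then show False using t(3) c pos by (simp add: G_def zero_values)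
    qed
    moreover have "t \<noteq> \<tau> / norm u"
      using t(3) G_ge[of "t *\<^sub>R u" c] c u0 consts_pos by (auto simp: \<rho>_def)
    ultimately show ?thesis using t u0 by (intro exI[of _ t]) (auto simp: field_simps)
  qed
  show "1 * G c (s *\<^sub>R v) < 0"
    if "v \<in> {v. A v < 0}" "v \<in> {v. norm v < \<tau>}" "G c v = 0" "0 < s" "s < 1" for c v s
  proof -
    have v0: "v \<noteq> 0" using that nonzero by simp
    have "bB v * (1 - s powr \<beta>) < aN v * (1 - s powr \<eta>)"
      using that v0 pos by (intro powr_ratio small_ball aN_pos) auto
    then show ?thesis using that by (simp add: G_eq aN_scale bB_scale algebra_simps)
  qed
  show "0 < 1 * G c (s *\<^sub>R v)"
    if "v \<in> {v. A v < 0}" "G c v = 0" "1 < s" "s *\<^sub>R v \<in> {v. norm v < \<tau>}" for c v s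
  proof -
    have v0: "s *\<^sub>R v \<noteq> 0" using that nonzero by auto
    \<comment> \<open>For s > 1 the comparison is based at the outer point
      \<open>s *\<^sub>R v\<close>, with ratio 1/s < 1.\<close>
    have "bB (s *\<^sub>R v) * (1 - (1 / s) powr \<beta>) < aN (s *\<^sub>R v) * (1 - (1 / s) powr \<eta>)"
      using that v0 pos by (intro powr_ratio small_ball aN_pos) auto
    then show ?thesis using that by (simp add: G_eq aN_scale bB_scale powr_divide algebra_simps)
  qed
  show "\<beta> * c < (\<beta> - \<eta>) / \<eta> * N v" if "c \<in> {cs<..<0}" "v \<in> {v. A v < 0}" for c v
  proof -
    have "\<beta> * c < 0" using that pos by (simp add: mult_pos_neg)
    also have "0 \<le> (\<beta> - \<eta>) / (\<eta> - \<alpha>) * aN v" using aN_pos[OF nonzero] that pos by (simp add: less_imp_le)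
    finally show ?thesis unfolding N_aN .
  qed
  fix c1 c2 r assume c1: "c1 \<in> {cs<..<0}" and c2: "c2 \<in> {cs<..<0}"
  \<comment> \<open>As c \<le> c2 < 0, the right end is the worst energy: it gives the bound
    \<open>e\<close> for the numerator in \<open>lam_crit\<close>, from which
    \<open>lam_lower\<close> produces \<open>a\<close>, and through \<open>P\<close> the inner
    radius \<open>d\<close>.\<close>
  define e where "e = - (\<beta> * c2)"
  define a where "a = \<alpha> * e / ((\<beta> - \<alpha>) * max 1 (- r)) / \<tau> powr \<alpha>"
  define d where "d = (- (\<alpha> * c2) / P) powr (1 / \<eta>)"
  let ?Q = "{v. a * norm v powr \<alpha> \<le> - A v}"
  have e: "0 < e" using c2 pos by (simp add: e_def mult_pos_neg)
  have a: "0 < a" using e pos consts_pos by (simp add: a_def)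
  have "0 < - (\<alpha> * c2)" using c2 pos by (simp add: mult_pos_neg)
  then have m: "0 < - (\<alpha> * c2) / P" using P_pos by (rule divide_pos_pos)
  then have d: "0 < d" unfolding d_def powr_gt_zero by linarith
  show "\<exists>a>0. \<exists>b>0. \<exists>d>0. \<exists>Q. closed Q \<and> (\<forall>v\<in>Q. \<forall>s>0. s *\<^sub>R v \<in> Q) \<and> Q - {0} \<subseteq> {v. A v < 0} \<and>
    (\<forall>c\<in>{c1..c2}. \<forall>v\<in>{v. A v < 0} \<inter> {v. norm v < \<tau>}. G c v = 0 \<longrightarrow> d \<le> norm v \<and>
      (r \<le> lam c v \<longrightarrow> norm v \<le> b \<and> a * norm v powr \<alpha> \<le> - A v \<and> v \<in> Q))"
  proof (rule exI[of _ a], rule conjI[OF a], rule exI[of _ \<tau>], rule conjI[OF consts_pos(2)],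
      rule exI[of _ d], rule conjI[OF d], rule exI[of _ ?Q], intro conjI ballI allI impI)
    show "closed ?Q" by (rule uminus_A_ge)
    show "s *\<^sub>R v \<in> ?Q" if "v \<in> ?Q" "0 < s" for v s
    proof -
      have "s powr \<alpha> * (a * norm v powr \<alpha>) \<le> s powr \<alpha> * - A v" using that by (intro mult_left_mono) auto
      then show ?thesis using that by (simp add: scale powr_mult mult_ac)
    qed
    show "?Q - {0} \<subseteq> {v. A v < 0}"
    proof
      fix v assume v: "v \<in> ?Q - {0}"
      then have "0 < a * norm v powr \<alpha>" using a by simp
      with v show "v \<in> {v. A v < 0}" by auto
    qed
    fix c v assume c: "c \<in> {c1..c2}" and v: "v \<in> {v. A v < 0} \<inter> {v. norm v < \<tau>}" and G: "G c v = 0"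
    have c0: "- (\<alpha> * c2) \<le> - (\<alpha> * c)" "e \<le> - (\<beta> * c)" using c pos by (auto simp: e_def)
    have "- (\<alpha> * c2) \<le> P * norm v powr \<eta>" using aN_bB_le[of v] v G c0 by (simp add: G_eq)
    then have "- (\<alpha> * c2) / P \<le> norm v powr \<eta>" using P_pos by (simp add: field_simps)
    then have "d \<le> (norm v powr \<eta>) powr (1 / \<eta>)" unfolding d_def using m pos by (intro powr_mono2) auto
    then show "d \<le> norm v" using pos by (simp add: powr_powr)
    show "norm v \<le> \<tau>" using v by simp
    assume r: "r \<le> lam c v"
    have "0 \<le> (\<beta> - \<eta>) / (\<eta> - \<alpha>) * aN v" using aN_pos[of v] nonzero v pos by (simp add: less_imp_le)
    then have "e \<le> (\<beta> - \<eta>) / \<eta> * N v - \<beta> * c" using c0 unfolding N_aN by simp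
    from lam_lower[OF _ G r this e] have "\<alpha> * e / ((\<beta> - \<alpha>) * max 1 (- r)) \<le> - A v" using v by simp
    moreover have "a * norm v powr \<alpha> \<le> a * \<tau> powr \<alpha>" using v a pos by (intro mult_left_mono powr_mono2) auto
    moreover have "a * \<tau> powr \<alpha> = \<alpha> * e / ((\<beta> - \<alpha>) * max 1 (- r))" using consts_pos by (simp add: a_def)
    ultimately show "a * norm v powr \<alpha> \<le> - A v" "v \<in> ?Q" by auto
  qed
qed (auto simp: is_interval_1)

text \<open>On a ray with B > 0, \<open>G c\<close> is positive at radius \<tau> and eventually
  negative, hence crosses downward outside; \<rho> excludes the inner zero. Fibre points escape to
  infinity as \<open>B\<close> tends to 0 on the unit sphere, so here a lower bound on \<lambda>
  must also bound their norms.\<close>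

lemma plus_fibres: "fibres N A B \<alpha> \<eta> \<beta> C C' {v. \<rho> < norm v} ({v. A v < 0} \<inter> {v. 0 < B v}) (- 1) {cs<..<css}"
proof unfold_locales
  let ?W = "{v. A v < 0} \<inter> {v. 0 < B v}"
  have cont: "continuous_on S A" "continuous_on S B" for S by (intro C1_on_continuous C1)+
  show "open {v :: 'a. \<rho> < norm v}" by (intro open_Collect_less continuous_intros)
  show "open ?W" by (intro open_Int open_Collect_less continuous_intros cont)
  show "x *\<^sub>R u \<in> {v. \<rho> < norm v}"
    if "s *\<^sub>R u \<in> {v. \<rho> < norm v}" "0 < s" "s \<le> x" "x \<le> t" for u :: 'a and s t x
  proof -
    have "s * norm u \<le> x * norm u" using that by (intro mult_right_mono) auto
    then show ?thesis using that by auto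
  qed
  show "symset ?W" by (simp add: symset_def)
  show "t *\<^sub>R u \<in> ?W" if "u \<in> ?W" "0 < t" for u t
    using that by (simp add: scale mult_pos_neg)
  show "\<exists>t>0. t *\<^sub>R u \<in> {v. \<rho> < norm v} \<and> G c (t *\<^sub>R u) = 0" if c: "c \<in> {cs<..<css}" and u: "u \<in> ?W" for c u
  proof -
    have u0: "0 < norm u" using u nonzero by auto
    have b: "0 < bB u" using u pos by (simp add: bB_def)
    \<comment> \<open>After division by t^\<beta> only - bB u survives at infinity.\<close>
    have "((\<lambda>t. t powr (\<eta> - \<beta>) * aN u + t powr (- \<beta>) * (\<alpha> * c)) \<longlongrightarrow> 0 * aN u + 0 * (\<alpha> * c)) at_top"
      using pos by (intro tendsto_intros tendsto_neg_powr filterlim_ident) auto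
    then have "\<forall>\<^sub>F t in at_top. t powr (\<eta> - \<beta>) * aN u + t powr (- \<beta>) * (\<alpha> * c) < bB u"
      using b by (intro order_tendstoD(2)[where y = "0 * aN u + 0 * (\<alpha> * c)"]) auto
    then obtain T where T: "\<tau> / norm u \<le> T" "T powr (\<eta> - \<beta>) * aN u + T powr (- \<beta>) * (\<alpha> * c) < bB u"
      using eventually_happens[OF eventually_conj[OF _ eventually_ge_at_top[of "\<tau> / norm u"]]] by (auto simp: trivial_limit_at_top_linorder)
    have T0: "0 < T" using T(1) u0 consts_pos by (smt (verit) divide_pos_pos)
    have "T powr \<beta> * (T powr (\<eta> - \<beta>) * aN u + T powr (- \<beta>) * (\<alpha> * c)) < T powr \<beta> * bB u"
      using T(2) T0 by (intro mult_strict_left_mono) auto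
    then have GT: "G c (T *\<^sub>R u) < 0"
      using T0 by (simp add: G_eq aN_scale bB_scale distrib_left powr_add[symmetric] flip: mult.assoc)
    have "\<exists>t\<ge>\<tau> / norm u. t \<le> T \<and> G c (t *\<^sub>R u) = 0"
    proof (rule IVT2')
      show "0 \<le> G c ((\<tau> / norm u) *\<^sub>R u)"
        using G_ge[of "(\<tau> / norm u) *\<^sub>R u" c] c u0 consts_pos by (simp add: \<rho>_def)
    qed (use GT T in \<open>auto intro: G_fibre_continuous\<close>)
    then obtain t where t: "\<tau> / norm u \<le> t" "G c (t *\<^sub>R u) = 0" by blast
    have "\<tau> \<le> t * norm u" using t(1) u0 by (simp add: field_simps)
    moreover have "0 < t" using t(1) u0 consts_pos by (smt (verit) divide_pos_pos)
    ultimately show ?thesis using t consts_pos by (intro exI[of _ t]) (auto simp: \<rho>_def)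
  qed
  show "- 1 * G c (s *\<^sub>R v) < 0"
    if "c \<in> {cs<..<css}" "v \<in> ?W" "G c v = 0" "0 < s" "s < 1" "s *\<^sub>R v \<in> {v. \<rho> < norm v}" for c v s
  proof -
    have v0: "s *\<^sub>R v \<noteq> 0" using that nonzero by auto
    \<comment> \<open>Division by t^\<beta> makes the exponents negative, so the comparison is based
      at the inner of the two points, here \<open>s *\<^sub>R v\<close>.\<close>
    have "- (\<alpha> * c) * (1 - s powr \<beta>) < aN (s *\<^sub>R v) * (1 - s powr (\<beta> - \<eta>))"
      using that v0 pos by (intro powr_ratio large_ball aN_pos) auto
    moreover have "aN (s *\<^sub>R v) * s powr (\<beta> - \<eta>) = s powr \<beta> * aN v"
      using that by (simp add: aN_scale mult.commute flip: powr_add mult.assoc)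
    moreover have "bB v = aN v + \<alpha> * c" using that by (simp add: G_eq)
    ultimately show ?thesis using that by (simp add: G_eq bB_scale algebra_simps)
  qed
  show "0 < - 1 * G c (s *\<^sub>R v)"
    if "c \<in> {cs<..<css}" "v \<in> ?W" "v \<in> {v. \<rho> < norm v}" "G c v = 0" "1 < s" for c v s
  proof -
    have v0: "v \<noteq> 0" using that nonzero by auto
    have "- (\<alpha> * c) * (1 - (1 / s) powr \<beta>) < aN v * (1 - (1 / s) powr (\<beta> - \<eta>))"
      using that v0 pos by (intro powr_ratio large_ball aN_pos) auto
    then have "s powr \<beta> * (- (\<alpha> * c) * (1 - (1 / s) powr \<beta>)) < s powr \<beta> * (aN v * (1 - (1 / s) powr (\<beta> - \<eta>)))"
      using that by (intro mult_strict_left_mono) auto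
    moreover have "s powr \<beta> * (1 / s) powr \<beta> = 1" "s powr \<beta> * (1 / s) powr (\<beta> - \<eta>) = s powr \<eta>"
      using that by (simp_all add: powr_divide powr_diff)
    moreover from this have "s powr \<beta> * (- (\<alpha> * c) * (1 - (1 / s) powr \<beta>)) = - (\<alpha> * c) * (s powr \<beta> - 1)"
      "s powr \<beta> * (aN v * (1 - (1 / s) powr (\<beta> - \<eta>))) = aN v * (s powr \<beta> - s powr \<eta>)"
      by algebra+
    moreover have "bB v = aN v + \<alpha> * c" using that by (simp add: G_eq)
    ultimately show ?thesis using that by (simp add: G_eq aN_scale bB_scale) (simp add: algebra_simps)
  qed
  have half: "(\<beta> - \<eta>) / (2 * (\<eta> - \<alpha>)) * aN v \<le> (\<beta> - \<eta>) / \<eta> * N v - \<beta> * c" if "c < css" "\<rho> < norm v" for c v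
  proof -
    have "\<beta> * c \<le> \<beta> * css" using that pos by (intro mult_left_mono) auto
    also have "\<dots> = (\<beta> - \<eta>) / (2 * (\<eta> - \<alpha>)) * (\<kappa> * \<rho> powr \<eta>)" using pos by (simp add: css_def)
    also have "\<dots> \<le> (\<beta> - \<eta>) / (2 * (\<eta> - \<alpha>)) * aN v" using aN_ge_rho[of v] that pos by (intro mult_left_mono) auto
    finally have "\<beta> * c \<le> (\<beta> - \<eta>) / (2 * (\<eta> - \<alpha>)) * aN v" .
    moreover have "y / x * z = 2 * (y / (2 * x) * z)" for x y z :: real by simp
    ultimately show ?thesis unfolding N_aN by (smt (verit))
  qed
  show "\<beta> * c < (\<beta> - \<eta>) / \<eta> * N v" if "c \<in> {cs<..<css}" "v \<in> ?W" "v \<in> {v. \<rho> < norm v}" for c v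
  proof -
    have "0 < (\<beta> - \<eta>) / (2 * (\<eta> - \<alpha>)) * aN v" using aN_pos[of v] nonzero[of v] that pos by simp
    with half[of c v] that show ?thesis by simp
  qed
  fix c1 c2 r assume c1: "c1 \<in> {cs<..<css}" and c2: "c2 \<in> {cs<..<css}"
  \<comment> \<open>\<open>lam_lower\<close> gives - A v \<ge> \<mu> |v|^\<eta>. Against - A v \<le>
    C |v|^\<alpha> this bounds |v| by \<open>b\<close>; with |v| > \<rho> it yields
    \<open>a\<close>; and |v| \<le> b turns bB v \<ge> g0/2 into the homogeneous bound with factor
    \<open>q\<close>.\<close>
  define \<mu> where "\<mu> = \<alpha> * ((\<beta> - \<eta>) / (2 * (\<eta> - \<alpha>)) * \<kappa>) / ((\<beta> - \<alpha>) * max 1 (- r))"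
  define b where "b = (C / \<mu>) powr (1 / (\<eta> - \<alpha>))"
  define a where "a = \<mu> * \<rho> powr (\<eta> - \<alpha>)"
  define q where "q = g0 / 2 / b powr \<beta>"
  let ?Q = "{v. a * norm v powr \<alpha> \<le> - A v} \<inter> {v. q * norm v powr \<beta> \<le> bB v}"
  have \<mu>: "0 < \<mu>" using pos consts_pos by (simp add: \<mu>_def)
  have b: "0 < b" using \<mu> C_pos by (simp add: b_def)
  have a: "0 < a" using \<mu> consts_pos by (simp add: a_def)
  have q: "0 < q" using b consts_pos by (simp add: q_def)
  show "\<exists>a>0. \<exists>b>0. \<exists>d>0. \<exists>Q. closed Q \<and> (\<forall>v\<in>Q. \<forall>s>0. s *\<^sub>R v \<in> Q) \<and> Q - {0} \<subseteq> ?W \<and>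
    (\<forall>c\<in>{c1..c2}. \<forall>v\<in>?W \<inter> {v. \<rho> < norm v}. G c v = 0 \<longrightarrow> d \<le> norm v \<and>
      (r \<le> lam c v \<longrightarrow> norm v \<le> b \<and> a * norm v powr \<alpha> \<le> - A v \<and> v \<in> Q))"
  proof (rule exI[of _ a], rule conjI[OF a], rule exI[of _ b], rule conjI[OF b],
      rule exI[of _ \<rho>], rule conjI[OF consts_pos(3)], rule exI[of _ ?Q], intro conjI ballI allI impI)
    show "closed ?Q" by (intro closed_Int uminus_A_ge bB_ge_closed)
    show "s *\<^sub>R v \<in> ?Q" if "v \<in> ?Q" "0 < s" for v s
    proof -
      have "s powr \<alpha> * (a * norm v powr \<alpha>) \<le> s powr \<alpha> * - A v" "s powr \<beta> * (q * norm v powr \<beta>) \<le> s powr \<beta> * bB v"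
        using that by (intro mult_left_mono; auto)+
      then show ?thesis using that by (simp add: scale bB_scale powr_mult mult_ac)
    qed
    show "?Q - {0} \<subseteq> ?W"
    proof
      fix v assume v: "v \<in> ?Q - {0}"
      then have "0 < a * norm v powr \<alpha>" "0 < q * norm v powr \<beta>" using a q by simp_all
      with v have "A v < 0" "0 < bB v" by auto
      then show "v \<in> ?W" using pos by (auto simp: bB_def zero_less_mult_iff zero_less_divide_iff)
    qed
    fix c v assume c: "c \<in> {c1..c2}" and v: "v \<in> ?W \<inter> {v. \<rho> < norm v}" and G: "G c v = 0"
    then show "\<rho> \<le> norm v" by simp
    assume r: "r \<le> lam c v"
    have v0: "0 < norm v" using v consts_pos by auto
    have "(\<beta> - \<eta>) / (2 * (\<eta> - \<alpha>)) * (\<kappa> * norm v powr \<eta>) \<le> (\<beta> - \<eta>) / (2 * (\<eta> - \<alpha>)) * aN v"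
      using aN_ge[of v] pos by (intro mult_left_mono) auto
    also have "\<dots> \<le> (\<beta> - \<eta>) / \<eta> * N v - \<beta> * c" using half[of c v] c c2 v by simp
    finally have "\<alpha> * ((\<beta> - \<eta>) / (2 * (\<eta> - \<alpha>)) * (\<kappa> * norm v powr \<eta>)) / ((\<beta> - \<alpha>) * max 1 (- r)) \<le> - A v"
      using v v0 pos consts_pos by (intro lam_lower[OF _ G r]) auto
    then have A: "\<mu> * norm v powr \<eta> \<le> - A v" by (simp add: \<mu>_def mult_ac)
    have split: "norm v powr \<eta> = norm v powr (\<eta> - \<alpha>) * norm v powr \<alpha>" by (simp flip: powr_add)
    have "\<mu> * norm v powr (\<eta> - \<alpha>) * norm v powr \<alpha> \<le> C * norm v powr \<alpha>"
      using A A_le[of v] by (simp add: split)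
    then have "\<mu> * norm v powr (\<eta> - \<alpha>) \<le> C" using v0 by simp
    then have "norm v powr (\<eta> - \<alpha>) \<le> C / \<mu>" using \<mu> by (simp add: field_simps)
    then have "(norm v powr (\<eta> - \<alpha>)) powr (1 / (\<eta> - \<alpha>)) \<le> b"
      unfolding b_def using pos by (intro powr_mono2) auto
    then show nb: "norm v \<le> b" using pos by (simp add: powr_powr)
    have "a * norm v powr \<alpha> \<le> \<mu> * norm v powr (\<eta> - \<alpha>) * norm v powr \<alpha>"
      unfolding a_def using v \<mu> consts_pos pos by (intro mult_right_mono mult_left_mono powr_mono2) auto
    also have "\<dots> \<le> - A v" using A by (simp add: split)
    finally show Aa: "a * norm v powr \<alpha> \<le> - A v" .
    have "g0 \<le> 1 * (\<kappa> * \<rho> powr \<eta>)"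
      unfolding g0_def using pos consts_pos by (intro mult_right_mono) auto
    also have "\<dots> \<le> aN v" using aN_ge_rho[of v] v by simp
    finally have "g0 \<le> aN v" .
    moreover have "\<alpha> * cs \<le> \<alpha> * c" using c c1 pos by (intro mult_left_mono) auto
    then have "- (g0 / 2) \<le> \<alpha> * c" using pos by (simp add: cs_def)
    ultimately have "g0 / 2 \<le> bB v" using G by (simp add: G_eq)
    moreover have "q * norm v powr \<beta> \<le> q * b powr \<beta>" using nb q pos by (intro mult_left_mono powr_mono2) auto
    moreover have "q * b powr \<beta> = g0 / 2" using b by (simp add: q_def)
    ultimately show "v \<in> ?Q" using Aa by auto
  qed
qed (auto simp: is_interval_1)

section \<open>Comparison of the two families and the limit of vanishing energy\<close>

sublocale minus: fibres N A B \<alpha> \<eta> \<beta> C C' "{v. norm v < \<tau>}" "{v. A v < 0}" 1 "{cs<..<0}"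
  by (rule minus_fibres)

sublocale plus: fibres N A B \<alpha> \<eta> \<beta> C C' "{v. \<rho> < norm v}" "{v. A v < 0} \<inter> {v. 0 < B v}" "- 1" "{cs<..<css}"
  by (rule plus_fibres)

text \<open>Both fibre domains contain the annulus \<open>\<rho> < norm v < \<tau>\<close>, where \<open>G c\<close> is bounded below; hence \<open>lam c\<close>
  drops by a fixed amount between the radii \<open>3\<tau>/5\<close> and \<open>4\<tau>/5\<close>.\<close>

lemma plus_minus_gap:
  assumes c: "cs < c" "c < 0"
  shows "\<exists>\<delta>>0. \<forall>u. A u < 0 \<and> 0 < B u \<and> norm u = 1 \<longrightarrow> plus.Lf c u + \<delta> \<le> minus.Lf c u"
proof -
  \<comment> \<open>The length \<tau>/5 times a lower bound for the slope, from - A u \<le> C on the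
    unit sphere, x \<le> \<tau> and G c \<ge> g0/2.\<close>
  let ?\<delta> = "\<tau> / 5 * (\<alpha> / C * (\<tau> powr (- \<alpha> - 1) * (g0 / 2)))"
  have "plus.Lf c u + ?\<delta> \<le> minus.Lf c u" if u: "A u < 0" "0 < B u" "norm u = 1" for u
  proof -
  define s t where "s = 3 / 5 * \<tau>" and "t = 4 / 5 * \<tau>"
  have st: "0 < s" "s < t" "0 < t" "t < \<tau>" "\<rho> < s" "t - s = \<tau> / 5" using consts_pos by (auto simp: s_def t_def \<rho>_def)
  have "1 * lam c (s *\<^sub>R u) \<le> 1 * minus.Lf c u"
    using c u st by (intro minus.extremal) auto
  moreover have "- 1 * lam c (t *\<^sub>R u) \<le> - 1 * plus.Lf c u"
    using c u st consts_pos by (intro plus.extremal) auto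
  moreover have "lam c (t *\<^sub>R u) + ?\<delta> \<le> lam c (s *\<^sub>R u)"
  proof -
    have "\<exists>x>s. x < t \<and> lam c (t *\<^sub>R u) - lam c (s *\<^sub>R u) = (t - s) * (\<alpha> / A u * (x powr (- \<alpha> - 1) * G c (x *\<^sub>R u)))"
      using st u by (intro MVT2 fibre_derivative) auto
    then obtain x where x: "s < x" "x < t"
      and eq: "lam c (s *\<^sub>R u) - lam c (t *\<^sub>R u) = \<tau> / 5 * (\<alpha> / - A u * (x powr (- \<alpha> - 1) * G c (x *\<^sub>R u)))"
      unfolding st(6) by (force simp: algebra_simps)
    have G: "g0 / 2 \<le> G c (x *\<^sub>R u)" using x st u c by (intro G_ge) auto
    have xp: "\<tau> powr (- \<alpha> - 1) \<le> x powr (- \<alpha> - 1)" using x st pos by (intro powr_mono2') auto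
    have "- A u \<le> C" using A_le[of u] u by simp
    then have Cp: "\<alpha> / C \<le> \<alpha> / - A u" using pos u by (intro frac_le) auto
    have "?\<delta> \<le> \<tau> / 5 * (\<alpha> / - A u * (x powr (- \<alpha> - 1) * G c (x *\<^sub>R u)))"
      using consts_pos pos C_pos u by (intro mult_left_mono mult_mono G xp Cp) (auto simp: divide_nonneg_neg)
    then show ?thesis unfolding eq[symmetric] by simp
  qed
  ultimately show ?thesis by linarith
  qed
  moreover have "0 < ?\<delta>" using consts_pos pos C_pos by simp
  ultimately show ?thesis by blast
qed

text \<open>A set admissible for the smaller cone is admissible for the larger one, so the uniform
  gap on the unit sphere passes to the levels.\<close>

lemma plus_less_minus:
  assumes c: "cs < c" "c < 0" and k: "enat k \<le> cone_genus ({v. A v < 0} \<inter> {v. 0 < B v})" "1 \<le> k"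
  shows "plus.lev c k < minus.lev c k"
proof -
  obtain \<delta> where \<delta>: "0 < \<delta>" "\<forall>u. A u < 0 \<and> 0 < B u \<and> norm u = 1 \<longrightarrow> plus.Lf c u + \<delta> \<le> minus.Lf c u"
    using plus_minus_gap[OF c] by blast
  have cI: "c \<in> {cs<..<css}" "c \<in> {cs<..<0}" using c consts_pos by auto
  have "0 < \<delta> / 2" using \<delta> by simp
  then obtain M where M: "adm ({v. A v < 0} \<inter> {v. 0 < B v}) k M" "\<forall>u\<in>M. norm u = 1 \<and> plus.lev c k - \<delta> / 2 \<le> plus.Lf c u"
    using ls_functional.level_approx[OF plus.ls_functional_Lf[OF cI(1)] k] by blast
  have "plus.lev c k + \<delta> / 2 \<le> minus.lev c k"
  proof (rule ls_functional.levelI[OF minus.ls_functional_Lf[OF cI(2)]])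
    show "adm {v. A v < 0} k M" using M(1) by (rule adm_mono) auto
    fix u assume u: "u \<in> M"
    then have "A u < 0" "0 < B u" using M(1) by (auto simp: adm_def)
    moreover have "norm u = 1" "plus.lev c k - \<delta> / 2 \<le> plus.Lf c u" using M(2) u by auto
    ultimately show "plus.lev c k + \<delta> / 2 \<le> minus.Lf c u" using \<delta>(2)[rule_format, of u] by simp
  qed
  then show ?thesis using \<delta>(1) by simp
qed

text \<open>The maximum on each ray of one fixed compact set is tested at radius (-c)^(1/\<eta>),
  where the \<open>N\<close> term and the energy have the same order. Only positive powers of - c
  remain, which with negativity squeezes the level to 0.\<close>

lemma minus_tendsto_0:
  assumes k: "enat k \<le> cone_genus {v. A v < 0}" "1 \<le> k"
  shows "((\<lambda>c. minus.lev c k) \<longlongrightarrow> 0) (at_left 0)"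
proof -
  \<comment> \<open>This energy merely supplies a compact subset of the unit sphere, which stays
    fixed while c tends to 0.\<close>
  have c0: "cs / 2 \<in> {cs<..<0}" using consts_pos by auto
  obtain M where M: "adm {v. A v < 0} k M" "\<forall>u\<in>M. norm u = 1"
    using ls_functional.level_approx[OF minus.ls_functional_Lf[OF c0] k, of 1] by auto
  obtain a where a: "0 < a" "\<And>u. u \<in> M \<Longrightarrow> a \<le> - A u"
  proof -
    have "continuous_on M A" by (intro C1_on_continuous C1)
    then obtain x where "x \<in> M" "\<forall>u\<in>M. A u \<le> A x"
      using continuous_attains_sup[of M A] M(1) by (auto simp: adm_def)
    then show thesis using M(1) by (intro that[of "- A x"]) (auto simp: adm_def)
  qed
  define g where "g c = - (\<alpha> / a * ((C' / \<eta> + 1) * (- c) powr ((\<eta> - \<alpha>) / \<eta>) + C / \<beta> * (- c) powr ((\<beta> - \<alpha>) / \<eta>)))" for c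
  have ev0: "\<forall>\<^sub>F c in at_left 0. (c :: real) < 0" by (auto simp: eventually_at_filter)
  have lim: "((\<lambda>c :: real. - c) \<longlongrightarrow> 0) (at_left 0)" by (auto intro!: tendsto_eq_intros)
  have pw: "((\<lambda>c :: real. (- c) powr p) \<longlongrightarrow> 0) (at_left 0)" if "0 < p" for p
    by (rule tendsto_zero_powrI[OF lim tendsto_const _ that]) (use ev0 in eventually_elim, auto)
  have g: "(g \<longlongrightarrow> 0) (at_left 0)"
  proof -
    have "(g \<longlongrightarrow> - (\<alpha> / a * ((C' / \<eta> + 1) * 0 + C / \<beta> * 0))) (at_left 0)"
      unfolding g_def using pos by (intro tendsto_minus tendsto_mult_left tendsto_add pw) auto
    then show ?thesis by simp
  qed
  have "\<forall>\<^sub>F c in at_left 0. (- c) powr (1 / \<eta>) < \<tau>"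
    using order_tendstoD(2)[OF pw] pos consts_pos by simp
  moreover have "\<forall>\<^sub>F c in at_left 0. cs < c"
    using consts_pos by (intro order_tendstoD(1)[OF tendsto_ident_at]) auto
  ultimately have ev: "\<forall>\<^sub>F c in at_left 0. c \<in> {cs<..<0} \<and> (- c) powr (1 / \<eta>) < \<tau>"
    using ev0 by eventually_elim auto
  show ?thesis
  proof (rule tendsto_sandwich[OF _ _ g tendsto_const])
    show "\<forall>\<^sub>F c in at_left 0. minus.lev c k \<le> 0"
      using ev
    proof eventually_elim
      case (elim c)
      then show ?case using minus.lev_critical[OF _ k, of c] by (metis less_imp_le)
    qed
    show "\<forall>\<^sub>F c in at_left 0. g c \<le> minus.lev c k"
      using ev
    proof eventually_elim
      case (elim c)
      then have c: "c \<in> {cs<..<0}" by simp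
      show ?case
      proof (rule ls_functional.levelI[OF minus.ls_functional_Lf[OF c] M(1)])
        fix u assume u: "u \<in> M"
        define t where "t = (- c) powr (1 / \<eta>)"
        have t: "0 < t" "t < \<tau>" using elim by (auto simp: t_def)
        have tp: "t powr \<eta> = - c" "t powr (\<eta> - \<alpha>) = (- c) powr ((\<eta> - \<alpha>) / \<eta>)" "t powr (\<beta> - \<alpha>) = (- c) powr ((\<beta> - \<alpha>) / \<eta>)"
          using c pos by (auto simp: t_def powr_powr)
        have Au: "A u < 0" and nu: "norm u = 1" using u M by (auto simp: adm_def)
        have NB: "N u \<le> C'" "- B u \<le> C" using N_le[of u] B_le[of u] nu by auto
        have lam_eq: "lam c (t *\<^sub>R u) = - (\<alpha> / - A u * ((N u / \<eta> + 1) * t powr (\<eta> - \<alpha>) + - B u / \<beta> * t powr (\<beta> - \<alpha>)))"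
        proof -
          have "- c = t powr (\<eta> - \<alpha>) * t powr \<alpha>" "t powr \<eta> = t powr (\<eta> - \<alpha>) * t powr \<alpha>" "t powr \<beta> = t powr (\<beta> - \<alpha>) * t powr \<alpha>"
            using tp(1) by (simp_all flip: powr_add)
          then have "N (t *\<^sub>R u) / \<eta> - B (t *\<^sub>R u) / \<beta> - c = t powr \<alpha> * ((N u / \<eta> + 1) * t powr (\<eta> - \<alpha>) + - B u / \<beta> * t powr (\<beta> - \<alpha>))"
            using t by (simp add: scale algebra_simps)
          then show ?thesis using t by (simp add: lam_def scale)
        qed
        have "\<alpha> / - A u * ((N u / \<eta> + 1) * t powr (\<eta> - \<alpha>) + - B u / \<beta> * t powr (\<beta> - \<alpha>))
            \<le> \<alpha> / - A u * ((C' / \<eta> + 1) * t powr (\<eta> - \<alpha>) + C / \<beta> * t powr (\<beta> - \<alpha>))"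
          using NB pos Au by (intro mult_left_mono add_mono mult_right_mono divide_right_mono) (auto simp: divide_nonneg_neg)
        also have "\<dots> \<le> \<alpha> / a * ((C' / \<eta> + 1) * t powr (\<eta> - \<alpha>) + C / \<beta> * t powr (\<beta> - \<alpha>))"
        proof (rule mult_right_mono)
          show "\<alpha> / - A u \<le> \<alpha> / a" using a(2)[OF u] a(1) pos by (intro frac_le) auto
          show "0 \<le> (C' / \<eta> + 1) * t powr (\<eta> - \<alpha>) + C / \<beta> * t powr (\<beta> - \<alpha>)"
            using pos C_pos by (intro add_nonneg_nonneg mult_nonneg_nonneg) auto
        qed
        finally have "g c \<le> lam c (t *\<^sub>R u)" unfolding lam_eq g_def tp by simp
        moreover have "1 * lam c (t *\<^sub>R u) \<le> 1 * minus.Lf c u"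
          using c t nu Au by (intro minus.extremal) auto
        ultimately show "g c \<le> minus.Lf c u" by simp
      qed
    qed
  qed
qed

text \<open>At a zero of \<open>G c\<close> the difference aN v - bB v equals - \<alpha> c, and in
  the small ball it controls |v|^\<eta>; so critical points of the first family shrink to 0 with the
  energy.\<close>

lemma minus_norm_bound:
  assumes "v \<noteq> 0" "norm v < \<tau>" "G c v = 0"
  shows "norm v powr \<eta> \<le> \<alpha> / ((1 - \<eta> / \<beta>) * \<kappa>) * - c"
proof -
  have k: "0 < (1 - \<eta> / \<beta>)" using pos exponents by simp
  have "(1 - \<eta> / \<beta>) * (\<kappa> * norm v powr \<eta>) \<le> (1 - \<eta> / \<beta>) * aN v"
    using aN_ge[of v] k by (intro mult_left_mono) auto
  also have "\<dots> \<le> aN v - bB v" using assms by (intro aN_bB_ge) auto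
  also have "\<dots> = \<alpha> * - c" using assms(3) by (simp add: G_eq)
  finally have "((1 - \<eta> / \<beta>) * \<kappa>) * norm v powr \<eta> \<le> \<alpha> * - c" by (simp add: mult_ac)
  moreover have K: "0 < (1 - \<eta> / \<beta>) * \<kappa>" using k consts_pos by simp
  ultimately have "norm v powr \<eta> \<le> (\<alpha> * - c) / ((1 - \<eta> / \<beta>) * \<kappa>)"
    by (simp only: pos_le_divide_eq[OF K] mult.commute[of "norm v powr \<eta>"])
  then show ?thesis by (simp only: times_divide_eq_left)
qed

end

theorem theorem1p5:
  fixes N A B :: "'a::banach \<Rightarrow> real"
    and \<alpha> \<eta> \<beta> C C' :: real
    and \<Phi> :: "real \<Rightarrow> 'a \<Rightarrow> real"
    and negA posB :: "'a set"
  assumes "uniformly_convex TYPE('a)"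
    and "C1_on (UNIV - {0}) (norm :: 'a \<Rightarrow> real)"
    and "1 < \<alpha>" "\<alpha> < \<eta>" "\<eta> < \<beta>"
    and "C1_on UNIV N" "C1_on UNIV A" "C1_on UNIV B"
    and "even_functional N" "even_functional A" "even_functional B"
    and "homogeneous \<eta> N" "homogeneous \<alpha> A" "homogeneous \<beta> B"
    and Phi: "\<Phi> = Phi \<eta> \<alpha> \<beta> N A B"
    and "C > 0" "C' > 0"
    and "\<And>u. N u \<le> C' * norm u powr \<eta>"
    and "\<And>u. N u \<ge> inverse C * norm u powr \<eta>"
    and "\<And>u. \<bar>A u\<bar> \<le> C * norm u powr \<alpha>"
    and "\<And>u. \<bar>B u\<bar> \<le> C * norm u powr \<beta>"
    and PS: "\<And>(lam :: nat \<Rightarrow> real) (u :: nat \<Rightarrow> 'a).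
           bounded (range lam) \<Longrightarrow> bounded (range u) \<Longrightarrow>
           bounded (range (\<lambda>n. \<Phi> (lam n) (u n))) \<Longrightarrow>
           (\<lambda>n. fderiv (\<Phi> (lam n)) (u n)) \<longlonglongrightarrow> 0 \<Longrightarrow>
           \<exists>r. strict_mono r \<and> convergent (u \<circ> r)"
    and negA: "negA = {u. A u < 0}"
    and posB: "posB = {u. B u > 0}"
  shows "\<exists>cs css :: real. cs < 0 \<and> 0 < css \<and>
    (\<exists>(lm :: real \<Rightarrow> nat \<Rightarrow> real) (v :: real \<Rightarrow> nat \<Rightarrow> 'a)
      (lp :: real \<Rightarrow> nat \<Rightarrow> real) (u :: real \<Rightarrow> nat \<Rightarrow> 'a).
      \<comment> \<open>i\<close>
      (\<forall>k c. 1 \<le> k \<and> enat k \<le> cone_genus negA \<and> c \<in> {cs<..<0} \<longrightarrow>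
         lm c k < 0 \<and> v c k \<in> negA \<and>
         \<Phi> (lm c k) (v c k) = c \<and> fderiv (\<Phi> (lm c k)) (v c k) = 0) \<and>
      \<comment> \<open>ii\<close>
      (\<forall>k. 1 \<le> k \<and> enat k \<le> cone_genus negA \<longrightarrow>
         continuous_on {cs<..<0} (\<lambda>c. lm c k) \<and>
         strict_mono_on {cs<..<0} (\<lambda>c. lm c k) \<and>
         ((\<lambda>c. lm c k) \<longlongrightarrow> 0) (at_left 0)) \<and>
      \<comment> \<open>iii\<close>
      (cone_genus negA = \<infinity> \<longrightarrow>
         (\<forall>c\<in>{cs<..<0}. (\<forall>k\<ge>1. lm c k \<ge> lm c (k + 1)) \<and>
            filterlim (\<lambda>k. lm c k) at_bot sequentially)) \<and>
      \<comment> \<open>iv\<close>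
      (cone_genus negA = \<infinity> \<longrightarrow>
         (\<forall>lam<0.
            (\<exists>(w :: nat \<Rightarrow> 'a) (c :: nat \<Rightarrow> real) (k :: nat \<Rightarrow> nat).
               (\<forall>n. w n \<in> negA \<and> c n \<in> {cs<..<0} \<and> 1 \<le> k n) \<and>
               c \<longlonglongrightarrow> 0 \<and> filterlim k at_top sequentially \<and>
               (\<forall>n. lam = lm (c n) (k n) \<and> \<Phi> lam (w n) = c n \<and> fderiv (\<Phi> lam) (w n) = 0) \<and>
               w \<longlonglongrightarrow> 0) \<and>
            bifurcation_point \<Phi> lam)) \<and>
      \<comment> \<open>v\<close>
      (\<forall>k c. 1 \<le> k \<and> enat k \<le> cone_genus (negA \<inter> posB) \<and> c \<in> {cs<..<css} \<longrightarrow>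
         lp c k < 0 \<and> u c k \<in> negA \<inter> posB \<and>
         \<Phi> (lp c k) (u c k) = c \<and> fderiv (\<Phi> (lp c k)) (u c k) = 0) \<and>
      (\<forall>k c. 1 \<le> k \<and> enat k \<le> cone_genus (negA \<inter> posB) \<and> c \<in> {cs<..<0} \<longrightarrow>
         lp c k < lm c k) \<and>
      \<comment> \<open>vi\<close>
      (\<forall>k. 1 \<le> k \<and> enat k \<le> cone_genus (negA \<inter> posB) \<longrightarrow>
         continuous_on {cs<..<css} (\<lambda>c. lp c k) \<and>
         strict_mono_on {cs<..<css} (\<lambda>c. lp c k)) \<and>
      \<comment> \<open>vii\<close>
      (cone_genus (negA \<inter> posB) = \<infinity> \<longrightarrow>
         (\<forall>c\<in>{cs<..<css}. (\<forall>k\<ge>1. lp c k \<ge> lp c (k + 1)) \<and>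
            filterlim (\<lambda>k. lp c k) at_bot sequentially)))"
proof -
  interpret setting N A B \<alpha> \<eta> \<beta> C C'
    by unfold_locales (use assms in \<open>auto simp: Phi\<close>)
  have W: "negA = {v. A v < 0}" "posB = {v. 0 < B v}" using negA posB by auto
  let ?Wm = "{v. A v < 0}" and ?Wp = "{v. A v < 0} \<inter> {v. 0 < B v}"
  have m_ex: "\<exists>v. A v < 0 \<and> norm v < \<tau> \<and> G c v = 0 \<and> minus.lev c k < 0 \<and> \<Phi> (minus.lev c k) v = c \<and> fderiv (\<Phi> (minus.lev c k)) v = 0"
    if c: "c \<in> {cs<..<0}" and k: "1 \<le> k" "enat k \<le> cone_genus ?Wm" for c k
  proof -
    obtain v where "v \<in> ?Wm" "v \<in> {v. norm v < \<tau>}" "G c v = 0" "minus.lev c k < 0"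
      "Phi \<eta> \<alpha> \<beta> N A B (minus.lev c k) v = c" "DPhi (minus.lev c k) v = 0"
      by (rule minus.lev_critical[OF c k(2,1)])
    then show ?thesis unfolding Phi by blast
  qed
  have p_ex: "\<exists>v. v \<in> ?Wp \<and> plus.lev c k < 0 \<and> \<Phi> (plus.lev c k) v = c \<and> fderiv (\<Phi> (plus.lev c k)) v = 0"
    if c: "c \<in> {cs<..<css}" and k: "1 \<le> k" "enat k \<le> cone_genus ?Wp" for c k
  proof -
    obtain v where "v \<in> ?Wp" "v \<in> {v. \<rho> < norm v}" "G c v = 0" "plus.lev c k < 0"
      "Phi \<eta> \<alpha> \<beta> N A B (plus.lev c k) v = c" "DPhi (plus.lev c k) v = 0"
      by (rule plus.lev_critical[OF c k(2,1)])
    then show ?thesis unfolding Phi by blast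
  qed
  \<comment> \<open>The choice records the ball and \<open>G c v = 0\<close>, because the
    convergence of critical points to 0 rests on them.\<close>
  define v where "v c k = (SOME v. A v < 0 \<and> norm v < \<tau> \<and> G c v = 0 \<and> minus.lev c k < 0 \<and>
    \<Phi> (minus.lev c k) v = c \<and> fderiv (\<Phi> (minus.lev c k)) v = 0)" for c k
  define u where "u c k = (SOME v. v \<in> ?Wp \<and> plus.lev c k < 0 \<and> \<Phi> (plus.lev c k) v = c \<and> fderiv (\<Phi> (plus.lev c k)) v = 0)" for c k
  have v: "A (v c k) < 0 \<and> norm (v c k) < \<tau> \<and> G c (v c k) = 0 \<and> minus.lev c k < 0 \<and>
    \<Phi> (minus.lev c k) (v c k) = c \<and> fderiv (\<Phi> (minus.lev c k)) (v c k) = 0"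
    if "c \<in> {cs<..<0}" "1 \<le> k" "enat k \<le> cone_genus ?Wm" for c k
    unfolding v_def by (rule someI_ex) (rule m_ex[OF that])
  have u: "u c k \<in> ?Wp \<and> plus.lev c k < 0 \<and> \<Phi> (plus.lev c k) (u c k) = c \<and> fderiv (\<Phi> (plus.lev c k)) (u c k) = 0"
    if "c \<in> {cs<..<css}" "1 \<le> k" "enat k \<le> cone_genus ?Wp" for c k
    unfolding u_def by (rule someI_ex) (rule p_ex[OF that])
  have iv: "\<exists>w c k. (\<forall>n :: nat. w n \<in> ?Wm \<and> c n \<in> {cs<..<0} \<and> 1 \<le> k n) \<and> c \<longlonglongrightarrow> 0 \<and> filterlim k at_top sequentially \<and>
      (\<forall>n. lam = minus.lev (c n) (k n) \<and> \<Phi> lam (w n) = c n \<and> fderiv (\<Phi> lam) (w n) = 0) \<and> w \<longlonglongrightarrow> 0"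
    if inf: "cone_genus ?Wm = \<infinity>" and lam: "lam < 0" for lam
  proof -
    have gen: "enat k \<le> cone_genus ?Wm" for k by (simp add: inf)
    have frac: "cs < cs / real (n + 2)" "cs / real (n + 2) < 0" for n
    proof -
      have "real (n + 1) * cs < 0" using consts_pos(5) by (intro mult_pos_neg) auto
      then show "cs < cs / real (n + 2)" by (simp add: field_simps)
      show "cs / real (n + 2) < 0" using consts_pos(5) by (intro divide_neg_pos) auto
    qed
    \<comment> \<open>The parameter is hit by the intermediate value theorem in the energy: at cs /
      (n + 2) a large index pushes the level to \<open>lam\<close> or below, and for that index the
      level tends to 0 > \<open>lam\<close> as c tends to 0.\<close>
    have "\<exists>c k. cs / real (n + 2) \<le> c \<and> c < 0 \<and> n + 1 \<le> k \<and> minus.lev c k = lam" for n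
    proof -
      define c0 where "c0 = cs / real (n + 2)"
      have c0: "c0 \<in> {cs<..<0}" using frac[of n] by (simp add: c0_def)
      have "\<forall>\<^sub>F k in sequentially. minus.lev c0 k \<le> lam"
        using ls_functional.level_at_bot[OF minus.ls_functional_Lf[OF c0] inf] by (simp add: filterlim_at_bot)
      then obtain k where k: "n + 1 \<le> k" "minus.lev c0 k \<le> lam"
        using eventually_happens[OF eventually_conj[OF _ eventually_ge_at_top[of "n + 1"]]] by auto
      have "\<forall>\<^sub>F c in at_left 0. lam < minus.lev c k"
        using order_tendstoD(1)[OF minus_tendsto_0[OF gen] lam, of k] k(1) by simp
      moreover have "\<forall>\<^sub>F c in at_left 0. c0 < c \<and> c < (0 :: real)"
        using eventually_at_left_real[of c0 0] c0 by simp
      ultimately have "\<forall>\<^sub>F c in at_left 0. lam < minus.lev c k \<and> c0 < c \<and> c < (0 :: real)" by eventually_elim auto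
      then obtain c1 where c1: "lam < minus.lev c1 k" "c0 < c1" "c1 < 0"
        using eventually_happens'[OF trivial_limit_at_left_real] by blast
      have "\<exists>c\<ge>c0. c \<le> c1 \<and> minus.lev c k = lam"
      proof (rule IVT')
        show "continuous_on {c0..c1} (\<lambda>c. minus.lev c k)"
          using c0 c1 k(1) by (intro continuous_on_subset[OF minus.lev_continuous[OF gen]]) auto
      qed (use k c1 in auto)
      with c1 k(1) show ?thesis by (fastforce simp: c0_def)
    qed
    then obtain c k where ck: "\<And>n. cs / real (n + 2) \<le> c n" "\<And>n. c n < 0" "\<And>n. n + 1 \<le> k n" "\<And>n. minus.lev (c n) (k n) = lam"
      by metis
    have cI: "c n \<in> {cs<..<0}" for n
      using less_le_trans[OF frac(1) ck(1)[of n]] ck(2)[of n] by simp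
    have k1: "1 \<le> k n" for n using ck(3)[of n] by simp
    have V: "A (v (c n) (k n)) < 0" "norm (v (c n) (k n)) < \<tau>" "G (c n) (v (c n) (k n)) = 0"
      "\<Phi> lam (v (c n) (k n)) = c n" "fderiv (\<Phi> lam) (v (c n) (k n)) = 0" for n
      using v[OF cI[of n] k1[of n] gen] unfolding ck(4) by auto
    have cs_lim: "(\<lambda>n. cs / real (n + 2)) \<longlonglongrightarrow> 0"
      using LIMSEQ_ignore_initial_segment[OF lim_const_over_n[of cs], of 2] by simp
    have c_lim: "c \<longlonglongrightarrow> 0"
      by (rule tendsto_sandwich[OF _ _ cs_lim tendsto_const]) (intro always_eventually allI less_imp_le ck)+
    have k_lim: "filterlim k at_top sequentially"
      using ck(3) by (intro filterlim_at_top_mono[OF filterlim_ident]) (auto intro!: always_eventually simp: Suc_le_eq less_imp_le)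
    define K where "K = \<alpha> / ((1 - \<eta> / \<beta>) * \<kappa>)"
    have w_powr: "norm (v (c n) (k n)) \<le> (K * - c n) powr (1 / \<eta>)" for n
    proof -
      have "norm (v (c n) (k n)) powr \<eta> \<le> K * - c n"
        unfolding K_def using V(1-3)[of n] nonzero by (intro minus_norm_bound) auto
      then have "(norm (v (c n) (k n)) powr \<eta>) powr (1 / \<eta>) \<le> (K * - c n) powr (1 / \<eta>)"
        using pos by (intro powr_mono2) auto
      then show ?thesis using pos by (simp add: powr_powr)
    qed
    have K0: "0 < K" using pos exponents consts_pos by (simp add: K_def)
    have "(\<lambda>n. K * - c n) \<longlonglongrightarrow> 0" using tendsto_mult_left[OF tendsto_minus[OF c_lim], of K] by simp
    then have "(\<lambda>n. (K * - c n) powr (1 / \<eta>)) \<longlonglongrightarrow> 0"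
    proof (rule tendsto_zero_powrI[OF _ tendsto_const])
      have "0 \<le> K * - c n" for n using K0 ck(2)[of n] by (intro mult_nonneg_nonneg) auto
      then show "\<forall>\<^sub>F n in sequentially. 0 \<le> K * - c n" by simp
    qed (use pos in auto)
    then have w_lim: "(\<lambda>n. v (c n) (k n)) \<longlonglongrightarrow> 0"
      by (rule Lim_null_comparison[rotated]) (use w_powr in auto)
    show ?thesis
      by (rule exI[of _ "\<lambda>n. v (c n) (k n)"], rule exI[of _ c], rule exI[of _ k])
        (use V cI k1 c_lim k_lim w_lim ck(4) in auto)
  qed
  have bif: "bifurcation_point \<Phi> lam" if inf: "cone_genus ?Wm = \<infinity>" and lam: "lam < 0" for lam
  proof -
    obtain w where w: "\<And>n :: nat. w n \<in> ?Wm" "\<And>n. fderiv (\<Phi> lam) (w n) = 0" "w \<longlonglongrightarrow> 0"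
      using iv[OF inf lam] by blast
    then show ?thesis unfolding bifurcation_point_def
      using nonzero by (intro exI[of _ "\<lambda>n. lam"] exI[of _ w]) auto
  qed
  show ?thesis
    unfolding W
  proof (rule exI[of _ cs], rule exI[of _ css], rule conjI[OF consts_pos(5)], rule conjI[OF consts_pos(6)],
      rule exI[of _ minus.lev], rule exI[of _ v], rule exI[of _ plus.lev], rule exI[of _ u],
      intro conjI allI impI ballI; (elim conjE)?)
    fix k c assume "1 \<le> k" "enat k \<le> cone_genus ?Wm" "c \<in> {cs<..<0}"
    then show "minus.lev c k < 0" "v c k \<in> ?Wm" "\<Phi> (minus.lev c k) (v c k) = c" "fderiv (\<Phi> (minus.lev c k)) (v c k) = 0"
      using v by auto
  next
    fix k assume k: "1 \<le> k" "enat k \<le> cone_genus ?Wm"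
    show "continuous_on {cs<..<0} (\<lambda>c. minus.lev c k)" by (rule minus.lev_continuous[OF k(2,1)])
    show "strict_mono_on {cs<..<0} (\<lambda>c. minus.lev c k)"
      using minus.lev_less[OF _ _ _ k(2,1)] by (auto intro!: strict_mono_onI)
    show "((\<lambda>c. minus.lev c k) \<longlongrightarrow> 0) (at_left 0)" by (rule minus_tendsto_0[OF k(2,1)])
  next
    fix c and k :: nat assume "cone_genus ?Wm = \<infinity>" "c \<in> {cs<..<0}" "1 \<le> k"
    then show "minus.lev c (k + 1) \<le> minus.lev c k"
      by (intro ls_functional.level_antimono[OF minus.ls_functional_Lf]) auto
  next
    fix c assume "cone_genus ?Wm = \<infinity>" "c \<in> {cs<..<0}"
    then show "filterlim (minus.lev c) at_bot sequentially"
      by (intro ls_functional.level_at_bot[OF minus.ls_functional_Lf])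
  next
    fix lam :: real assume "cone_genus ?Wm = \<infinity>" "lam < 0"
    then show "\<exists>w c k. (\<forall>n :: nat. w n \<in> ?Wm \<and> c n \<in> {cs<..<0} \<and> 1 \<le> k n) \<and> c \<longlonglongrightarrow> 0 \<and> filterlim k at_top sequentially \<and>
      (\<forall>n. lam = minus.lev (c n) (k n) \<and> \<Phi> lam (w n) = c n \<and> fderiv (\<Phi> lam) (w n) = 0) \<and> w \<longlonglongrightarrow> 0"
      and "bifurcation_point \<Phi> lam"
      by (rule iv, rule bif)
  next
    fix k c assume "1 \<le> k" "enat k \<le> cone_genus ?Wp" "c \<in> {cs<..<css}"
    then show "plus.lev c k < 0" "u c k \<in> ?Wp" "\<Phi> (plus.lev c k) (u c k) = c" "fderiv (\<Phi> (plus.lev c k)) (u c k) = 0"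
      using u by blast+
  next
    fix k c assume "1 \<le> k" "enat k \<le> cone_genus ?Wp" "c \<in> {cs<..<0}"
    then show "plus.lev c k < minus.lev c k" by (intro plus_less_minus) auto
  next
    fix k assume k: "1 \<le> k" "enat k \<le> cone_genus ?Wp"
    show "continuous_on {cs<..<css} (\<lambda>c. plus.lev c k)" by (rule plus.lev_continuous[OF k(2,1)])
    show "strict_mono_on {cs<..<css} (\<lambda>c. plus.lev c k)"
      using plus.lev_less[OF _ _ _ k(2,1)] by (auto intro!: strict_mono_onI)
  next
    fix c and k :: nat assume "cone_genus ?Wp = \<infinity>" "c \<in> {cs<..<css}" "1 \<le> k"
    then show "plus.lev c (k + 1) \<le> plus.lev c k"
      by (intro ls_functional.level_antimono[OF plus.ls_functional_Lf]) auto
  next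
    fix c assume "cone_genus ?Wp = \<infinity>" "c \<in> {cs<..<css}"
    then show "filterlim (plus.lev c) at_bot sequentially"
      by (intro ls_functional.level_at_bot[OF plus.ls_functional_Lf])
  qed
qed

end
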